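(* Let $1\le p<\infty$, $0<q<\infty$ and $\nu\in\mathcal{D}\cap\widehat{\mathcal{D}}_q$. Then there exist positive constants $C_1$ and $C_2$ depending only on $p$, $q$ and $\nu$ such that $$\|f'\|_{A^{p,q}_\nu}^q\le C_1\left(F_1(f)+F_2(f)\right)\le C_2\left(\|f'\|_{A^{p,q}_\nu}^q+\|f\|_{H^p}^q\right),\quad f\in H^p,$$ where $$F_1(f)=\int_0^1\left(\int_0^{2\pi}\left(\int_0^{2\pi}|f(e^{i\theta})|\,d\mu_{re^{it}}(\theta)-|f(re^{it})|\right)^p dt\right)^{q/p}\frac{\nu(r)}{(1-r)^q}\,dr$$ and $$F_2(f)=\int_0^1\left(\int_0^{2\pi}\left(\int_0^{2\pi}\left||f(e^{i\theta})|-\int_0^{2\pi}|f(e^{is})|\,d\mu_{re^{it}}(s)\right|d\mu_{re^{it}}(\theta)\right)^p dt\right)^{q/p}\frac{\nu(r)}{(1-r)^q}\,dr.$$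
   Context: $\mathbb{D}$ is the open unit disc of $\mathbb{C}$, $\mathbb{T}$ its boundary, and $\mathcal{H}(\mathbb{D})$ the set of analytic functions in $\mathbb{D}$. For $f\in\mathcal{H}(\mathbb{D})$, $0<p<\infty$ and $0\le r<1$ let $M_p(r,f)=\left(\frac1{2\pi}\int_0^{2\pi}|f(re^{i\theta})|^p\,d\theta\right)^{1/p}$. The Hardy space $H^p$ consists of $f\in\mathcal{H}(\mathbb{D})$ with $\|f\|_{H^p}=\sup_{0\le r<1}M_p(r,f)<\infty$; for $f\in H^p$, $f(e^{i\theta})$ denotes the non-tangential limit, which exists almost everywhere. A weight is a function $\nu:\mathbb{D}\to[0,\infty)$ that is integrable over $\mathbb{D}$ and radial, $\nu(z)=\nu(|z|)$. Put $\widehat\nu(z)=\widehat\nu(|z|)=\int_{|z|}^1\nu(s)\,ds$; it is understood that $\widehat\nu(r)>0$ for all $0\le r<1$. Write $\nu\in\widehat{\mathcal{D}}$ if there is $C=C(\nu)>0$ with $\widehat\nu(r)\le C\,\widehat\nu\left(\frac{1+r}{2}\right)$ for all $0\le r<1$. Write $\nu\in\check{\mathcal{D}}$ if there are $K=K(\nu)>1$ and $C=C(\nu)>1$ with $\widehat\nu(r)\ge C\,\widehat\nu\left(1-\frac{1-r}{K}\right)$ for all $0\le r<1$. Set $\mathcal{D}=\widehat{\mathcal{D}}\cap\check{\mathcal{D}}$. For $0<q<\infty$, $\widehat{\mathcal{D}}_q$ is the subclass of those $\nu\in\widehat{\mathcal{D}}$ with $$\sup_{0\le r<1}\frac{(1-r)^q}{\widehat\nu(r)}\int_0^r\frac{\nu(s)}{(1-s)^q}\,ds<\infty.$$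 For $g\in\mathcal{H}(\mathbb{D})$, $\|g\|_{A^{p,q}_\nu}^q=\int_0^1M_p(r,g)^q\,\nu(r)\,dr\in[0,\infty]$. For $z\in\mathbb{D}$, $\mu_z$ is the measure on $[0,2\pi)$ given by $d\mu_z(\theta)=\frac{1-|z|^2}{|e^{i\theta}-z|^2}\,\frac{d\theta}{2\pi}$. The expressions in the chain may take the value $+\infty$. *)

theory Defs
  imports "HOL-Complex_Analysis.Complex_Analysis"
begin

text \<open>All one-dimensional integrals are taken with respect to Lebesgue (not Borel) measure, so that
  Lebesgue measurable weights and almost everywhere defined boundary functions are covered.\<close>

subsection \<open>Hardy spaces\<close>

definition integral_mean :: "real \<Rightarrow> real \<Rightarrow> (complex \<Rightarrow> complex) \<Rightarrow> real" where
  "integral_mean p r f =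
     (1 / (2 * pi) * (LINT \<theta>:{0..<2*pi}|lebesgue. norm (f (of_real r * cis \<theta>)) powr p)) powr (1 / p)"

definition hardy_space :: "real \<Rightarrow> (complex \<Rightarrow> complex) set" where
  "hardy_space p =
     {f. f holomorphic_on ball 0 1 \<and> bdd_above ((\<lambda>r. integral_mean p r f) ` {0..<1})}"

definition hardy_norm :: "real \<Rightarrow> (complex \<Rightarrow> complex) \<Rightarrow> real" where
  "hardy_norm p f = (SUP r\<in>{0..<1}. integral_mean p r f)"

definition stolz_region :: "real \<Rightarrow> complex \<Rightarrow> complex set" where
  "stolz_region \<alpha> \<zeta> = {z \<in> ball 0 1. norm (z - \<zeta>) < \<alpha> * (1 - norm z)}"

definition has_nontangential_limit :: "(complex \<Rightarrow> complex) \<Rightarrow> complex \<Rightarrow> complex \<Rightarrow> bool" where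
  "has_nontangential_limit f \<zeta> L \<longleftrightarrow>
     (\<forall>\<alpha>>1. (f \<longlongrightarrow> L) (at \<zeta> within stolz_region \<alpha> \<zeta>))"

text \<open>The boundary function \<open>\<theta> \<mapsto> f(e\<^sup>i\<^sup>\<theta>)\<close>. Where no non-tangential limit exists (a null set for
  \<open>f\<close> in a Hardy space) its value is one fixed unspecified number. The values that \<open>f\<close> itself takes
  off the open unit disc play no role.\<close>

definition boundary_value :: "(complex \<Rightarrow> complex) \<Rightarrow> real \<Rightarrow> complex" where
  "boundary_value f \<theta> = (THE L. has_nontangential_limit f (cis \<theta>) L)"

subsection \<open>Radial weights\<close>

text \<open>Integrability over the disc only controls \<open>s * \<nu> s\<close> near \<open>s = 0\<close>, so the tail integral is
  \<open>ennreal\<close>-valued: it may be infinite at \<open>0\<close>, which is ruled out by the doubling condition below.\<close>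

definition tail :: "(complex \<Rightarrow> real) \<Rightarrow> real \<Rightarrow> ennreal" where
  "tail \<nu> r = (\<integral>\<^sup>+s\<in>{r..<1}. ennreal (\<nu> (of_real s)) \<partial>lebesgue)"

definition weight :: "(complex \<Rightarrow> real) \<Rightarrow> bool" where
  "weight \<nu> \<longleftrightarrow>
     (\<forall>z\<in>ball 0 1. 0 \<le> \<nu> z) \<and>
     set_integrable lebesgue (ball 0 1) \<nu> \<and>
     (\<forall>z\<in>ball 0 1. \<nu> z = \<nu> (of_real (norm z))) \<and>
     (\<forall>r\<in>{0..<1}. 0 < tail \<nu> r)"

definition D_hat :: "(complex \<Rightarrow> real) set" where
  "D_hat = {\<nu>. weight \<nu> \<and>
     (\<exists>C>0. \<forall>r\<in>{0..<1}. tail \<nu> r \<le> ennreal C * tail \<nu> ((1 + r) / 2))}"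

definition D_check :: "(complex \<Rightarrow> real) set" where
  "D_check = {\<nu>. weight \<nu> \<and>
     (\<exists>K>1. \<exists>C>1. \<forall>r\<in>{0..<1}. tail \<nu> r \<ge> ennreal C * tail \<nu> (1 - (1 - r) / K))}"

definition D_two_sided :: "(complex \<Rightarrow> real) set" where
  "D_two_sided = D_hat \<inter> D_check"

definition D_hat_sub :: "real \<Rightarrow> (complex \<Rightarrow> real) set" where
  "D_hat_sub q = {\<nu> \<in> D_hat.
     (SUP r\<in>{0..<1}. ennreal ((1 - r) powr q) / tail \<nu> r *
        (\<integral>\<^sup>+s\<in>{0..<r}. ennreal (\<nu> (of_real s) / (1 - s) powr q) \<partial>lebesgue)) < \<infinity>}"

subsection \<open>The three quantities being compared\<close>

text \<open>The \<open>q\<close>-th power of the mixed norm.\<close>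

definition mixed_norm_power ::
    "real \<Rightarrow> real \<Rightarrow> (complex \<Rightarrow> real) \<Rightarrow> (complex \<Rightarrow> complex) \<Rightarrow> ennreal" where
  "mixed_norm_power p q \<nu> g =
     (\<integral>\<^sup>+r\<in>{0..<1}. ennreal (integral_mean p r g powr q * \<nu> (of_real r)) \<partial>lebesgue)"

definition poisson_measure :: "complex \<Rightarrow> real measure" where
  "poisson_measure z = density (lebesgue_on {0..<2*pi})
     (\<lambda>\<theta>. ennreal ((1 - (norm z)\<^sup>2) / (norm (cis \<theta> - z))\<^sup>2 / (2 * pi)))"

definition poisson_mean_norm :: "(complex \<Rightarrow> complex) \<Rightarrow> complex \<Rightarrow> real" where
  "poisson_mean_norm f z = (LINT \<theta>|poisson_measure z. norm (boundary_value f \<theta>))"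

text \<open>For \<open>f\<close> in the Hardy space with exponent \<open>p \<ge> 1\<close> all inner integrals below are finite, so they
  are real-valued, and the difference in \<open>F1\<close> is nonnegative since \<open>\<bar>f\<bar>\<close> is bounded by the Poisson
  integral of its boundary function. Only the integral over \<open>r\<close> can be infinite.\<close>

definition F1 :: "real \<Rightarrow> real \<Rightarrow> (complex \<Rightarrow> real) \<Rightarrow> (complex \<Rightarrow> complex) \<Rightarrow> ennreal" where
  "F1 p q \<nu> f =
     (\<integral>\<^sup>+r\<in>{0..<1}. ennreal (
        (LINT t:{0..<2*pi}|lebesgue.
           (poisson_mean_norm f (of_real r * cis t) - norm (f (of_real r * cis t))) powr p) powr (q / p)
        * (\<nu> (of_real r) / (1 - r) powr q)) \<partial>lebesgue)"

definition F2 :: "real \<Rightarrow> real \<Rightarrow> (complex \<Rightarrow> real) \<Rightarrow> (complex \<Rightarrow> complex) \<Rightarrow> ennreal" where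
  "F2 p q \<nu> f =
     (\<integral>\<^sup>+r\<in>{0..<1}. ennreal (
        (LINT t:{0..<2*pi}|lebesgue.
           (LINT \<theta>|poisson_measure (of_real r * cis t).
              \<bar>norm (boundary_value f \<theta>) - poisson_mean_norm f (of_real r * cis t)\<bar>) powr p) powr (q / p)
        * (\<nu> (of_real r) / (1 - r) powr q)) \<partial>lebesgue)"

end

(*
  Everything rests on one pointwise comparison. Let m be the Poisson average at z of |f| over the circle, and
  rotate f so that f(z) >= 0. The kernel of the derivative is orthogonal to the conjugate of f and to
  constants, so (1 - |z|^2) f'(z) is twice the integral of Re f - m against a unimodular multiple of the
  Poisson kernel, and |Re f - m| <= (|f| - Re f) + ||f| - m|. This bounds (1 - |z|^2) |f'(z)| by
  2 (m - |f(z)|) + 2 (Poisson average of ||f| - m|), which gives the first inequality by integration.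

  Conversely both integrands are at most twice the Poisson average of |f(e^{is}) - f(z)|. By Minkowski's
  inequality its L^p mean over |z| = r is controlled by moving from e^{is} towards the origin, along a chord
  and back, so by dyadic sums of the means of f'. The one-sided doubling conditions say that
  V_n = tail (1 - 2^-n) decays and 2^{nq} V_n grows geometrically, and a discrete Hardy inequality finishes.

  For p = 1 the boundary theory needs an argument: f = g / h with bounded g, h (h a limit of exp (-q) with
  polynomials q, Re q close to log^+ |f| on circles), Fatou's theorem for bounded functions by a
  Vitali covering argument, and |f| <= Poisson integral of |f^*| from uniform integrability of sqrt |f|.
*)
theory Submission
  imports Defs
begin

text \<open>On the ring 1 - r ~ 2^-n the Poisson average sees arcs at distance 2^-j for every j <=
  n, with weight 2^(j-n), and an arc at distance 2^-j costs all means of f' between the radius 1 -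
  2^-j and the circle. After division by (1 - r)^q every ring k therefore acts on ring n, with a
  coefficient of order 1 for k <= n and of order 2^-(k-n) for k > n. The first half is summable
  against the weight by the lower doubling condition, the second by the condition with exponent q;
  the upper doubling condition pays for a shift of the index by one.

  The obstacle elsewhere is that boundary values exist only almost everywhere and arise as limits.
  Estimates involving them are proved for dilations, which are continuous up to the circle, and
  carried over by L^1 convergence or by Fatou's lemma. Exponentials of polynomials, supplied by
  Stone-Weierstrass, play the part of outer functions, both for the Poisson majorant of |f|^s and
  for the factorization.\<close>

subsection \<open>The circle and its arc length measure\<close>

text \<open>Normalised arc length. The sigma-algebra lives on the sphere alone, so continuity on the
  sphere already gives measurability, whatever a function does elsewhere.\<close>

definition circ :: "complex measure" where
  "circ = distr (density lborel (\<lambda>t. ennreal (indicator {0..<2*pi} t / (2*pi))))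
     (restrict_space borel (sphere 0 1)) cis"

lemma cis_measurable_sphere [measurable]: "cis \<in> borel \<rightarrow>\<^sub>M restrict_space borel (sphere 0 1)"
  by (intro measurable_restrict_space2 borel_measurable_continuous_onI) (auto intro: continuous_on_cis)

lemma space_circ [simp]: "space circ = sphere 0 1"
  by (simp add: circ_def space_restrict_space)

lemma sets_circ [measurable_cong]: "sets circ = sets (restrict_space borel (sphere 0 1))"
  by (simp add: circ_def)

lemma nn_integral_circ:
  assumes [measurable]: "u \<in> borel_measurable circ"
  shows "(\<integral>\<^sup>+ x. u x \<partial>circ) = (\<integral>\<^sup>+ t\<in>{0..<2*pi}. u (cis t) \<partial>lborel) / ennreal (2*pi)"
proof -
  have [measurable]: "u \<in> borel_measurable (restrict_space borel (sphere 0 1))"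
    using assms by (simp cong: measurable_cong_sets add: measurable_cong_sets[OF sets_circ refl])
  have "(\<integral>\<^sup>+ x. u x \<partial>circ) = (\<integral>\<^sup>+ t. ennreal (indicator {0..<2*pi} t / (2*pi)) * u (cis t) \<partial>lborel)"
    unfolding circ_def by (subst nn_integral_distr) (auto simp: nn_integral_density)
  also have "\<dots> = (\<integral>\<^sup>+ t. (u (cis t) * indicator {0..<2*pi} t) / ennreal (2*pi) \<partial>lborel)"
    by (intro nn_integral_cong) (auto simp: indicator_def divide_ennreal_def mult.commute inverse_ennreal field_simps)
  also have "\<dots> = (\<integral>\<^sup>+ t\<in>{0..<2*pi}. u (cis t) \<partial>lborel) / ennreal (2*pi)"
    by (subst nn_integral_divide) auto
  finally show ?thesis .
qed

lemma integral_circ: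
  fixes u :: "complex \<Rightarrow> 'b::{banach, second_countable_topology}"
  assumes [measurable]: "u \<in> borel_measurable circ"
  shows "(LINT x|circ. u x) = (1 / (2*pi)) *\<^sub>R (LINT t:{0..<2*pi}|lborel. u (cis t))"
    and "integrable circ u \<longleftrightarrow> set_integrable lborel {0..<2*pi} (\<lambda>t. u (cis t))"
proof -
  have [measurable]: "u \<in> borel_measurable (restrict_space borel (sphere 0 1))"
    using assms by (simp add: measurable_cong_sets[OF sets_circ refl])
  have eq: "(indicator {0..<2*pi} t / (2*pi)) *\<^sub>R u (cis t)
      = (1/(2*pi)) *\<^sub>R (indicator {0..<2*pi} t *\<^sub>R u (cis t))" for t :: real
    by simp
  have "(LINT x|circ. u x) = (LINT t|lborel. (indicator {0..<2*pi} t / (2*pi)) *\<^sub>R u (cis t))"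
    unfolding circ_def by (subst integral_distr) (auto simp: integral_density)
  also have "\<dots> = (1 / (2*pi)) *\<^sub>R (LINT t:{0..<2*pi}|lborel. u (cis t))"
    unfolding set_lebesgue_integral_def eq by (rule integral_scaleR_right)
  finally show "(LINT x|circ. u x) = (1 / (2*pi)) *\<^sub>R (LINT t:{0..<2*pi}|lborel. u (cis t))" .
  have "integrable circ u \<longleftrightarrow> integrable lborel (\<lambda>t. (indicator {0..<2*pi} t / (2*pi)) *\<^sub>R u (cis t))"
    unfolding circ_def by (subst integrable_distr_eq) (auto simp: integrable_density)
  also have "\<dots> \<longleftrightarrow> set_integrable lborel {0..<2*pi} (\<lambda>t. u (cis t))"
  proof
    assume "integrable lborel (\<lambda>t. (indicator {0..<2*pi} t / (2*pi)) *\<^sub>R u (cis t))"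
    then have "integrable lborel (\<lambda>t. (2*pi) *\<^sub>R ((indicator {0..<2*pi} t / (2*pi)) *\<^sub>R u (cis t)))"
      by (intro integrable_scaleR_right)
    then show "set_integrable lborel {0..<2*pi} (\<lambda>t. u (cis t))"
      by (simp add: set_integrable_def)
  next
    assume "set_integrable lborel {0..<2*pi} (\<lambda>t. u (cis t))"
    then show "integrable lborel (\<lambda>t. (indicator {0..<2*pi} t / (2*pi)) *\<^sub>R u (cis t))"
      unfolding set_integrable_def eq by (intro integrable_scaleR_right)
  qed
  finally show "integrable circ u \<longleftrightarrow> set_integrable lborel {0..<2*pi} (\<lambda>t. u (cis t))" .
qed

lemma AE_circ_cis:
  assumes "AE x in circ. P x"
  shows "AE t in lborel. t \<in> {0..<2*pi} \<longrightarrow> P (cis t)"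
proof -
  have "AE t in density lborel (\<lambda>t. ennreal (indicator {0..<2*pi} t / (2*pi))). P (cis t)"
    using assms unfolding circ_def by (rule AE_distrD[rotated]) simp
  then show ?thesis
    by (subst (asm) AE_density) (auto elim!: eventually_mono simp: indicator_def)
qed

lemma emeasure_circ_UNIV: "emeasure circ (sphere 0 1) = 1"
proof -
  have "emeasure circ (space circ) = (\<integral>\<^sup>+ x. 1 \<partial>circ)" by (subst nn_integral_const) simp
  also have "\<dots> = 1"
    by (subst nn_integral_circ) (auto simp: ennreal_divide_self)
  finally show ?thesis by simp
qed

interpretation circ: finite_measure circ
  by standard (simp add: emeasure_circ_UNIV)

lemma borel_measurable_circ_continuous:
  "continuous_on (sphere 0 1) u \<Longrightarrow> u \<in> borel_measurable circ"
  using borel_measurable_continuous_on_restrict by (simp add: measurable_cong_sets[OF sets_circ refl])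

lemma integrable_circ_continuous:
  fixes u :: "complex \<Rightarrow> 'b::{banach, second_countable_topology}"
  assumes "continuous_on (sphere 0 1) u"
  shows "integrable circ u"
proof -
  have "bounded (u ` sphere 0 1)"
    using assms by (intro compact_imp_bounded compact_continuous_image) auto
  then obtain B where "\<forall>x\<in>sphere 0 1. norm (u x) \<le> B"
    by (auto simp: bounded_iff)
  then show ?thesis
    by (intro circ.integrable_const_bound[where B=B] borel_measurable_circ_continuous assms) auto
qed

text \<open>A rotation shifts the window of angles to [a, a + 2 pi); the part beyond 2 pi is moved
  back by periodicity.\<close>

lemma nn_integral_circ_rotate:
  assumes w: "norm w = 1" and [measurable]: "u \<in> borel_measurable circ"
  shows "(\<integral>\<^sup>+ x. u (w * x) \<partial>circ) = (\<integral>\<^sup>+ x. u x \<partial>circ)"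
proof -
  have um[measurable]: "u \<in> borel_measurable (restrict_space borel (sphere 0 1))"
    using assms by (simp add: measurable_cong_sets[OF sets_circ refl])
  define a where "a = Arg2pi w"
  have a: "0 \<le> a" "a < 2*pi" "w = cis a"
    using Arg2pi[of w] w Arg2pi_eq[of w] by (auto simp: a_def cis_conv_exp)
  have mm: "(\<lambda>x. w * x) \<in> restrict_space borel (sphere 0 1) \<rightarrow>\<^sub>M restrict_space borel (sphere 0 1)"
    using w by (intro measurable_restrict_space2 measurable_restrict_space1)
      (auto simp: norm_mult space_restrict_space)
  have m2: "(\<lambda>x. u (w * x)) \<in> borel_measurable circ"
    using measurable_compose[OF mm um] by (simp add: measurable_cong_sets[OF sets_circ refl])
  define v where "v t = u (cis t)" for t
  have [measurable]: "v \<in> borel_measurable borel"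
    unfolding v_def by measurable
  have per: "v (t + 2*pi) = v t" for t
    by (simp add: v_def flip: cis_mult)
  have "(\<integral>\<^sup>+ t\<in>{0..<2*pi}. u (w * cis t) \<partial>lborel) = (\<integral>\<^sup>+ t. v (a + t) * indicator {a..<a+2*pi} (a+t) \<partial>lborel)"
    by (intro nn_integral_cong) (auto simp: v_def a cis_mult indicator_def)
  also have "\<dots> = (\<integral>\<^sup>+ t. v t * indicator {a..<a+2*pi} t \<partial>lborel)"
    by (subst nn_integral_real_affine[where c=1 and t=a, simplified, symmetric]) auto
  also have "\<dots> = (\<integral>\<^sup>+ t. v t * indicator {a..<2*pi} t + v t * indicator {2*pi..<a+2*pi} t \<partial>lborel)"
    using a by (intro nn_integral_cong) (auto simp: indicator_def)
  also have "\<dots> = (\<integral>\<^sup>+ t. v t * indicator {a..<2*pi} t \<partial>lborel) + (\<integral>\<^sup>+ t. v t * indicator {2*pi..<a+2*pi} t \<partial>lborel)"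
    by (rule nn_integral_add) auto
  also have "(\<integral>\<^sup>+ t. v t * indicator {2*pi..<a+2*pi} t \<partial>lborel)
      = (\<integral>\<^sup>+ t. v (2*pi+t) * indicator {2*pi..<a+2*pi} (2*pi+t) \<partial>lborel)"
    by (subst nn_integral_real_affine[where c=1 and t="2*pi"]) auto
  also have "\<dots> = (\<integral>\<^sup>+ t. v t * indicator {0..<a} t \<partial>lborel)"
    by (intro nn_integral_cong) (use per in \<open>auto simp: indicator_def add.commute\<close>)
  also have "(\<integral>\<^sup>+ t. v t * indicator {a..<2*pi} t \<partial>lborel) + \<dots>
      = (\<integral>\<^sup>+ t. v t * indicator {a..<2*pi} t + v t * indicator {0..<a} t \<partial>lborel)"
    by (rule nn_integral_add[symmetric]) auto
  also have "\<dots> = (\<integral>\<^sup>+ t. v t * indicator {0..<2*pi} t \<partial>lborel)"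
    using a by (intro nn_integral_cong) (auto simp: indicator_def)
  finally show ?thesis
    using m2 by (simp add: nn_integral_circ v_def)
qed

lemma borel_measurable_circ_rotate:
  assumes w: "norm w = 1" and "u \<in> borel_measurable circ"
  shows "(\<lambda>x. u (w * x)) \<in> borel_measurable circ"
proof -
  have um[measurable]: "u \<in> borel_measurable (restrict_space borel (sphere 0 1))"
    using assms by (simp add: measurable_cong_sets[OF sets_circ refl])
  have mm: "(\<lambda>x. w * x) \<in> restrict_space borel (sphere 0 1) \<rightarrow>\<^sub>M restrict_space borel (sphere 0 1)"
    using w by (intro measurable_restrict_space2 measurable_restrict_space1)
      (auto simp: norm_mult space_restrict_space)
  show ?thesis
    using measurable_compose[OF mm um] by (simp add: measurable_cong_sets[OF sets_circ refl])
qed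

lemma norm_cis_minus_1: "norm (cis t - 1) = 2 * \<bar>sin (t/2)\<bar>"
proof -
  have "(norm (cis t - 1))^2 = (cos t - 1)^2 + (sin t)^2"
    by (simp add: cmod_power2)
  also have "\<dots> = 2 - 2 * cos t"
    using sin_cos_squared_add[of t] by (simp add: power2_eq_square algebra_simps)
  also have "cos t = 1 - 2 * (sin (t/2))^2"
    using cos_double_sin[of "t/2"] by simp
  finally have "(norm (cis t - 1))^2 = (2 * \<bar>sin (t/2)\<bar>)^2" by (simp add: power_mult_distrib)
  then show ?thesis by (rule power2_eq_imp_eq) auto
qed

text \<open>Jordan's inequality: on [0, pi/2] a concave function lies above its chord.\<close>

lemma sin_ge_two_over_pi:
  assumes "0 \<le> x" "x \<le> pi/2"
  shows "2 / pi * x \<le> sin x"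
proof -
  have "concave_on {0..pi} sin"
  proof -
    have "convex_on {0..pi} (\<lambda>x. - sin x)"
      by (rule f''_ge0_imp_convex[where f' = "\<lambda>x. - cos x" and f'' = sin])
        (auto intro!: derivative_eq_intros sin_ge_zero)
    then show ?thesis by (simp add: concave_on_def)
  qed
  then have "sin ((1 - 2*x/pi) *\<^sub>R 0 + (2*x/pi) *\<^sub>R (pi/2)) \<ge> (1 - 2*x/pi) * sin 0 + (2*x/pi) * sin (pi/2)"
    using assms by (intro concave_onD[of "{0..pi}" sin]) (auto simp: field_simps)
  then show ?thesis by simp
qed

text \<open>After a rotation the centre is 1. By Jordan's inequality a chord of length at most
  \<open>u\<close> spans an angle of at most pi u / 2 on either side, hence normalised measure at
  most u / 2.\<close>

lemma emeasure_circ_cball: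
  assumes w: "norm w = 1"
  shows "emeasure circ (cball w u \<inter> sphere 0 1) \<le> ennreal u"
proof -
  have S: "cball a u \<inter> sphere 0 1 \<in> sets circ" for a
    by (subst sets_circ) (auto simp: sets_restrict_space)
  have "emeasure circ (cball w u \<inter> sphere 0 1) = (\<integral>\<^sup>+ x. indicator (cball w u \<inter> sphere 0 1) x \<partial>circ)"
    using S by simp
  also have "\<dots> = (\<integral>\<^sup>+ x. indicator (cball w u \<inter> sphere 0 1) (w * x) \<partial>circ)"
    using S w by (intro nn_integral_circ_rotate[symmetric]) auto
  also have "\<dots> = (\<integral>\<^sup>+ x. indicator (cball 1 u \<inter> sphere 0 1) x \<partial>circ)"
  proof (rule nn_integral_cong)
    fix x assume "x \<in> space circ"
    then have x: "norm x = 1" by simp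
    have "dist w (w * x) = norm (w * (1 - x))" by (simp add: dist_norm algebra_simps)
    also have "\<dots> = dist 1 x" using w by (simp add: norm_mult dist_norm)
    finally show "indicator (cball w u \<inter> sphere 0 1) (w * x) = (indicator (cball 1 u \<inter> sphere 0 1) x :: ennreal)"
      using w x by (auto simp: indicator_def norm_mult)
  qed
  also have "\<dots> = (\<integral>\<^sup>+ t\<in>{0..<2*pi}. indicator (cball 1 u \<inter> sphere 0 1) (cis t) \<partial>lborel) / ennreal (2*pi)"
    using S by (intro nn_integral_circ) auto
  also have "\<dots> \<le> (\<integral>\<^sup>+ t. indicator {0..pi*u/2} t + indicator {2*pi-pi*u/2..2*pi} t \<partial>lborel) / ennreal (2*pi)"
  proof (intro divide_right_mono_ennreal nn_integral_mono)
    fix t :: real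
    have "t \<in> {0..pi*u/2} \<or> t \<in> {2*pi-pi*u/2..2*pi}" if t: "0 \<le> t" "t < 2*pi" "norm (cis t - 1) \<le> u"
    proof (cases "t \<le> pi")
      case True
      with t have "2/pi * (t/2) \<le> sin (t/2)" by (intro sin_ge_two_over_pi) auto
      then have "2 * t / pi \<le> u" using t(3) by (simp add: norm_cis_minus_1)
      then show ?thesis using t by (auto simp: field_simps)
    next
      case False
      with t have "2/pi * (pi - t/2) \<le> sin (pi - t/2)" by (intro sin_ge_two_over_pi) auto
      then have "2/pi * (pi - t/2) \<le> sin (t/2)" by simp
      then have "2 - t/pi \<le> sin (t/2)" by (simp add: field_simps)
      then have "2 * (2 - t / pi) \<le> u" using t(3) by (simp add: norm_cis_minus_1)
      then show ?thesis using t by (auto simp: field_simps)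
    qed
    then show "indicator (cball 1 u \<inter> sphere 0 1) (cis t) * indicator {0..<2 * pi} t
         \<le> indicator {0..pi*u/2} t + (indicator {2*pi-pi*u/2..2*pi} t :: ennreal)"
      by (auto simp: indicator_def dist_norm norm_minus_commute)
  qed
  also have "\<dots> = (emeasure lborel {0..pi*u/2} + emeasure lborel {2*pi-pi*u/2..2*pi}) / ennreal (2*pi)"
    by (subst nn_integral_add) auto
  also have "\<dots> \<le> ennreal u"
  proof (cases "u \<ge> 0")
    case True
    have "(emeasure lborel {0..pi*u/2} + emeasure lborel {2*pi-pi*u/2..2*pi}) / ennreal (2*pi) = ennreal (u/2)"
      using True by (simp add: divide_ennreal field_simps flip: ennreal_plus)
    then show ?thesis using True by (simp add: ennreal_leI)
  next
    case False
    then have "pi * u / 2 < 0" by (simp add: mult_pos_neg)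
    then show ?thesis by simp
  qed
  finally show ?thesis .
qed

subsection \<open>Poisson kernel and Cauchy formulas\<close>

text \<open>No factor 1 / (2 pi): it sits in the normalisation of \<open>circ\<close>.\<close>

definition poisson :: "complex \<Rightarrow> complex \<Rightarrow> real" where
  "poisson z w = (1 - (norm z)\<^sup>2) / (norm (w - z))\<^sup>2"

text \<open>The disc automorphism with zero \<open>z\<close>. On the circle it is unimodular, and
  its conjugate is the phase by which the kernel of the derivative differs from the Poisson
  kernel.\<close>

definition blaschke :: "complex \<Rightarrow> complex \<Rightarrow> complex" where
  "blaschke z w = (w - z) / (1 - cnj z * w)"

lemma poisson_nonneg: "norm z < 1 \<Longrightarrow> 0 \<le> poisson z w"
  by (simp add: poisson_def abs_square_le_1)

lemma one_minus_cnj_mult_nonzero: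
  fixes z w :: complex
  assumes "norm z < 1" "norm w \<le> 1"
  shows "1 - cnj z * w \<noteq> 0"
proof
  assume "1 - cnj z * w = 0"
  then have "norm (cnj z * w) = 1" by simp
  moreover have "norm (cnj z * w) \<le> norm z * 1" unfolding norm_mult complex_mod_cnj
    using assms by (intro mult_left_mono) auto
  ultimately show False using assms by simp
qed

text \<open>On the circle \<open>cnj w\<close> is 1 / w, so the kernel becomes a rational function
  of \<open>w\<close> whose only possible pole in the disc is \<open>z\<close>; this opens it to
  Cauchy's formula.\<close>

lemma poisson_complex:
  fixes z w :: complex
  assumes "norm z < 1" "norm w = 1"
  shows "complex_of_real (poisson z w) = complex_of_real (1 - (norm z)\<^sup>2) * w / ((1 - cnj z * w) * (w - z))"
proof -
  have [simp]: "w \<noteq> 0" "w \<noteq> z" using assms by auto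
  have c: "cnj w = 1 / w" using assms complex_norm_square[of w] by (simp add: field_simps)
  have "complex_of_real ((norm (w - z))\<^sup>2) = (w - z) * (1/w - cnj z)"
    by (simp only: complex_norm_square complex_cnj_diff c)
  also have "\<dots> = (1 - cnj z * w) * (w - z) / w" by (simp add: field_simps)
  finally show ?thesis
    by (simp add: poisson_def)
qed

lemma norm_blaschke:
  fixes z w :: complex
  assumes "norm z < 1" "norm w = 1"
  shows "norm (blaschke z w) = 1"
proof -
  have c: "1 = cnj w * w" using assms complex_norm_square[of w] by (simp add: mult.commute)
  have "1 - cnj z * w = cnj (w - z) * w" by (subst c) (simp add: algebra_simps)
  then have "norm (1 - cnj z * w) = norm (w - z)"
    using assms by (simp only: norm_mult complex_mod_cnj mult_1_right)
  moreover have "w \<noteq> z" using assms by auto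
  ultimately show ?thesis by (simp add: blaschke_def norm_divide)
qed

lemma continuous_on_poisson:
  assumes "norm z < 1"
  shows "continuous_on (sphere 0 1) (poisson z)"
  unfolding poisson_def using assms by (intro continuous_intros) auto

lemma continuous_on_blaschke:
  assumes z: "norm z < 1"
  shows "continuous_on (cball 0 1) (blaschke z)"
  unfolding blaschke_def using one_minus_cnj_mult_nonzero[OF z]
  by (intro continuous_intros) auto

text \<open>Here dw = i w dt. The endpoint 2 pi missing from the half-open interval is a null
  set.\<close>

lemma contour_integral_circlepath_circ:
  assumes "continuous_on (sphere 0 1) f"
  shows "contour_integral (circlepath 0 1) f = 2 * complex_of_real pi * \<i> * (LINT w|circ. f w * w)"
proof -
  have cont: "continuous_on (sphere 0 1) (\<lambda>w. f w * w)"
    using assms by (intro continuous_intros)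
  have cs: "continuous_on {0..2*pi} (\<lambda>t. f (cis t) * cis t)"
    by (intro continuous_on_compose2[OF cont, of _ cis] continuous_intros) auto
  have "contour_integral (circlepath 0 1) f = integral {0..2*pi} (\<lambda>t. f (cis t) * \<i> * cis t)"
    unfolding circlepath_def by (subst contour_integral_part_circlepath_eq) auto
  also have "\<dots> = \<i> * integral {0..2*pi} (\<lambda>t. f (cis t) * cis t)"
    by (subst integral_mult_right[symmetric]) (simp add: mult_ac)
  also have "integral {0..2*pi} (\<lambda>t. f (cis t) * cis t) = (LINT t:{0..2*pi}|lborel. f (cis t) * cis t)"
    by (rule set_borel_integral_eq_integral(2)[symmetric], rule borel_integrable_atLeastAtMost', rule cs)
  also have "\<dots> = (LINT t:{0..<2*pi}|lborel. f (cis t) * cis t)"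
    unfolding set_lebesgue_integral_def
  proof (rule integral_cong_AE)
    have "continuous_on {0..<2*pi} (\<lambda>t. f (cis t) * cis t)"
      by (rule continuous_on_subset[OF cs]) auto
    then show "(\<lambda>t. indicator {0..2*pi} t *\<^sub>R (f (cis t) * cis t)) \<in> borel_measurable lborel"
      "(\<lambda>t. indicator {0..<2*pi} t *\<^sub>R (f (cis t) * cis t)) \<in> borel_measurable lborel"
      unfolding measurable_lborel2
      by (intro borel_measurable_continuous_on_indicator cs; simp)+
  qed (use AE_lborel_singleton[of "2*pi"] in \<open>auto elim!: eventually_mono simp: indicator_def\<close>)
  also have "\<dots> = 2 * pi * (LINT w|circ. f w * w)"
    by (subst integral_circ(1)) (auto intro: borel_measurable_circ_continuous cont simp: scaleR_conv_of_real)
  finally show ?thesis by simp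
qed

text \<open>Cauchy's formula for F(w) (1 - |z|^2) / (1 - cnj z w), which is analytic in the disc and
  equals F(z) at w = z.\<close>

lemma poisson_integral_formula:
  fixes F :: "complex \<Rightarrow> complex" and z :: complex
  assumes F: "continuous_on (cball 0 1) F" "F holomorphic_on ball 0 1" and z: "norm z < 1"
  shows "(LINT w|circ. poisson z w *\<^sub>R F w) = F z"
proof -
  let ?G = "\<lambda>w. F w * complex_of_real (1 - (norm z)\<^sup>2) / (1 - cnj z * w)"
  have G: "continuous_on (cball 0 1) ?G" "?G holomorphic_on ball 0 1"
    by (intro continuous_intros holomorphic_intros F; use z one_minus_cnj_mult_nonzero[OF z] in auto)+
  have cs: "continuous_on (sphere 0 1) (\<lambda>w. ?G w / (w - z))"
    using z by (intro continuous_intros continuous_on_subset[OF G(1)]) auto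
  have "((\<lambda>u. ?G u / (u - z)) has_contour_integral (2 * of_real pi * \<i> * ?G z)) (circlepath 0 1)"
    using z by (intro Cauchy_integral_circlepath G) auto
  then have "contour_integral (circlepath 0 1) (\<lambda>w. ?G w / (w - z)) = 2 * of_real pi * \<i> * ?G z"
    by (rule contour_integral_unique)
  then have "(LINT w|circ. ?G w / (w - z) * w) = ?G z"
    by (subst (asm) contour_integral_circlepath_circ[OF cs]) (simp only: mult_cancel_left, simp)
  moreover have "?G z = F z"
    using one_minus_cnj_mult_nonzero[OF z, of z] z complex_norm_square[of z]
    by (simp add: mult.commute)
  moreover have "(LINT w|circ. ?G w / (w - z) * w) = (LINT w|circ. poisson z w *\<^sub>R F w)"
    by (intro Bochner_Integration.integral_cong refl)
      (auto simp: scaleR_conv_of_real poisson_complex[OF z])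
  ultimately show ?thesis by simp
qed

lemma integral_poisson: "norm z < 1 \<Longrightarrow> (LINT w|circ. poisson z w) = 1"
proof -
  assume z: "norm z < 1"
  have "(LINT w|circ. poisson z w *\<^sub>R (1::complex)) = 1"
    using z by (intro poisson_integral_formula) auto
  then have "complex_of_real (LINT w|circ. poisson z w) = 1"
    by (simp add: scaleR_conv_of_real)
  then show ?thesis using of_real_eq_1_iff by blast
qed

text \<open>Cauchy's formula for the derivative has the kernel w / (w - z)^2. The Blaschke factor is
  unimodular on the circle, so its conjugate is its inverse, and (1 - |z|^2) times this kernel
  splits into Poisson kernel and phase.\<close>

lemma poisson_derivative_formula:
  fixes F :: "complex \<Rightarrow> complex" and z :: complex
  assumes F: "continuous_on (cball 0 1) F" "F holomorphic_on ball 0 1" and z: "norm z < 1"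
  shows "(LINT w|circ. poisson z w *\<^sub>R (F w * cnj (blaschke z w))) = complex_of_real (1 - (norm z)\<^sup>2) * deriv F z"
proof -
  have cs: "continuous_on (sphere 0 1) (\<lambda>w. F w / (w - z)^2)"
    using z by (intro continuous_intros continuous_on_subset[OF F(1)]) auto
  have "deriv F z = 1 / (2 * of_real pi * \<i>) * contour_integral(circlepath 0 1) (\<lambda>u. F u / (u-z)^2)"
    using Cauchy_derivative_integral_circlepath(2)[OF F, of z] z by (intro DERIV_imp_deriv) auto
  also have "\<dots> = (LINT w|circ. F w / (w - z)^2 * w)"
    by (subst contour_integral_circlepath_circ[OF cs]) auto
  finally have d: "deriv F z = (LINT w|circ. F w / (w - z)^2 * w)" .
  have "complex_of_real (1 - (norm z)\<^sup>2) * deriv F z = (LINT w|circ. complex_of_real (1 - (norm z)\<^sup>2) * (F w / (w - z)^2 * w))"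
    unfolding d by (rule integral_mult_right_zero[symmetric])
  also have "\<dots> = (LINT w|circ. poisson z w *\<^sub>R (F w * cnj (blaschke z w)))"
  proof (intro Bochner_Integration.integral_cong refl)
    fix w assume "w \<in> space circ"
    then have w: "norm w = 1" by simp
    have "cnj (blaschke z w) * blaschke z w = 1"
      using norm_blaschke[OF z w] complex_norm_square[of "blaschke z w"] by (simp add: mult.commute)
    then have c: "cnj (blaschke z w) = 1 / blaschke z w"
      by (metis div_by_1 divide_divide_eq_right eq_divide_imp mult_zero_right zero_neq_one)
    show "complex_of_real (1 - (norm z)\<^sup>2) * (F w / (w - z)^2 * w) = poisson z w *\<^sub>R (F w * cnj (blaschke z w))"
      unfolding c scaleR_conv_of_real poisson_complex[OF z w]
      using z w one_minus_cnj_mult_nonzero[OF z, of w] by (simp add: blaschke_def power2_eq_square)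
  qed
  finally show ?thesis by simp
qed

text \<open>Replacing \<open>F\<close> by its real part (up to a rotation and a constant) costs only a factor 2, since
  the conjugate of \<open>F\<close> is orthogonal to the kernel of the derivative.\<close>

lemma derivative_bound:
  fixes F :: "complex \<Rightarrow> complex" and z :: complex
  assumes F: "continuous_on (cball 0 1) F" "F holomorphic_on ball 0 1" and z: "norm z < 1"
  shows "(1 - (norm z)\<^sup>2) * norm (deriv F z) \<le>
     2 * ((LINT w|circ. poisson z w * norm (F w)) - norm (F z)) +
     2 * (LINT w|circ. poisson z w * \<bar>norm (F w) - m\<bar>)"
proof -
  let ?B = "\<lambda>w. cnj (blaschke z w)"
  obtain e where e: "norm e = 1" "e * F z = norm (F z)"
  proof (cases "F z = 0")
    case False
    then show ?thesis using that[of "norm (F z) / F z"] by (simp add: norm_divide)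
  qed (use that[of 1] in auto)
  define G where "G w = e * F w" for w
  have G: "continuous_on (cball 0 1) G" "G holomorphic_on ball 0 1"
    unfolding G_def by (intro continuous_intros holomorphic_intros F)+
  have FS: "continuous_on (sphere 0 1) F" and GS: "continuous_on (sphere 0 1) G"
    by (rule continuous_on_subset[OF F(1)] continuous_on_subset[OF G(1)]; force)+
  have BS: "continuous_on (sphere 0 1) (blaschke z)"
    by (rule continuous_on_subset[OF continuous_on_blaschke[OF z]]) force
  note cont = continuous_on_poisson[OF z] FS GS BS
  have int: "integrable circ (\<lambda>w. poisson z w *\<^sub>R (G w * ?B w))"
    "integrable circ (\<lambda>w. poisson z w *\<^sub>R (cnj (G w) * ?B w))"
    "integrable circ (\<lambda>w. poisson z w *\<^sub>R ?B w)"
    by (intro integrable_circ_continuous continuous_intros cont)+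
  have int2: "integrable circ (\<lambda>w. poisson z w * norm (F w))"
    "integrable circ (\<lambda>w. poisson z w * Re (G w))"
    "integrable circ (\<lambda>w. poisson z w * \<bar>norm (F w) - m\<bar>)"
    by (intro integrable_circ_continuous continuous_intros cont)+
  have Gz: "G z = norm (F z)" by (simp add: G_def e)
  have 1: "(LINT w|circ. poisson z w *\<^sub>R (G w * ?B w)) = complex_of_real (1 - (norm z)\<^sup>2) * deriv G z"
    by (rule poisson_derivative_formula[OF G z])
  have blz: "blaschke z holomorphic_on ball 0 1"
    unfolding blaschke_def using one_minus_cnj_mult_nonzero[OF z] by (intro holomorphic_intros) auto
  have bz: "blaschke z z = 0" by (simp add: blaschke_def)
  \<comment> \<open>\<open>G * blaschke z\<close> is analytic with value 0 at \<open>z\<close>; the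
    conjugate of its mean value identity is the orthogonality to \<open>cnj G\<close>.\<close>
  have "(LINT w|circ. poisson z w *\<^sub>R (G w * blaschke z w)) = G z * blaschke z z"
    by (intro poisson_integral_formula z continuous_intros holomorphic_intros G blz continuous_on_blaschke)
  then have "cnj (LINT w|circ. poisson z w *\<^sub>R (G w * blaschke z w)) = 0" by (simp add: bz)
  then have 2: "(LINT w|circ. poisson z w *\<^sub>R (cnj (G w) * ?B w)) = 0"
    using Bochner_Integration.integral_cnj[of circ "\<lambda>w. poisson z w *\<^sub>R (G w * blaschke z w)"]
    by (simp add: scaleR_conv_of_real)
  \<comment> \<open>The constant function 1 has derivative 0, so \<open>m\<close> may be subtracted
    at no cost.\<close>
  have "(LINT w|circ. poisson z w *\<^sub>R (1 * ?B w)) = complex_of_real (1 - (norm z)\<^sup>2) * deriv (\<lambda>_. 1) z"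
    by (rule poisson_derivative_formula) (use z in auto)
  then have 3: "(LINT w|circ. poisson z w *\<^sub>R ?B w) = 0" by simp
  \<comment> \<open>Two vanishing integrals are added so that the integrand collects to 2 (Re G - m)
    times kernel and phase.\<close>
  have "complex_of_real (1 - (norm z)\<^sup>2) * deriv G z = (LINT w|circ. poisson z w *\<^sub>R (G w * ?B w))
     + (LINT w|circ. poisson z w *\<^sub>R (cnj (G w) * ?B w)) - 2 * m * (LINT w|circ. poisson z w *\<^sub>R ?B w)"
    using 1 2 3 by simp
  also have "\<dots> = (LINT w|circ. poisson z w *\<^sub>R (G w * ?B w) + poisson z w *\<^sub>R (cnj (G w) * ?B w)
      - 2 * m * (poisson z w *\<^sub>R ?B w))"
    using int by (simp del: scaleR_conv_of_real mult_scaleR_right)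
  also have "\<dots> = (LINT w|circ. (2 * poisson z w * (Re (G w) - m)) *\<^sub>R ?B w)"
  proof (intro Bochner_Integration.integral_cong refl)
    fix w
    have r: "cnj (G w) = 2 * Re (G w) - G w" using complex_add_cnj[of "G w"] by (simp add: algebra_simps)
    show "poisson z w *\<^sub>R (G w * ?B w) + poisson z w *\<^sub>R (cnj (G w) * ?B w) - 2 * m * (poisson z w *\<^sub>R ?B w)
      = (2 * poisson z w * (Re (G w) - m)) *\<^sub>R ?B w"
      unfolding r by (simp add: scaleR_conv_of_real algebra_simps)
  qed
  finally have "norm (complex_of_real (1 - (norm z)\<^sup>2) * deriv G z) \<le>
      (LINT w|circ. norm ((2 * poisson z w * (Re (G w) - m)) *\<^sub>R ?B w))"
    by (simp only: integral_norm_bound)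
  also have "\<dots> = (LINT w|circ. 2 * (poisson z w * \<bar>Re (G w) - m\<bar>))"
    by (intro Bochner_Integration.integral_cong refl)
      (auto simp: abs_mult norm_blaschke[OF z] poisson_nonneg[OF z])
  also have "\<dots> = 2 * (LINT w|circ. poisson z w * \<bar>Re (G w) - m\<bar>)"
    by simp
  finally have le: "norm (complex_of_real (1 - (norm z)\<^sup>2) * deriv G z) \<le>
      2 * (LINT w|circ. poisson z w * \<bar>Re (G w) - m\<bar>)" .
  have "(LINT w|circ. poisson z w * \<bar>Re (G w) - m\<bar>) \<le>
     (LINT w|circ. (poisson z w * norm (F w) - poisson z w * Re (G w)) + poisson z w * \<bar>norm (F w) - m\<bar>)"
  proof (intro integral_mono integrable_circ_continuous continuous_intros cont)
    fix w assume "w \<in> space circ"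
    have "Re (G w) \<le> norm (F w)"
      using complex_Re_le_cmod[of "G w"] by (simp add: G_def norm_mult e)
    then have "\<bar>Re (G w) - m\<bar> \<le> (norm (F w) - Re (G w)) + \<bar>norm (F w) - m\<bar>" by linarith
    from mult_left_mono[OF this poisson_nonneg[OF z, of w]]
    show "poisson z w * \<bar>Re (G w) - m\<bar> \<le>
       poisson z w * norm (F w) - poisson z w * Re (G w) + poisson z w * \<bar>norm (F w) - m\<bar>"
      by (simp add: algebra_simps)
  qed
  also have "\<dots> = (LINT w|circ. poisson z w * norm (F w)) - (LINT w|circ. poisson z w * Re (G w))
      + (LINT w|circ. poisson z w * \<bar>norm (F w) - m\<bar>)"
    using int2 by simp
  \<comment> \<open>The rotation \<open>e\<close> makes G(z) = |F(z)|, so the average of Re G is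
    |F(z)|.\<close>
  also have "(LINT w|circ. poisson z w * Re (G w)) = Re (LINT w|circ. poisson z w *\<^sub>R G w)"
    by (subst integral_Re[symmetric]) (auto intro!: integrable_circ_continuous continuous_intros cont)
  also have "\<dots> = norm (F z)"
    by (subst poisson_integral_formula[OF G z]) (simp add: Gz)
  finally have le2: "(LINT w|circ. poisson z w * \<bar>Re (G w) - m\<bar>) \<le>
     (LINT w|circ. poisson z w * norm (F w)) - norm (F z) + (LINT w|circ. poisson z w * \<bar>norm (F w) - m\<bar>)" .
  have eq: "norm (complex_of_real (1 - (norm z)\<^sup>2) * deriv G z) = (1 - (norm z)\<^sup>2) * norm (deriv F z)"
  proof -
    have "deriv G z = e * deriv F z"
      unfolding G_def using F z by (intro deriv_cmult) (auto simp: holomorphic_on_imp_differentiable_at)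
    moreover have "(norm z)\<^sup>2 \<le> 1" using z by (simp add: abs_square_le_1)
    ultimately show ?thesis
      by (simp only: norm_mult norm_of_real e(1) mult_1 abs_of_nonneg diff_ge_0_iff_ge)
  qed
  from order_trans[OF le mult_left_mono[OF le2, of 2]] show ?thesis
    unfolding eq by simp
qed

subsection \<open>Powers of absolute values\<close>

lemma measurable_fst_circ [measurable]: "fst \<in> borel_measurable (circ \<Otimes>\<^sub>M M)"
  and measurable_snd_circ [measurable]: "snd \<in> borel_measurable (M \<Otimes>\<^sub>M circ)"
proof -
  have *: "(\<lambda>x. x) \<in> borel_measurable circ"
    by (intro borel_measurable_circ_continuous continuous_intros)
  show "fst \<in> borel_measurable (circ \<Otimes>\<^sub>M M)" "snd \<in> borel_measurable (M \<Otimes>\<^sub>M circ)"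
    using measurable_compose[OF measurable_fst *] measurable_compose[OF measurable_snd *] by auto
qed

lemma poisson_symmetric:
  assumes "norm v = 1" "norm w = 1"
  shows "poisson (of_real r * v) w = poisson (of_real r * w) v"
proof -
  have "(norm (w - of_real r * v))\<^sup>2 = (norm (v - of_real r * w))\<^sup>2"
  proof -
    have "cnj v * v = 1" "cnj w * w = 1"
      using assms complex_norm_square[of v] complex_norm_square[of w] by (simp_all add: mult.commute)
    then have "complex_of_real ((norm (w - of_real r * v))\<^sup>2) = complex_of_real ((norm (v - of_real r * w))\<^sup>2)"
      unfolding complex_norm_square by (simp, algebra)
    then show ?thesis using of_real_eq_iff by blast
  qed
  then show ?thesis using assms by (simp add: poisson_def norm_mult)
qed

lemma integrable_poisson_mult:
  fixes u :: "complex \<Rightarrow> 'b::{banach, second_countable_topology}"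
  assumes z: "norm z < 1" and u: "integrable circ u"
  shows "integrable circ (\<lambda>w. poisson z w *\<^sub>R u w)"
proof -
  have cp: "continuous_on (sphere 0 1) (poisson z)" by (rule continuous_on_poisson[OF z])
  then have "bounded (poisson z ` sphere 0 1)"
    by (intro compact_imp_bounded compact_continuous_image) auto
  then obtain B where B: "\<forall>x\<in>sphere 0 1. norm (poisson z x) \<le> B"
    by (auto simp: bounded_iff)
  show ?thesis
  proof (rule Bochner_Integration.integrable_bound)
    show "integrable circ (\<lambda>w. B *\<^sub>R u w)" using u by simp
    show "(\<lambda>w. poisson z w *\<^sub>R u w) \<in> borel_measurable circ"
      using u borel_measurable_circ_continuous[OF cp] by measurable
    have "\<bar>poisson z w\<bar> \<le> \<bar>B\<bar>" if "norm w = 1" for w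
      using B[rule_format, of w] that by simp
    then show "AE w in circ. norm (poisson z w *\<^sub>R u w) \<le> norm (B *\<^sub>R u w)"
      by (intro AE_I2) (simp add: mult_right_mono)
  qed
qed

lemma nn_integral_poisson: "norm z < 1 \<Longrightarrow> (\<integral>\<^sup>+w. ennreal (poisson z w) \<partial>circ) = 1"
  using integral_poisson[of z]
  by (subst nn_integral_eq_integral) (auto simp: poisson_nonneg intro: integrable_circ_continuous continuous_on_poisson)

text \<open>Fubini, with a kernel that is symmetric in the two points of the circle: integrated over
  \<open>v\<close> first it has mass 1.\<close>

lemma nn_integral_poisson_average:
  assumes [measurable]: "u \<in> borel_measurable circ" and r: "0 \<le> r" "r < 1"
  shows "(\<integral>\<^sup>+v. (\<integral>\<^sup>+w. ennreal (poisson (of_real r * v) w) * u w \<partial>circ) \<partial>circ) = (\<integral>\<^sup>+w. u w \<partial>circ)"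
proof -
  interpret P: pair_sigma_finite circ circ ..
  have "(\<integral>\<^sup>+v. (\<integral>\<^sup>+w. ennreal (poisson (of_real r * v) w) * u w \<partial>circ) \<partial>circ)
     = (\<integral>\<^sup>+w. (\<integral>\<^sup>+v. ennreal (poisson (of_real r * v) w) * u w \<partial>circ) \<partial>circ)"
    unfolding poisson_def by (intro P.Fubini') measurable
  also have "\<dots> = (\<integral>\<^sup>+w. (\<integral>\<^sup>+v. ennreal (poisson (of_real r * w) v) * u w \<partial>circ) \<partial>circ)"
    by (intro nn_integral_cong) (simp add: poisson_symmetric)
  also have "\<dots> = (\<integral>\<^sup>+w. u w \<partial>circ)"
  proof (intro nn_integral_cong)
    fix w assume "w \<in> space circ"
    then have *: "norm (of_real r * w) < 1" using r by (simp add: norm_mult)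
    have "(\<integral>\<^sup>+v. ennreal (poisson (of_real r * w) v) * u w \<partial>circ)
      = (\<integral>\<^sup>+v. ennreal (poisson (of_real r * w) v) \<partial>circ) * u w"
      by (intro nn_integral_multc) (intro measurable_compose[OF _ measurable_ennreal]
         borel_measurable_circ_continuous continuous_on_poisson *)
    then show "(\<integral>\<^sup>+v. ennreal (poisson (of_real r * w) v) * u w \<partial>circ) = u w"
      by (simp add: nn_integral_poisson[OF *])
  qed
  finally show ?thesis .
qed

text \<open>Write the factors as a + w p and b + w q'. In the product with the conjugate the last
  term carries w cnj w = 1, so both degrees drop; the others are polynomials or conjugates of
  polynomials, and conjugation leaves the real part alone. Hence real parts of polynomials are
  closed under products on the circle.\<close>

lemma real_part_product:
  fixes p :: "complex poly"
  shows "\<exists>r. \<forall>w. norm w = 1 \<longrightarrow> Re (poly p w * cnj (poly q w)) = Re (poly r w)"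
proof (induction p arbitrary: q)
  case 0
  show ?case by (rule exI[of _ 0]) simp
next
  case (pCons a p)
  obtain b q' where q: "q = pCons b q'" by (rule pCons_cases)
  obtain r where r: "\<And>w. norm w = 1 \<Longrightarrow> Re (poly p w * cnj (poly q' w)) = Re (poly r w)"
    using pCons.IH by blast
  show ?case
  proof (intro exI allI impI)
    fix w :: complex assume w: "norm w = 1"
    have 1: "w * cnj w = 1" using w complex_norm_square[of w] by simp
    have "poly (pCons a p) w * cnj (poly q w) = a * cnj (poly q w) + cnj b * (w * poly p w)
       + (w * cnj w) * (poly p w * cnj (poly q' w))"
      by (simp add: q algebra_simps)
    moreover have "Re (a * cnj (poly q w)) = Re (cnj a * poly q w)" by simp
    ultimately show "Re (poly (pCons a p) w * cnj (poly q w)) = Re (poly (smult (cnj a) q + smult (cnj b) (pCons 0 p) + r) w)"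
      by (simp only: 1 mult_1 plus_complex.sel r[OF w] poly_add poly_smult poly_pCons add_0)
  qed
qed

text \<open>Stone-Weierstrass for the algebra of real parts of polynomials, where \<open>Re\<close>
  and \<open>Im\<close> separate points. Each approximant comes with an explicit analytic
  completion, which stands in for a solution of the Dirichlet problem.\<close>

lemma circle_approximation:
  fixes u :: "complex \<Rightarrow> real"
  assumes u: "continuous_on (sphere 0 1) u" and e: "e > 0"
  obtains q :: "complex poly" where "\<And>w. norm w = 1 \<Longrightarrow> \<bar>u w - Re (poly q w)\<bar> < e"
proof -
  define R where "R = {u. continuous_on (sphere 0 1) u \<and> (\<exists>q. \<forall>w. norm w = 1 \<longrightarrow> u w = Re (poly q w))}"
  have I: "g \<in> R" if "\<And>w. norm w = 1 \<Longrightarrow> g w = Re (poly q w)" for g q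
  proof -
    have "continuous_on (sphere 0 1) g \<longleftrightarrow> continuous_on (sphere 0 1) (\<lambda>w. Re (poly q w))"
      using that by (intro continuous_on_cong) auto
    then have "continuous_on (sphere 0 1) g" by (simp add: continuous_intros)
    with that show ?thesis by (auto simp: R_def)
  qed
  interpret function_ring_on R "sphere 0 1"
  proof
    fix f g assume "f \<in> R" "g \<in> R"
    then obtain p q where p: "\<And>w. norm w = 1 \<Longrightarrow> f w = Re (poly p w)" and q: "\<And>w. norm w = 1 \<Longrightarrow> g w = Re (poly q w)"
      unfolding R_def by blast
    show "(\<lambda>x. f x + g x) \<in> R" by (rule I[of _ "p + q"]) (simp add: p q)
    obtain r where r: "\<And>w. norm w = 1 \<Longrightarrow> Re (poly p w * cnj (poly q w)) = Re (poly r w)"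
      using real_part_product by blast
    show "(\<lambda>x. f x * g x) \<in> R"
    proof (rule I)
      fix w :: complex assume w: "norm w = 1"
      \<comment> \<open>Re A Re B = Re (A B + A cnj B) / 2.\<close>
      show "f w * g w = Re (poly (smult (1/2) (p * q + r)) w)"
        using r[OF w] by (simp add: p[OF w] q[OF w])
    qed
  next
    fix c show "(\<lambda>_. c) \<in> R" by (rule I[of _ "[:of_real c:]"]) simp
  next
    fix x y :: complex assume "x \<in> sphere 0 1" "y \<in> sphere 0 1" "x \<noteq> y"
    moreover have "Re \<in> R" by (rule I[of _ "[:0, 1:]"]) simp
    moreover have "Im \<in> R" by (rule I[of _ "[:0, -\<i>:]"]) simp
    ultimately show "\<exists>f\<in>R. f x \<noteq> f y" using complex_eq_iff by blast
  qed (auto simp: R_def)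
  obtain g where g: "g \<in> R" "\<forall>x\<in>sphere 0 1. \<bar>u x - g x\<bar> < e"
    using Stone_Weierstrass_basic[OF u e] by blast
  then obtain q where q: "\<And>w. norm w = 1 \<Longrightarrow> g w = Re (poly q w)"
    unfolding R_def by blast
  show ?thesis
    by (rule that[of q]) (use g(2) q in simp)
qed

lemma maximum_modulus_disc:
  assumes "continuous_on (cball 0 1) F" "F holomorphic_on ball 0 1"
    and "\<And>w. norm w = 1 \<Longrightarrow> norm (F w) \<le> B" and "norm z \<le> 1"
  shows "norm (F z) \<le> B"
  by (rule maximum_modulus_frontier[where S = "cball 0 1" and f = F]) (use assms in auto)

text \<open>A polynomial \<open>q\<close> whose real part on the circle is close to \<open>ln (\<bar>F\<bar> + \<delta>)\<close> makes
  \<open>F exp (-q)\<close> bounded by 1, so the mean value property for \<open>exp (s q)\<close> gives the bound for \<open>\<bar>F\<bar>\<^sup>s\<close>.\<close>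

lemma norm_powr_le_poisson:
  fixes F :: "complex \<Rightarrow> complex"
  assumes F: "continuous_on (cball 0 1) F" "F holomorphic_on ball 0 1" and z: "norm z < 1" and s: "s > 0"
  shows "norm (F z) powr s \<le> (LINT w|circ. poisson z w * norm (F w) powr s)"
proof -
  have FS: "continuous_on (sphere 0 1) F" by (rule continuous_on_subset[OF F(1)]) force
  have approx: "norm (F z) powr s \<le> (LINT w|circ. poisson z w * (exp (2 * e * s) * (norm (F w) + e) powr s))"
    if e: "e > 0" for e
  proof -
    have nz: "norm (F w) + e \<noteq> 0" for w using e norm_ge_zero[of "F w"] by linarith
    \<comment> \<open>Aiming at ln (|F| + e) + e with tolerance e makes the error one-sided: Re q
      lies between ln (|F| + e) and that value plus 2 e.\<close>
    have "continuous_on (sphere 0 1) (\<lambda>w. ln (norm (F w) + e) + e)"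
      by (intro continuous_intros FS) (use nz in auto)
    then obtain q where q: "\<And>w. norm w = 1 \<Longrightarrow> \<bar>(ln (norm (F w) + e) + e) - Re (poly q w)\<bar> < e"
      using circle_approximation e by metis
    have "norm (F z * exp (- poly q z)) \<le> 1"
    proof (rule maximum_modulus_disc[where F = "\<lambda>z. F z * exp (- poly q z)"])
      fix w :: complex assume "norm w = 1"
      from q[OF this] have "ln (norm (F w) + e) \<le> Re (poly q w)" by linarith
      then have "norm (F w) + e \<le> exp (Re (poly q w))"
        using e by (metis add_nonneg_pos exp_le_cancel_iff exp_ln norm_ge_zero)
      then have "norm (F w) \<le> exp (Re (poly q w))" using e by linarith
      then have "norm (F w) * exp (- Re (poly q w)) \<le> exp (Re (poly q w)) * exp (- Re (poly q w))"
        by (intro mult_right_mono) auto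
      then show "norm (F w * exp (- poly q w)) \<le> 1"
        by (simp add: norm_mult exp_minus_inverse)
    next
      show "norm z \<le> 1" using z by simp
    qed (intro continuous_intros holomorphic_intros F)+
    then have "norm (F z) * exp (- Re (poly q z)) \<le> 1"
      by (simp add: norm_mult)
    then have "norm (F z) * exp (- Re (poly q z)) * exp (Re (poly q z)) \<le> 1 * exp (Re (poly q z))"
      by (intro mult_right_mono) auto
    then have "norm (F z) \<le> exp (Re (poly q z))"
      by (simp only: mult.assoc mult_1 mult_1_right flip: exp_add) simp
    then have "norm (F z) powr s \<le> exp (Re (poly q z)) powr s"
      using s by (intro powr_mono2) auto
    also have "\<dots> = norm (exp (of_real s * poly q z))"
      by (simp add: powr_def)
    also have "exp (of_real s * poly q z) = (LINT w|circ. poisson z w *\<^sub>R exp (of_real s * poly q w))"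
      by (intro poisson_integral_formula[symmetric] continuous_intros holomorphic_intros z)
    also have "norm \<dots> \<le> (LINT w|circ. norm (poisson z w *\<^sub>R exp (of_real s * poly q w)))"
      by (rule integral_norm_bound)
    also have "\<dots> \<le> (LINT w|circ. poisson z w * (exp (2 * e * s) * (norm (F w) + e) powr s))"
    proof (intro integral_mono integrable_circ_continuous continuous_intros FS continuous_on_poisson z)
      fix w assume "w \<in> space circ"
      then have w: "norm w = 1" by simp
      have "s * Re (poly q w) \<le> s * (ln (norm (F w) + e) + 2*e)"
        using q[OF w] s by (intro mult_left_mono) linarith+
      then have "exp (s * Re (poly q w)) \<le> exp (2 * e * s) * (norm (F w) + e) powr s"
        using nz[of w] by (simp add: powr_def algebra_simps flip: exp_add)
      from mult_left_mono[OF this poisson_nonneg[OF z, of w]]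
      show "norm (poisson z w *\<^sub>R exp (of_real s * poly q w)) \<le> poisson z w * (exp (2 * e * s) * (norm (F w) + e) powr s)"
        by (simp add: poisson_nonneg[OF z])
    qed (use nz in auto)
    finally show ?thesis .
  qed
  define e where "e n = 1 / (real n + 1)" for n
  have e0: "e n > 0" "e n \<le> 1" for n by (auto simp: e_def)
  have elim: "e \<longlonglongrightarrow> 0" unfolding e_def by real_asymp
  have "(\<lambda>n. LINT w|circ. poisson z w * (exp (2 * e n * s) * (norm (F w) + e n) powr s))
     \<longlonglongrightarrow> (LINT w|circ. poisson z w * norm (F w) powr s)"
  \<comment> \<open>For e <= 1 everything is dominated by the expression at e = 1.\<close>
  proof (rule integral_dominated_convergence)
    show "integrable circ (\<lambda>w. poisson z w * (exp (2 * s) * (norm (F w) + 1) powr s))"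
      by (intro integrable_circ_continuous continuous_intros FS continuous_on_poisson z)
        (auto simp: add_nonneg_eq_0_iff)
    show "AE w in circ. (\<lambda>n. poisson z w * (exp (2 * e n * s) * (norm (F w) + e n) powr s))
       \<longlonglongrightarrow> poisson z w * norm (F w) powr s"
    proof (intro AE_I2 tendsto_mult tendsto_const)
      fix w
      have "(\<lambda>n. exp (2 * e n * s) * (norm (F w) + e n) powr s) \<longlonglongrightarrow> exp (2 * 0 * s) * (norm (F w) + 0) powr s"
        using s e0 by (intro tendsto_intros elim tendsto_powr2) (auto intro!: always_eventually add_nonneg_nonneg less_imp_le[OF e0(1)])
      then show "(\<lambda>n. exp (2 * e n * s) * (norm (F w) + e n) powr s) \<longlonglongrightarrow> norm (F w) powr s" by simp
    qed
    show "AE w in circ. norm (poisson z w * (exp (2 * e n * s) * (norm (F w) + e n) powr s))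
       \<le> poisson z w * (exp (2 * s) * (norm (F w) + 1) powr s)" for n
    proof (intro AE_I2)
      fix w
      have "e n * s \<le> 1 * s" using s e0 by (intro mult_right_mono) auto
      then have "exp (2 * e n * s) * (norm (F w) + e n) powr s \<le> exp (2 * s) * (norm (F w) + 1) powr s"
        using e0[of n] s by (intro mult_mono powr_mono2) auto
      from mult_left_mono[OF this poisson_nonneg[OF z, of w]]
      show "norm (poisson z w * (exp (2 * e n * s) * (norm (F w) + e n) powr s))
         \<le> poisson z w * (exp (2 * s) * (norm (F w) + 1) powr s)"
        by (simp add: abs_mult poisson_nonneg[OF z])
    qed
    show "(\<lambda>w. poisson z w * norm (F w) powr s) \<in> borel_measurable circ"
      "(\<lambda>w. poisson z w * (exp (2 * e n * s) * (norm (F w) + e n) powr s)) \<in> borel_measurable circ" for n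
      using borel_measurable_circ_continuous[OF FS] borel_measurable_circ_continuous[OF continuous_on_poisson[OF z]]
      by measurable
  qed
  then show ?thesis
    by (rule LIMSEQ_le_const) (use approx e0 in blast)
qed

section \<open>Dilations and monotone power means\<close>

lemma continuous_on_dilation:
  assumes "F holomorphic_on ball 0 1" "0 \<le> r" "r < 1"
  shows "continuous_on (cball 0 1) (\<lambda>w. F (of_real r * w))" "(\<lambda>w. F (of_real r * w)) holomorphic_on ball 0 1"
    "continuous_on (sphere 0 1) (\<lambda>w. F (of_real r * w))"
proof -
  have *: "(\<lambda>w. of_real r * w) ` cball 0 1 \<subseteq> ball (0::complex) 1"
  proof clarsimp
    fix w :: complex assume "norm w \<le> 1"
    then have "r * norm w \<le> r * 1" using assms by (intro mult_left_mono) auto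
    then show "norm (of_real r * w) < 1" using assms by (simp add: norm_mult)
  qed
  show 1: "continuous_on (cball 0 1) (\<lambda>w. F (of_real r * w))"
    by (rule continuous_on_compose2[OF holomorphic_on_imp_continuous_on[OF assms(1)] _ *]) (intro continuous_intros)
  show "continuous_on (sphere 0 1) (\<lambda>w. F (of_real r * w))"
    by (rule continuous_on_subset[OF 1]) force
  have "F \<circ> (\<lambda>w. of_real r * w) holomorphic_on ball 0 1"
    using * by (intro holomorphic_on_compose_gen[OF _ assms(1)] holomorphic_intros) force
  then show "(\<lambda>w. F (of_real r * w)) holomorphic_on ball 0 1" by (simp add: o_def)
qed

text \<open>The Poisson majorant of |F|^s at r v is averaged over v; by Fubini this average is the
  boundary integral.\<close>

lemma power_mean_le_boundary:
  fixes F :: "complex \<Rightarrow> complex"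
  assumes F: "continuous_on (cball 0 1) F" "F holomorphic_on ball 0 1" and r: "0 \<le> r" "r < 1" and s: "s > 0"
  shows "(LINT w|circ. norm (F (of_real r * w)) powr s) \<le> (LINT w|circ. norm (F w) powr s)"
proof -
  let ?u = "\<lambda>w. norm (F w) powr s"
  have FS: "continuous_on (sphere 0 1) F" by (rule continuous_on_subset[OF F(1)]) force
  have Fr: "continuous_on (sphere 0 1) (\<lambda>w. F (of_real r * w))"
    using continuous_on_dilation[OF F(2)] r by auto
  have um: "?u \<in> borel_measurable circ"
    using borel_measurable_circ_continuous[OF FS] by measurable
  have ui: "integrable circ ?u"
    using s by (intro integrable_circ_continuous continuous_on_powr' continuous_intros FS) auto
  have *: "ennreal (norm (F (of_real r * v)) powr s) \<le> (\<integral>\<^sup>+w. ennreal (poisson (of_real r * v) w) * ?u w \<partial>circ)"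
    if v: "norm v = 1" for v
  proof -
    have z: "norm (of_real r * v) < 1" using r v by (simp add: norm_mult)
    have "norm (F (of_real r * v)) powr s \<le> (LINT w|circ. poisson (of_real r * v) w * ?u w)"
      by (rule norm_powr_le_poisson[OF F z s])
    then have "ennreal (norm (F (of_real r * v)) powr s) \<le> ennreal (LINT w|circ. poisson (of_real r * v) w * ?u w)"
      by (intro ennreal_leI)
    also have "\<dots> = (\<integral>\<^sup>+w. ennreal (poisson (of_real r * v) w * ?u w) \<partial>circ)"
      using integrable_poisson_mult[OF z ui]
      by (intro nn_integral_eq_integral[symmetric] AE_I2 mult_nonneg_nonneg poisson_nonneg z) auto
    finally show ?thesis by (simp add: ennreal_mult poisson_nonneg[OF z])
  qed
  have "(\<integral>\<^sup>+v. ennreal (norm (F (of_real r * v)) powr s) \<partial>circ) \<le>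
    (\<integral>\<^sup>+v. (\<integral>\<^sup>+w. ennreal (poisson (of_real r * v) w) * ?u w \<partial>circ) \<partial>circ)"
    using * by (intro nn_integral_mono) auto
  also have "\<dots> = (\<integral>\<^sup>+w. ?u w \<partial>circ)"
    by (rule nn_integral_poisson_average[OF _ r]) (use um in measurable)
  finally have "(\<integral>\<^sup>+v. ennreal (norm (F (of_real r * v)) powr s) \<partial>circ) \<le> (\<integral>\<^sup>+w. ?u w \<partial>circ)" .
  moreover have "integrable circ (\<lambda>w. norm (F (of_real r * w)) powr s)"
    using s by (intro integrable_circ_continuous continuous_on_powr' continuous_intros Fr) auto
  ultimately show ?thesis
    using ui by (simp add: nn_integral_eq_integral)
qed

lemma power_mean_mono:
  assumes F: "F holomorphic_on ball 0 1" and r: "0 \<le> r" "r \<le> R" "R < 1" and s: "s > 0"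
  shows "(LINT w|circ. norm (F (of_real r * w)) powr s) \<le> (LINT w|circ. norm (F (of_real R * w)) powr s)"
proof (cases "r = R")
  case False
  with r have R: "0 < R" and q: "0 \<le> r / R" "r / R < 1" by auto
  have "(LINT w|circ. norm (F (of_real R * (of_real (r/R) * w))) powr s) \<le> (LINT w|circ. norm (F (of_real R * w)) powr s)"
    using continuous_on_dilation[OF F less_imp_le[OF R] r(3)] q s by (intro power_mean_le_boundary)
  then show ?thesis using R by simp
qed simp

subsection \<open>A weak type inequality in Stolz regions\<close>

lemma dist_sphere_le_2: "norm w = 1 \<Longrightarrow> norm x = 1 \<Longrightarrow> dist w (x::complex) \<le> 2"
  using norm_triangle_ineq4[of w x] by (simp add: dist_norm)

text \<open>The circle is cut into rings of radius 2^j (1 - |z|) around \<open>w\<close>, where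
  \<open>w\<close> will be the vertex of a Stolz region containing \<open>z\<close>. The factor
  \<open>b\<close> exchanges distances to \<open>z\<close> for distances to \<open>w\<close>;
  \<open>J\<close> is so large that the last ring reaches the diameter 2.\<close>

lemma poisson_dyadic_bound:
  assumes z: "norm z < 1" and x: "norm x = 1" and w: "norm w = 1"
    and b: "1 \<le> b" "dist w x \<le> b * dist z x" and J: "1 \<le> 2 ^ J * (1 - norm z)"
  shows "poisson z x \<le> (\<Sum>j\<le>Suc J. 8 * b\<^sup>2 / (4 ^ j * (1 - norm z)) * indicator (cball w (2 ^ j * (1 - norm z))) x)"
proof -
  define h where "h = 1 - norm z"
  define c where "c j = 8 * b\<^sup>2 / (4 ^ j * h)" for j :: nat
  have h: "0 < h" using z by (simp add: h_def)
  have dz: "h \<le> dist z x"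
    using norm_triangle_ineq2[of x z] x by (simp add: h_def dist_norm norm_minus_commute)
  have P: "poisson z x \<le> 2 * h / (dist z x)\<^sup>2"
  proof -
    have "1 - (norm z)\<^sup>2 = h * (1 + norm z)" by (simp add: h_def power2_eq_square algebra_simps)
    also have "\<dots> \<le> h * 2" using z h by (intro mult_left_mono) auto
    finally show ?thesis unfolding poisson_def
      by (simp add: dist_norm norm_minus_commute divide_right_mono mult.commute)
  qed
  have single: "poisson z x \<le> (\<Sum>j\<le>Suc J. c j * indicator (cball w (2 ^ j * h)) x)"
    if "j \<le> Suc J" "dist w x \<le> 2 ^ j * h" "poisson z x \<le> c j" for j
  proof -
    have "poisson z x \<le> c j * indicator (cball w (2 ^ j * h)) x" using that by simp
    also have "\<dots> \<le> (\<Sum>j\<le>Suc J. c j * indicator (cball w (2 ^ j * h)) x)"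
      using that h by (intro member_le_sum) (auto simp: c_def)
    finally show ?thesis .
  qed
  have ex: "dist w x \<le> 2 ^ Suc J * h"
    using dist_sphere_le_2[OF w x] J by (simp add: h_def)
  define j where "j = (LEAST j. dist w x \<le> 2 ^ j * h)"
  have j1: "dist w x \<le> 2 ^ j * h" unfolding j_def by (rule LeastI[of _ "Suc J"]) (rule ex)
  have j2: "j \<le> Suc J" unfolding j_def by (rule Least_le) (rule ex)
  have "poisson z x \<le> c j"
  proof (cases j)
    case 0
    have "2 * h / (dist z x)\<^sup>2 \<le> 2 * h / h\<^sup>2"
      using dz h by (intro divide_left_mono power_mono mult_pos_pos zero_less_power) auto
    also have "\<dots> = 2 / h" using h by (simp add: power2_eq_square)
    also have "\<dots> \<le> 8 * b\<^sup>2 / h"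
    proof -
      have "1 \<le> b\<^sup>2" using b by (simp add: one_le_power)
      then show ?thesis using h by (intro divide_right_mono) auto
    qed
    finally show ?thesis using P 0 by (simp add: c_def)
  next
    case (Suc i)
    \<comment> \<open>Minimality of \<open>j\<close> bounds the distance from below at the previous
      radius; passing from \<open>i\<close> to \<open>j\<close> costs a factor 4 and turns 2 into
      8.\<close>
    then have "\<not> dist w x \<le> 2 ^ i * h" unfolding j_def by (metis lessI not_less_Least)
    then have d: "2 ^ i * h < b * dist z x" using b(2) by linarith
    have p: "0 < 2 ^ i * h / b" using h b by simp
    have d': "2 ^ i * h / b < dist z x" using d b by (simp add: field_simps)
    have "2 * h / (dist z x)\<^sup>2 \<le> 2 * h / (2 ^ i * h / b)\<^sup>2"
      using d' h p by (intro divide_left_mono power_mono mult_pos_pos zero_less_power) linarith+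
    also have "\<dots> = c j"
      using h b by (simp add: Suc c_def power_divide power_mult_distrib power2_eq_square field_simps
          flip: power_mult_distrib)
    finally show ?thesis using P by simp
  qed
  from single[OF j2 j1 this] show ?thesis by (simp add: c_def h_def)
qed

lemma stolz_region_dist:
  assumes "z \<in> stolz_region \<alpha> w" "norm w = 1" "norm x = 1" "\<alpha> > 0"
  shows "dist w x \<le> (1 + \<alpha>) * dist z x"
proof -
  have "dist w z = norm (z - w)" by (metis dist_commute dist_norm)
  then have 1: "dist w z \<le> \<alpha> * (1 - norm z)" using assms by (simp add: stolz_region_def)
  have "1 - norm z \<le> dist z x"
    using norm_triangle_ineq2[of x z] assms by (simp add: dist_norm norm_minus_commute)
  then have "\<alpha> * (1 - norm z) \<le> \<alpha> * dist z x" using assms by (intro mult_left_mono) auto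
  then have "dist w z + dist z x \<le> \<alpha> * dist z x + dist z x" using 1 by linarith
  also have "\<dots> = (1 + \<alpha>) * dist z x" by (simp add: distrib_right)
  finally have "dist w z + dist z x \<le> (1 + \<alpha>) * dist z x" .
  with dist_triangle[of w x z] show ?thesis by (rule order_trans)
qed

lemma cball_sphere_sets_circ [measurable]: "cball w u \<inter> sphere 0 1 \<in> sets circ"
  unfolding sets_circ by (simp add: sets_restrict_space_iff)

text \<open>By contraposition: if every ball mass stayed below k d with k = l / (32 (1 +
  \<alpha>)^2), the ring estimate would sum to a geometric series with terms (l / 4) 2^-j, hence to
  at most l / 2. The bound d <= 2 is what the covering lemma will ask for.\<close>

lemma poisson_stolz_large_average:
  assumes z: "z \<in> stolz_region \<alpha> w" and w: "norm w = 1" and a: "\<alpha> > 0"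
    and u: "integrable circ u" "\<And>x. 0 \<le> u x" and l: "l < (LINT x|circ. poisson z x * u x)"
  obtains d where "0 < d" "d \<le> 2"
    "l / (32 * (1 + \<alpha>)\<^sup>2) * d \<le> (LINT x|circ. indicator (cball w d) x * u x)"
proof -
  define h where "h = 1 - norm z"
  have z1: "norm z < 1" using z by (simp add: stolz_region_def)
  then have h: "0 < h" by (simp add: h_def)
  obtain J where J: "1 / h < 2 ^ J" using real_arch_pow[of 2 "1/h"] by auto
  then have J': "1 \<le> 2 ^ J * (1 - norm z)" using h by (simp add: h_def field_simps)
  define A where "A d = (LINT x|circ. indicator (cball w d) x * u x)" for d
  have ind: "(\<lambda>x. indicator (cball w d) x :: real) \<in> borel_measurable circ" for d
    using cball_sphere_sets_circ[of w d]
    by (subst measurable_cong[where g="indicator (cball w d \<inter> sphere 0 1)"]) (auto simp: indicator_def)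
  have intA: "integrable circ (\<lambda>x. indicator (cball w d) x * u x)" for d
  proof (rule Bochner_Integration.integrable_bound[OF u(1)])
    show "(\<lambda>x. indicator (cball w d) x * u x) \<in> borel_measurable circ" using ind u(1) by measurable
  qed (auto simp: indicator_def)
  show ?thesis
  proof (cases "\<exists>d. 0 < d \<and> d \<le> 2 \<and> l / (32 * (1 + \<alpha>)\<^sup>2) * d \<le> A d")
    case True
    then show ?thesis using that by (auto simp: A_def)
  next
    case False
    have A0: "0 \<le> A d" for d unfolding A_def using u(2) by (intro integral_nonneg_AE) auto
    let ?k = "l / (32 * (1 + \<alpha>)\<^sup>2)"
    have A2: "A 2 < ?k * 2" using False by force
    \<comment> \<open>Positivity of \<open>l\<close> follows: the mass at radius 2 is nonnegative
      and lies below 2 k.\<close>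
    have k0: "0 < ?k" using A0[of 2] A2 by linarith
    have Ad: "A d \<le> ?k * d" if "0 < d" for d
    proof (cases "d \<le> 2")
      case True
      then show ?thesis using False that by force
    next
      case F: False
      have "A d = A 2"
        unfolding A_def
      proof (intro Bochner_Integration.integral_cong refl)
        fix x assume "x \<in> space circ"
        then have "dist w x \<le> 2" using w by (intro dist_sphere_le_2) auto
        then show "indicator (cball w d) x * u x = indicator (cball w 2) x * u x"
          using F by simp
      qed
      also have "\<dots> \<le> ?k * 2" using A2 by simp
      also have "\<dots> \<le> ?k * d" using F k0 by (intro mult_left_mono) auto
      finally show ?thesis .
    qed
    have "(LINT x|circ. poisson z x * u x) \<le> (LINT x|circ. (\<Sum>j\<le>Suc J. 8 * (1+\<alpha>)\<^sup>2 / (4 ^ j * h) * (indicator (cball w (2 ^ j * h)) x * u x)))"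
    proof (intro integral_mono)
      show "integrable circ (\<lambda>x. poisson z x * u x)" using integrable_poisson_mult[OF z1 u(1)] by simp
      show "integrable circ (\<lambda>x. \<Sum>j\<le>Suc J. 8 * (1+\<alpha>)\<^sup>2 / (4 ^ j * h) * (indicator (cball w (2 ^ j * h)) x * u x))"
        by (intro Bochner_Integration.integrable_sum integrable_mult_right intA)
      fix x assume "x \<in> space circ"
      then have x: "norm x = 1" by simp
      have "poisson z x \<le> (\<Sum>j\<le>Suc J. 8 * (1+\<alpha>)\<^sup>2 / (4 ^ j * h) * indicator (cball w (2 ^ j * h)) x)"
        unfolding h_def
        by (rule poisson_dyadic_bound[OF z1 x w _ _ J']) (use stolz_region_dist[OF z w x a] a in auto)
      from mult_right_mono[OF this u(2)[of x]]
      show "poisson z x * u x \<le> (\<Sum>j\<le>Suc J. 8 * (1+\<alpha>)\<^sup>2 / (4 ^ j * h) * (indicator (cball w (2 ^ j * h)) x * u x))"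
        by (simp only: sum_distrib_right mult.assoc)
    qed
    also have "\<dots> = (\<Sum>j\<le>Suc J. 8 * (1+\<alpha>)\<^sup>2 / (4 ^ j * h) * A (2 ^ j * h))"
      unfolding A_def using intA by (subst Bochner_Integration.integral_sum) auto
    also have "\<dots> \<le> (\<Sum>j\<le>Suc J. 8 * (1+\<alpha>)\<^sup>2 / (4 ^ j * h) * (?k * (2 ^ j * h)))"
      using h by (intro sum_mono mult_left_mono Ad) auto
    also have "\<dots> = (\<Sum>j\<le>Suc J. l / 4 * (1/2) ^ j)"
    proof (intro sum.cong refl)
      fix j :: nat
      have "(4::real) ^ j = 2 ^ j * 2 ^ j" by (simp flip: power_mult_distrib)
      then show "8 * (1+\<alpha>)\<^sup>2 / (4 ^ j * h) * (?k * (2 ^ j * h)) = l / 4 * (1/2) ^ j"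
        using h a by (simp add: power_one_over field_simps)
    qed
    also have "\<dots> = l / 4 * (\<Sum>j\<le>Suc J. (1/2) ^ j)" by (rule sum_distrib_left[symmetric])
    also have "\<dots> \<le> l / 4 * 2"
    proof (intro mult_left_mono)
      show "(\<Sum>j\<le>Suc J. (1/2) ^ j) \<le> (2::real)" by (subst sum_gp_basic[of "1/2::real", simplified, symmetric, THEN sym] | simp add: sum_gp0)+
      show "0 \<le> l / 4" using k0 a by (simp add: zero_less_divide_iff)
    qed
    also have "\<dots> \<le> l" using k0 a by (simp add: zero_less_divide_iff)
    finally show ?thesis using l by simp
  qed
qed

text \<open>The set where the nontangential maximal function of \<open>k\<close> with aperture
  \<open>\<alpha>\<close> exceeds \<open>l\<close>.\<close>

definition stolz_large :: "real \<Rightarrow> real \<Rightarrow> (complex \<Rightarrow> complex) \<Rightarrow> complex set" where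
  "stolz_large \<alpha> l k = {w \<in> sphere 0 1. \<exists>z\<in>stolz_region \<alpha> w. l < norm (k z)}"

text \<open>For fixed \<open>z\<close> the Stolz condition is open in \<open>w\<close>, so the set
  is relatively open, for arbitrary \<open>k\<close>.\<close>

lemma stolz_large_sets [measurable]: "stolz_large \<alpha> l k \<in> sets circ"
proof -
  have "stolz_large \<alpha> l k = sphere 0 1 \<inter> (\<Union>z\<in>{z \<in> ball 0 1. l < norm (k z)}. {w. norm (z - w) < \<alpha> * (1 - norm z)})"
    by (auto simp: stolz_large_def stolz_region_def)
  moreover have "open (\<Union>z\<in>{z \<in> ball 0 1. l < norm (k z)}. {w. norm (z - w) < \<alpha> * (1 - norm z)})"
    by (intro open_UN ballI open_Collect_less continuous_intros)
  ultimately show ?thesis by (subst sets_circ) (auto simp: sets_restrict_space)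
qed

text \<open>The Poisson majorant of |k|^2 gives each point of the set a ball of radius d and mass at
  least c d, c = l^2 / (32 (1 + \<alpha>)^2). Vitali's lemma selects disjoint balls whose fivefold
  enlargements cover the set, and 160 = 5 * 32.\<close>

lemma stolz_weak_type:
  assumes k: "continuous_on (cball 0 1) k" "k holomorphic_on ball 0 1" and a: "\<alpha> > 0" and l: "l > 0"
  shows "emeasure circ (stolz_large \<alpha> l k) \<le> ennreal (160 * (1+\<alpha>)\<^sup>2 / l\<^sup>2 * (LINT w|circ. norm (k w) powr 2))"
proof -
  let ?E = "stolz_large \<alpha> l k" and ?u = "\<lambda>w. norm (k w) powr 2"
  let ?c = "l\<^sup>2 / (32 * (1+\<alpha>)\<^sup>2)"
  have kS: "continuous_on (sphere 0 1) k" by (rule continuous_on_subset[OF k(1)]) force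
  have um[measurable]: "?u \<in> borel_measurable circ"
    using borel_measurable_circ_continuous[OF kS] by measurable
  have ui: "integrable circ ?u"
    by (intro integrable_circ_continuous continuous_on_powr' continuous_intros kS) auto
  have c0: "?c > 0" using l a by (intro divide_pos_pos mult_pos_pos zero_less_power) auto
  have "\<forall>w\<in>?E. \<exists>d. 0 < d \<and> d \<le> 2 \<and> ?c * d \<le> (LINT x|circ. indicator (cball w d) x * ?u x)"
  proof
    fix w assume wE: "w \<in> ?E"
    from wE obtain z where w: "norm w = 1" and z: "z \<in> stolz_region \<alpha> w" "l < norm (k z)"
      by (auto simp: stolz_large_def)
    have "norm z < 1" using z by (simp add: stolz_region_def)
    then have "norm (k z) powr 2 \<le> (LINT w|circ. poisson z w * ?u w)"
      by (intro norm_powr_le_poisson k) auto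
    moreover have "l\<^sup>2 < norm (k z) powr 2" using z(2) l by (simp add: power_strict_mono)
    ultimately have *: "l\<^sup>2 < (LINT w|circ. poisson z w * ?u w)" by linarith
    show "\<exists>d. 0 < d \<and> d \<le> 2 \<and> ?c * d \<le> (LINT x|circ. indicator (cball w d) x * ?u x)"
      by (rule poisson_stolz_large_average[OF z(1) w a ui _ *]) auto
  qed
  from bchoice[OF this] obtain d where d: "\<And>w. w \<in> ?E \<Longrightarrow> 0 < d w \<and> d w \<le> 2"
    and dA: "\<And>w. w \<in> ?E \<Longrightarrow> ?c * d w \<le> (LINT x|circ. indicator (cball w (d w)) x * ?u x)"
    by blast
  have "?E \<subseteq> (\<Union>w\<in>?E. cball w (d w))" using d by force
  from Vitali_covering_lemma_cballs[OF this d] obtain C where C: "countable C" "C \<subseteq> ?E"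
    and disj: "pairwise (\<lambda>i j. disjnt (cball i (d i)) (cball j (d j))) C"
    and cov: "?E \<subseteq> (\<Union>i\<in>C. cball i (5 * d i))" by blast
  have S: "?E \<subseteq> sphere 0 1" by (auto simp: stolz_large_def)
  have "emeasure circ ?E = (\<integral>\<^sup>+x. indicator ?E x \<partial>circ)" by simp
  \<comment> \<open>Countable sums are written as integrals over a counting measure, so that they
    can be exchanged with the integral over the circle.\<close>
  also have "\<dots> \<le> (\<integral>\<^sup>+x. (\<integral>\<^sup>+i. indicator (cball i (5 * d i) \<inter> sphere 0 1) x \<partial>count_space C) \<partial>circ)"
  proof (intro nn_integral_mono)
    fix x
    show "indicator ?E x \<le> (\<integral>\<^sup>+i. indicator (cball i (5 * d i) \<inter> sphere 0 1) x \<partial>count_space C)"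
    proof (cases "x \<in> ?E")
      case True
      then obtain i where i: "i \<in> C" "x \<in> cball i (5 * d i)" using cov by blast
      have "1 = (\<integral>\<^sup>+j. indicator {i} j \<partial>count_space C)" using i by simp
      also have "\<dots> \<le> (\<integral>\<^sup>+i. indicator (cball i (5 * d i) \<inter> sphere 0 1) x \<partial>count_space C)"
        using i True S by (intro nn_integral_mono) (auto simp: indicator_def)
      finally show ?thesis using True by simp
    qed simp
  qed
  also have "\<dots> = (\<integral>\<^sup>+i. (\<integral>\<^sup>+x. indicator (cball i (5 * d i) \<inter> sphere 0 1) x \<partial>circ) \<partial>count_space C)"
    using C(1) by (intro nn_integral_count_space_nn_integral) auto
  also have "\<dots> \<le> (\<integral>\<^sup>+i. ennreal (5 / ?c) * (\<integral>\<^sup>+x. indicator (cball i (d i) \<inter> sphere 0 1) x * ?u x \<partial>circ) \<partial>count_space C)"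
  proof (intro nn_integral_mono)
    fix i assume "i \<in> space (count_space C)"
    then have i: "i \<in> ?E" using C by auto
    then have n1: "norm i = 1" using S by auto
    have "(\<integral>\<^sup>+x. indicator (cball i (5 * d i) \<inter> sphere 0 1) x \<partial>circ) = emeasure circ (cball i (5 * d i) \<inter> sphere 0 1)"
      by simp
    also have "\<dots> \<le> ennreal (5 * d i)" by (rule emeasure_circ_cball[OF n1])
    also have "\<dots> \<le> ennreal (5 / ?c * (LINT x|circ. indicator (cball i (d i)) x * ?u x))"
    proof (intro ennreal_leI)
      have "5 / ?c * (?c * d i) \<le> 5 / ?c * (LINT x|circ. indicator (cball i (d i)) x * ?u x)"
        using dA[OF i] c0 by (intro mult_left_mono) auto
      moreover have "5 / ?c * (?c * d i) = 5 * d i" using l a by simp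
      ultimately show "5 * d i \<le> 5 / ?c * (LINT x|circ. indicator (cball i (d i)) x * ?u x)" by linarith
    qed
    also have "\<dots> = ennreal (5 / ?c) * ennreal (LINT x|circ. indicator (cball i (d i)) x * ?u x)"
      using c0 by (intro ennreal_mult integral_nonneg_AE) auto
    finally have up: "(\<integral>\<^sup>+x. indicator (cball i (5 * d i) \<inter> sphere 0 1) x \<partial>circ) \<le>
      ennreal (5 / ?c) * ennreal (LINT x|circ. indicator (cball i (d i)) x * ?u x)" .
    have e1: "ennreal (LINT x|circ. indicator (cball i (d i)) x * ?u x) = (\<integral>\<^sup>+x. ennreal (indicator (cball i (d i) \<inter> sphere 0 1) x * ?u x) \<partial>circ)"
    proof -
      have "integrable circ (\<lambda>x. indicator (cball i (d i) \<inter> sphere 0 1) x *\<^sub>R ?u x)"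
        by (rule integrable_mult_indicator[OF cball_sphere_sets_circ ui])
      then have "(\<integral>\<^sup>+x. ennreal (indicator (cball i (d i) \<inter> sphere 0 1) x * ?u x) \<partial>circ) =
        ennreal (LINT x|circ. indicator (cball i (d i) \<inter> sphere 0 1) x * ?u x)"
        by (intro nn_integral_eq_integral) auto
      also have "(LINT x|circ. indicator (cball i (d i) \<inter> sphere 0 1) x * ?u x) = (LINT x|circ. indicator (cball i (d i)) x * ?u x)"
        by (intro Bochner_Integration.integral_cong refl) (auto simp: indicator_def)
      finally show ?thesis ..
    qed
    show "(\<integral>\<^sup>+x. indicator (cball i (5 * d i) \<inter> sphere 0 1) x \<partial>circ) \<le>
      ennreal (5 / ?c) * (\<integral>\<^sup>+x. indicator (cball i (d i) \<inter> sphere 0 1) x * ?u x \<partial>circ)"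
      using up unfolding e1 .
  qed
  also have "\<dots> = ennreal (5 / ?c) * (\<integral>\<^sup>+i. (\<integral>\<^sup>+x. indicator (cball i (d i) \<inter> sphere 0 1) x * ?u x \<partial>circ) \<partial>count_space C)"
    by (rule nn_integral_cmult) simp
  finally have up: "emeasure circ ?E \<le> ennreal (5 / ?c) * (\<integral>\<^sup>+i. (\<integral>\<^sup>+x. indicator (cball i (d i) \<inter> sphere 0 1) x * ?u x \<partial>circ) \<partial>count_space C)" .
  have m: "(\<lambda>x. ennreal (indicator (cball i (d i) \<inter> sphere 0 1) x * ?u x)) \<in> borel_measurable circ" for i
    by measurable
  have swap: "(\<integral>\<^sup>+i. (\<integral>\<^sup>+x. indicator (cball i (d i) \<inter> sphere 0 1) x * ?u x \<partial>circ) \<partial>count_space C)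
     = (\<integral>\<^sup>+x. (\<integral>\<^sup>+i. indicator (cball i (d i) \<inter> sphere 0 1) x * ?u x \<partial>count_space C) \<partial>circ)"
    using C(1) by (intro nn_integral_count_space_nn_integral[symmetric] m)
  note up
  also have "ennreal (5 / ?c) * (\<integral>\<^sup>+i. (\<integral>\<^sup>+x. indicator (cball i (d i) \<inter> sphere 0 1) x * ?u x \<partial>circ) \<partial>count_space C)
      \<le> ennreal (5 / ?c) * (\<integral>\<^sup>+x. ?u x \<partial>circ)" unfolding swap
  proof (intro mult_left_mono nn_integral_mono)
    fix x
    have "(\<integral>\<^sup>+i. indicator (cball i (d i) \<inter> sphere 0 1) x \<partial>count_space C) \<le> (1::ennreal)"
    proof (cases "\<exists>i\<in>C. x \<in> cball i (d i)")
      case True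
      then obtain i where i: "i \<in> C" "x \<in> cball i (d i)" by blast
      have "j = i" if "j \<in> C" "x \<in> cball j (d j)" for j
        using disj i that unfolding pairwise_def disjnt_def by blast
      then have "(\<integral>\<^sup>+i. indicator (cball i (d i) \<inter> sphere 0 1) x \<partial>count_space C) \<le> (\<integral>\<^sup>+j. indicator {i} j \<partial>count_space C)"
        by (intro nn_integral_mono) (auto simp: indicator_def)
      also have "\<dots> = 1" using i by simp
      finally show ?thesis .
    next
      case False
      then have "(\<integral>\<^sup>+i. indicator (cball i (d i) \<inter> sphere 0 1) x \<partial>count_space C) = (\<integral>\<^sup>+i. 0 \<partial>count_space C)"
        by (intro nn_integral_cong) (auto simp: indicator_def)
      then show ?thesis by simp
    qed
    then have *: "(\<integral>\<^sup>+i. indicator (cball i (d i) \<inter> sphere 0 1) x \<partial>count_space C) * ennreal (?u x) \<le> 1 * ennreal (?u x)"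
      by (intro mult_right_mono) auto
    show "(\<integral>\<^sup>+i. indicator (cball i (d i) \<inter> sphere 0 1) x * ?u x \<partial>count_space C) \<le> ennreal (?u x)"
    proof -
      have "(\<integral>\<^sup>+i. indicator (cball i (d i) \<inter> sphere 0 1) x * ?u x \<partial>count_space C)
        = (\<integral>\<^sup>+i. indicator (cball i (d i) \<inter> sphere 0 1) x * ennreal (?u x) \<partial>count_space C)"
        by (intro nn_integral_cong) (auto simp: indicator_def)
      also have "\<dots> = (\<integral>\<^sup>+i. indicator (cball i (d i) \<inter> sphere 0 1) x \<partial>count_space C) * ennreal (?u x)"
        by (rule nn_integral_multc) simp
      finally show ?thesis using * by simp
    qed
  qed simp
  also have "\<dots> = ennreal (5 / ?c * (LINT w|circ. ?u w))"
  proof -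
    have "(\<integral>\<^sup>+x. ?u x \<partial>circ) = ennreal (LINT w|circ. ?u w)"
      by (rule nn_integral_eq_integral[OF ui]) auto
    moreover have "ennreal (5 / ?c * (LINT w|circ. ?u w)) = ennreal (5 / ?c) * ennreal (LINT w|circ. ?u w)"
      using c0 by (intro ennreal_mult integral_nonneg_AE) auto
    ultimately show ?thesis by (simp only:)
  qed
  finally show ?thesis by simp
qed

subsection \<open>Nontangential limits\<close>

text \<open>One fixed sequence of radii increasing to 1; the offset 2 keeps it positive from the
  start.\<close>

definition rho :: "nat \<Rightarrow> real" where "rho n = 1 - 1 / (real n + 2)"

lemma rho: "0 < rho n" "rho n < 1" "0 \<le> rho n"
  by (auto simp: rho_def field_simps)

lemma rho_mono: "m \<le> n \<Longrightarrow> rho m \<le> rho n"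
  by (auto simp: rho_def field_simps)

lemma rho_tendsto: "rho \<longlonglongrightarrow> 1"
  unfolding rho_def by real_asymp

text \<open>For functions without continuous boundary values. If \<open>z\<close> witnesses
  membership, then by continuity at \<open>z\<close> it does so for all late dilations; the large
  set thus lies in an increasing union of intersections, each controlled by a single
  dilation.\<close>

lemma stolz_weak_type_limit:
  assumes k: "k holomorphic_on ball 0 1" and a: "\<alpha> > 0" and l: "l > 0"
    and e: "\<And>n. N \<le> n \<Longrightarrow> (LINT w|circ. norm (k (of_real (rho n) * w)) powr 2) \<le> e"
  shows "emeasure circ (stolz_large \<alpha> l k) \<le> ennreal (160 * (1+\<alpha>)\<^sup>2 / l\<^sup>2 * e)"
proof -
  define S where "S n = stolz_large \<alpha> l (\<lambda>z. k (of_real (rho n) * z))" for n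
  \<comment> \<open>Starting at \<open>max m N\<close> ensures that every dilation involved
    satisfies the bound on the means.\<close>
  define T where "T m = (\<Inter>n\<in>{max m N..}. S n)" for m
  have Sm[measurable]: "S n \<in> sets circ" for n by (simp add: S_def)
  have Tm[measurable]: "T m \<in> sets circ" for m unfolding T_def
    by (intro sets.countable_INT') auto
  have inc: "incseq T"
    unfolding T_def by (rule incseq_SucI) (auto simp: max_def)
  have sub: "stolz_large \<alpha> l k \<subseteq> (\<Union>m. T m)"
  proof
    fix w assume "w \<in> stolz_large \<alpha> l k"
    then obtain z where w: "norm w = 1" and z: "z \<in> stolz_region \<alpha> w" "l < norm (k z)"
      by (auto simp: stolz_large_def)
    have z1: "z \<in> ball 0 1" using z by (simp add: stolz_region_def)
    have "isCont k z"
      using holomorphic_on_imp_continuous_on[OF k] z1 by (simp add: continuous_on_eq_continuous_at)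
    moreover have "(\<lambda>n. of_real (rho n) * z) \<longlonglongrightarrow> of_real 1 * z"
      by (intro tendsto_intros rho_tendsto)
    ultimately have "(\<lambda>n. norm (k (of_real (rho n) * z))) \<longlonglongrightarrow> norm (k z)"
      by (intro tendsto_norm isCont_tendsto_compose[of _ k]) auto
    then have "eventually (\<lambda>n. l < norm (k (of_real (rho n) * z))) sequentially"
      using z(2) by (rule order_tendstoD)
    then obtain m where "\<And>n. n \<ge> m \<Longrightarrow> l < norm (k (of_real (rho n) * z))"
      by (auto simp: eventually_sequentially)
    then have "w \<in> T m" using w z(1) by (auto simp: T_def S_def stolz_large_def intro!: bexI[of _ z])
    then show "w \<in> (\<Union>m. T m)" by blast
  qed
  have "emeasure circ (stolz_large \<alpha> l k) \<le> emeasure circ (\<Union>m. T m)"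
    by (intro emeasure_mono sub) auto
  also have "\<dots> = (SUP m. emeasure circ (T m))"
    by (intro SUP_emeasure_incseq[symmetric] inc) auto
  also have "\<dots> \<le> ennreal (160 * (1+\<alpha>)\<^sup>2 / l\<^sup>2 * e)"
  proof (rule SUP_least)
    fix m
    let ?n = "max m N"
    have "emeasure circ (T m) \<le> emeasure circ (S ?n)"
      by (intro emeasure_mono Sm) (auto simp: T_def)
    also have "\<dots> \<le> ennreal (160 * (1+\<alpha>)\<^sup>2 / l\<^sup>2 * (LINT w|circ. norm (k (of_real (rho ?n) * w)) powr 2))"
      unfolding S_def using continuous_on_dilation[OF k rho(3) rho(2)] a l by (intro stolz_weak_type) auto
    also have "\<dots> \<le> ennreal (160 * (1+\<alpha>)\<^sup>2 / l\<^sup>2 * e)"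
      by (intro ennreal_leI mult_left_mono e) auto
    finally show "emeasure circ (T m) \<le> ennreal (160 * (1+\<alpha>)\<^sup>2 / l\<^sup>2 * e)" .
  qed
  finally show ?thesis .
qed

text \<open>The dilations form a Cauchy sequence in \<open>L\<^sup>2\<close> because the means are monotone: by the
  parallelogram law \<open>\<parallel>g\<^sub>n - g\<^sub>m\<parallel>\<^sup>2 = 2 \<parallel>g\<^sub>n\<parallel>\<^sup>2 + 2 \<parallel>g\<^sub>m\<parallel>\<^sup>2 - \<parallel>g\<^sub>n + g\<^sub>m\<parallel>\<^sup>2\<close>, and the last
  term is at least its value on a smaller circle, where \<open>g\<^sub>n + g\<^sub>m\<close> is almost \<open>2 g\<close>.\<close>

lemma dilations_L2_Cauchy:
  fixes g :: "complex \<Rightarrow> complex"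
  assumes g: "g holomorphic_on ball 0 1" and b: "\<And>z. norm z < 1 \<Longrightarrow> norm (g z) \<le> 1" and e: "0 < e"
  obtains R where "0 \<le> R" "R < 1" "\<And>a b. R \<le> a \<Longrightarrow> a < 1 \<Longrightarrow> R \<le> b \<Longrightarrow> b < 1 \<Longrightarrow>
    (LINT w|circ. norm (g (of_real a * w) - g (of_real b * w)) powr 2) \<le> e"
proof -
  \<comment> \<open>This leaves room: the total loss below is 4 d + 8 d.\<close>
  define d where "d = e / 20"
  have d0: "d > 0" using e by (simp add: d_def)
  define M where "M r = (LINT w|circ. norm (g (of_real r * w)) powr 2)" for r
  have norm1: "norm (of_real r * w) < 1" if "norm w = 1" "0 \<le> r" "r < 1" for r and w :: complex
    using that by (simp add: norm_mult)
  have gc: "continuous_on (sphere 0 1) (\<lambda>w. g (of_real r * w))" if "0 \<le> r" "r < 1" for r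
    using continuous_on_dilation(3)[OF g that] .
  have gi: "integrable circ (\<lambda>w. norm (u w) powr 2)" if "continuous_on (sphere 0 1) u" for u :: "complex \<Rightarrow> complex"
    by (intro integrable_circ_continuous continuous_on_powr' continuous_intros that) auto
  have M1: "M r \<le> 1" if "0 \<le> r" "r < 1" for r
  proof -
    have "M r \<le> (LINT w|circ. 1)" unfolding M_def
    proof (intro integral_mono gi gc that)
      fix w assume "w \<in> space circ"
      then have "norm (g (of_real r * w)) \<le> 1" using norm1[of w r] that by (intro b) auto
      then show "norm (g (of_real r * w)) powr 2 \<le> 1" by (simp add: power_le_one)
    qed simp
    also have "\<dots> = 1" using emeasure_circ_UNIV by (simp add: measure_def)
    finally show ?thesis .
  qed
  have inc: "incseq (\<lambda>n. M (rho n))"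
    unfolding M_def by (intro incseq_SucI power_mean_mono g rho rho_mono) auto
  have "\<forall>n. M (rho n) \<le> 1" using M1 rho by blast
  then obtain T where T: "\<forall>n. M (rho n) \<le> T" "(\<lambda>n. M (rho n)) \<longlonglongrightarrow> T"
    using incseq_convergent[OF inc, of 1] by metis
  have MT: "M a \<le> T" if a: "0 \<le> a" "a < 1" for a
  proof -
    from order_tendstoD(1)[OF rho_tendsto a(2)] obtain n where "a < rho n"
      by (auto simp: eventually_sequentially)
    then have "M a \<le> M (rho n)" unfolding M_def using a rho by (intro power_mean_mono g) auto
    then show ?thesis using T(1) by (meson order_trans)
  qed
  from order_tendstoD(1)[OF T(2), of "T - d"] d0 obtain k where k: "T - d < M (rho k)"
    by (auto simp: eventually_sequentially)
  define c where "c = rho k"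
  have c: "0 \<le> c" "c < 1" using rho by (auto simp: c_def)
  have "uniformly_continuous_on (cball 0 c) g"
    using c by (intro compact_uniformly_continuous holomorphic_on_imp_continuous_on holomorphic_on_subset[OF g]) auto
  then obtain \<eta> where eta: "\<eta> > 0" "\<And>x y. x \<in> cball 0 c \<Longrightarrow> y \<in> cball 0 c \<Longrightarrow> dist y x < \<eta> \<Longrightarrow> dist (g y) (g x) < d"
    using d0 unfolding uniformly_continuous_on_def by blast
  \<comment> \<open>At the radius c < 1 uniform continuity makes a dilation close to the identity
    change \<open>g\<close> by at most \<open>d\<close>.\<close>
  have close: "norm (g (of_real a * (of_real c * w)) - g (of_real c * w)) \<le> d" if a: "0 \<le> a" "a < 1" "1 - \<eta> < a" and w: "norm w = 1" for a w
  proof -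
    have "dist (of_real a * (of_real c * w)) (of_real c * w) = norm (of_real (a - 1) * (of_real c * w))"
      by (simp add: dist_norm algebra_simps)
    also have "\<dots> = (1 - a) * c" using c a w by (simp add: norm_mult del: of_real_diff)
    also have "\<dots> \<le> (1 - a) * 1" using c a by (intro mult_left_mono) auto
    also have "\<dots> < \<eta>" using a by simp
    finally have "dist (of_real a * (of_real c * w)) (of_real c * w) < \<eta>" .
    moreover have "a * c \<le> 1 * c" using a c by (intro mult_right_mono) auto
    ultimately show ?thesis using c w a
      by (intro less_imp_le) (subst dist_norm[symmetric], intro eta(2), auto simp: norm_mult)
  qed
  show ?thesis
  proof (rule that[of "max 0 (1 - \<eta>/2)"])
    show "0 \<le> max 0 (1 - \<eta>/2)" "max 0 (1 - \<eta>/2) < 1" using eta(1) by auto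
    fix a b :: real assume "max 0 (1 - \<eta>/2) \<le> a" "a < 1" "max 0 (1 - \<eta>/2) \<le> b" "b < 1"
    then have n: "0 \<le> a" "a < 1" "1 - \<eta> < a" and m: "0 \<le> b" "b < 1" "1 - \<eta> < b" using eta(1) by auto
    let ?a = "\<lambda>w. g (of_real a * w)" and ?b = "\<lambda>w. g (of_real b * w)"
    have ac: "continuous_on (sphere 0 1) ?a" "continuous_on (sphere 0 1) ?b"
      using gc n m by auto
    have "4 * M c - 8 * d \<le> (LINT w|circ. 4 * norm (g (of_real c * w)) powr 2 - 8 * d)"
      using gi[OF gc[OF c]] emeasure_circ_UNIV by (simp add: M_def measure_def)
    also have "\<dots> \<le> (LINT w|circ. norm (?a (of_real c * w) + ?b (of_real c * w)) powr 2)"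
    proof (intro integral_mono)
      have "continuous_on (sphere 0 1) (\<lambda>w. ?a (of_real c * w) + ?b (of_real c * w))"
        using continuous_on_dilation(3)[OF continuous_on_dilation(2)[OF g n(1,2)] c]
          continuous_on_dilation(3)[OF continuous_on_dilation(2)[OF g m(1,2)] c]
        by (intro continuous_intros) auto
      then show "integrable circ (\<lambda>w. norm (?a (of_real c * w) + ?b (of_real c * w)) powr 2)" by (rule gi)
      show "integrable circ (\<lambda>w. 4 * norm (g (of_real c * w)) powr 2 - 8 * d)"
        using gi[OF gc[OF c]] by simp
      fix w assume "w \<in> space circ"
      then have w: "norm w = 1" by simp
      let ?A = "?a (of_real c * w)" and ?B = "?b (of_real c * w)" and ?G = "g (of_real c * w)"
      have G: "norm ?G \<le> 1" using norm1[OF w c] by (rule b)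
      have "2 * norm ?G = norm ((?A + ?B) - (?A - ?G) - (?B - ?G))"
        by (simp add: norm_mult flip: mult_2)
      also have "\<dots> \<le> norm (?A + ?B) + norm (?A - ?G) + norm (?B - ?G)"
        by (meson add_right_mono norm_triangle_ineq4 order_trans)
      also have "\<dots> \<le> norm (?A + ?B) + 2 * d" using close[OF n w] close[OF m w] by linarith
      finally have le: "2 * norm ?G \<le> norm (?A + ?B) + 2 * d" .
      \<comment> \<open>Squaring requires 2 |g| - 2 d >= 0; otherwise |g|^2 <= d and the left side
        is negative.\<close>
      have "4 * (norm ?G)\<^sup>2 - 8 * d \<le> (norm (?A + ?B))\<^sup>2"
      proof (cases "norm ?G \<le> d")
        case True
        then have "(norm ?G)\<^sup>2 \<le> 1 * d" unfolding power2_eq_square using G d0 by (intro mult_mono) auto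
        moreover have "0 \<le> (norm (?A + ?B))\<^sup>2" by simp
        ultimately show ?thesis using d0 by linarith
      next
        case False
        then have "(2 * norm ?G - 2 * d)\<^sup>2 \<le> (norm (?A + ?B))\<^sup>2" using le by (intro power_mono) auto
        moreover have "norm ?G * d \<le> 1 * d" using G d0 by (intro mult_right_mono) auto
        moreover have "(2 * norm ?G - 2 * d)\<^sup>2 = 4 * (norm ?G)\<^sup>2 - 8 * (norm ?G * d) + 4 * d\<^sup>2"
          by (simp add: power2_eq_square algebra_simps)
        moreover have "0 \<le> d\<^sup>2" by simp
        ultimately show ?thesis by linarith
      qed
      then show "4 * norm ?G powr 2 - 8 * d \<le> norm (?A + ?B) powr 2" by simp
    qed
    also have "\<dots> \<le> (LINT w|circ. norm (?a w + ?b w) powr 2)"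
      using continuous_on_dilation[OF g n(1,2)] continuous_on_dilation[OF g m(1,2)] c
      by (intro power_mean_le_boundary continuous_intros holomorphic_intros) auto
    finally have low: "4 * M c - 8 * d \<le> (LINT w|circ. norm (?a w + ?b w) powr 2)" .
    have par: "norm (x - y) powr 2 = 2 * norm x powr 2 + 2 * norm y powr 2 - norm (x + y) powr 2" for x y :: complex
      by (simp add: cmod_power2) (simp add: power2_eq_square algebra_simps)
    have "(LINT w|circ. norm (?a w - ?b w) powr 2) = 2 * M a + 2 * M b - (LINT w|circ. norm (?a w + ?b w) powr 2)"
      unfolding par M_def using gi[OF ac(1)] gi[OF ac(2)] gi[OF continuous_on_add[OF ac]] by simp
    also have "\<dots> \<le> 4 * T - (4 * M c - 8 * d)"
      using MT[OF n(1,2)] MT[OF m(1,2)] low by linarith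
    also have "\<dots> \<le> e" using k e unfolding c_def d_def by linarith
    finally show "(LINT w|circ. norm (?a w - ?b w) powr 2) \<le> e" .
  qed
qed

section \<open>Radial limits and a Cauchy criterion in Stolz regions\<close>

lemma stolz_region_radial: "norm w = 1 \<Longrightarrow> \<alpha> > 1 \<Longrightarrow> of_real (rho n) * w \<in> stolz_region \<alpha> w"
proof -
  assume w: "norm w = 1" and a: "\<alpha> > 1"
  have "norm (of_real (rho n) * w - w) = norm (of_real (rho n - 1) * w)" by (simp add: algebra_simps)
  also have "\<dots> = 1 * (1 - rho n)" using w rho[of n] by (simp add: norm_mult del: of_real_diff)
  also have "\<dots> < \<alpha> * (1 - rho n)" using a rho[of n] by (intro mult_strict_right_mono) auto
  finally show ?thesis using w rho[of n] by (simp add: stolz_region_def norm_mult)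
qed

lemma stolz_region_mono: "\<alpha> \<le> \<beta> \<Longrightarrow> stolz_region \<alpha> w \<subseteq> stolz_region \<beta> w"
  by (auto simp: stolz_region_def intro: less_le_trans mult_right_mono)

text \<open>Taken along one sequence, hence measurable without knowing where the limit exists;
  wherever a nontangential limit exists, the two agree.\<close>

definition radial_limit :: "(complex \<Rightarrow> complex) \<Rightarrow> complex \<Rightarrow> complex" where
  "radial_limit f w = lim (\<lambda>n. f (of_real (rho n) * w))"

lemma tendsto_rho_mult: "(\<lambda>n. of_real (rho n) * w) \<longlonglongrightarrow> (w::complex)"
proof -
  have "(\<lambda>n. of_real (rho n) * w) \<longlonglongrightarrow> of_real 1 * w" by (intro tendsto_intros rho_tendsto)
  then show ?thesis by simp
qed

lemma nontangential_limit_radial: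
  assumes "has_nontangential_limit f w L" and w: "norm w = 1"
  shows "(\<lambda>n. f (of_real (rho n) * w)) \<longlonglongrightarrow> L"
proof -
  have "(f \<longlongrightarrow> L) (at w within stolz_region 2 w)"
    using assms(1) by (simp add: has_nontangential_limit_def)
  moreover have "filterlim (\<lambda>n. of_real (rho n) * w) (at w within stolz_region 2 w) sequentially"
    unfolding filterlim_at using tendsto_rho_mult stolz_region_radial[OF w, of 2] w rho
    by (auto simp: less_le)
  ultimately show ?thesis by (rule filterlim_compose)
qed

text \<open>The radius runs inside the Stolz regions. This also yields the uniqueness on which the
  \<open>THE\<close> in \<open>boundary_value\<close> rests.\<close>

lemma nontangential_limit_eq_radial_limit:
  assumes "has_nontangential_limit f w L" and w: "norm w = 1"
  shows "L = radial_limit f w"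
  using limI[OF nontangential_limit_radial[OF assms]] by (simp add: radial_limit_def)

text \<open>A Cauchy criterion in which apertures and tolerances range over countable sets, so that
  one null set serves them all.\<close>

lemma nontangential_limitI:
  assumes w: "norm w = 1"
    and osc: "\<And>i k. \<exists>d>0. \<forall>x\<in>stolz_region (real i + 2) w. \<forall>y\<in>stolz_region (real i + 2) w.
      dist x w < d \<longrightarrow> dist y w < d \<longrightarrow> dist (g x) (g y) \<le> 1 / (real k + 1)"
  shows "has_nontangential_limit g w (radial_limit g w)"
proof -
  have osc': "\<exists>d>0. \<forall>x\<in>stolz_region (real i + 2) w. \<forall>y\<in>stolz_region (real i + 2) w.
      dist x w < d \<longrightarrow> dist y w < d \<longrightarrow> dist (g x) (g y) < e" if e: "e > 0" for i e
  proof -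
    from reals_Archimedean[OF e] obtain k where "inverse (real (Suc k)) < e" by blast
    then have "1 / (real k + 1) < e" by (simp add: inverse_eq_divide add.commute)
    then show ?thesis using osc[of i k] by (meson le_less_trans)
  qed
  have ev: "eventually (\<lambda>n. dist (of_real (rho n) * w) w < d) sequentially" if "d > 0" for d
    using tendsto_rho_mult that by (rule tendstoD)
  have rad: "of_real (rho n) * w \<in> stolz_region (real i + 2) w" for n i
    using w by (intro stolz_region_radial) auto
  have "Cauchy (\<lambda>n. g (of_real (rho n) * w))"
  proof (rule metric_CauchyI)
    fix e :: real assume "e > 0"
    from osc'[OF this, of 0] obtain d where d: "d > 0" "\<And>x y. x \<in> stolz_region (real 0 + 2) w \<Longrightarrow> y \<in> stolz_region (real 0 + 2) w
      \<Longrightarrow> dist x w < d \<Longrightarrow> dist y w < d \<Longrightarrow> dist (g x) (g y) < e" by blast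
    from ev[OF d(1)] obtain N where "\<And>n. n \<ge> N \<Longrightarrow> dist (of_real (rho n) * w) w < d"
      by (auto simp: eventually_sequentially)
    then show "\<exists>M. \<forall>m\<ge>M. \<forall>n\<ge>M. dist (g (of_real (rho m) * w)) (g (of_real (rho n) * w)) < e"
      using d(2) rad by blast
  qed
  then have lim: "(\<lambda>n. g (of_real (rho n) * w)) \<longlonglongrightarrow> radial_limit g w"
    unfolding radial_limit_def by (simp add: Cauchy_convergent convergent_LIMSEQ_iff[symmetric])
  show ?thesis
    unfolding has_nontangential_limit_def
  proof (intro allI impI)
    fix \<alpha> :: real assume "\<alpha> > 1"
    obtain i :: nat where i: "\<alpha> \<le> real i + 2" using real_arch_simple[of \<alpha>]
      by (metis add.commute add_increasing zero_le_numeral)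
    have "(g \<longlongrightarrow> radial_limit g w) (at w within stolz_region (real i + 2) w)"
    proof (rule tendstoI)
      fix e :: real assume e: "e > 0"
      from osc'[of "e/2" i] e obtain d where d: "d > 0" "\<And>x y. x \<in> stolz_region (real i + 2) w \<Longrightarrow> y \<in> stolz_region (real i + 2) w
        \<Longrightarrow> dist x w < d \<Longrightarrow> dist y w < d \<Longrightarrow> dist (g x) (g y) < e/2" by (meson half_gt_zero)
      have "dist (g x) (radial_limit g w) < e" if x: "x \<in> stolz_region (real i + 2) w" "dist x w < d" for x
      proof -
        have "eventually (\<lambda>n. dist (g x) (g (of_real (rho n) * w)) \<le> e/2) sequentially"
          using ev[OF d(1)] by eventually_elim (use d(2)[OF x(1) rad x(2)] in \<open>auto intro: less_imp_le\<close>)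
        moreover have "(\<lambda>n. dist (g x) (g (of_real (rho n) * w))) \<longlonglongrightarrow> dist (g x) (radial_limit g w)"
          by (intro tendsto_intros lim)
        ultimately have "dist (g x) (radial_limit g w) \<le> e/2"
          by (intro tendsto_upperbound) auto
        then show ?thesis using e by linarith
      qed
      then show "eventually (\<lambda>x. dist (g x) (radial_limit g w) < e) (at w within stolz_region (real i + 2) w)"
        unfolding eventually_at using d(1) by blast
    qed
    then show "(g \<longlongrightarrow> radial_limit g w) (at w within stolz_region \<alpha> w)"
      by (rule tendsto_within_subset) (rule stolz_region_mono[OF i])
  qed
qed

text \<open>Fatou's theorem. The difference between \<open>g\<close> and a dilation is small in L^2
  and hence, by the weak type estimate, uniformly small in the Stolz regions at all points off a set
  of small measure; the dilation itself is continuous on the closed disc. Points that are bad for a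
  whole sequence of dilations form a null set.\<close>

lemma bounded_nontangential_limit:
  fixes g :: "complex \<Rightarrow> complex"
  assumes g: "g holomorphic_on ball 0 1" and b: "\<And>z. norm z < 1 \<Longrightarrow> norm (g z) \<le> 1"
  shows "AE w in circ. has_nontangential_limit g w (radial_limit g w)"
proof -
  have "AE w in circ. \<exists>d>0. \<forall>x\<in>stolz_region (real i + 2) w. \<forall>y\<in>stolz_region (real i + 2) w.
      dist x w < d \<longrightarrow> dist y w < d \<longrightarrow> dist (g x) (g y) \<le> 1 / (real k + 1)" for i k
  proof -
    define \<alpha> where "\<alpha> = real i + 2"
    \<comment> \<open>Three times \<open>l\<close> is lost: each of two points loses
      \<open>l\<close> in passing to the dilation and l / 2 in the comparison with the
      vertex.\<close>
    define l where "l = 1 / (3 * (real k + 1))"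
    have a: "\<alpha> > 0" and l: "l > 0" by (auto simp: \<alpha>_def l_def)
    define c where "c = 160 * (1+\<alpha>)\<^sup>2 / l\<^sup>2"
    have c: "c > 0" using a l by (auto simp: c_def)
    have "\<exists>s. 0 \<le> s \<and> s < 1 \<and> emeasure circ (stolz_large \<alpha> l (\<lambda>z. g z - g (of_real s * z))) \<le> ennreal (1 / (real j + 1))" for j
    proof -
      define e where "e = 1 / (c * (real j + 1))"
      have "e > 0" using c by (auto simp: e_def)
      from dilations_L2_Cauchy[OF g b this] obtain R where R: "0 \<le> R" "R < 1"
        and L2: "\<And>a b. R \<le> a \<Longrightarrow> a < 1 \<Longrightarrow> R \<le> b \<Longrightarrow> b < 1 \<Longrightarrow>
          (LINT w|circ. norm (g (of_real a * w) - g (of_real b * w)) powr 2) \<le> e" by blast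
      \<comment> \<open>Strictly above \<open>R\<close>, so that \<open>rho n * s\<close> exceeds
        \<open>R\<close> eventually as well.\<close>
      define s where "s = (R + 1) / 2"
      have s: "0 \<le> s" "s < 1" "R < s" using R by (auto simp: s_def)
      have "(\<lambda>n. rho n * s) \<longlonglongrightarrow> 1 * s" by (intro tendsto_intros rho_tendsto)
      then have "eventually (\<lambda>n. R < rho n * s) sequentially" using s(3) by (intro order_tendstoD(1)) auto
      moreover have "eventually (\<lambda>n. R < rho n) sequentially" using R by (intro order_tendstoD(1)[OF rho_tendsto])
      ultimately have "eventually (\<lambda>n. R < rho n * s \<and> R < rho n) sequentially" by eventually_elim simp
      then obtain N where N: "\<And>n. N \<le> n \<Longrightarrow> R < rho n * s \<and> R < rho n"
        by (auto simp: eventually_sequentially)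
      have sb: "rho n * s < 1" for n using mult_strict_mono[of "rho n" 1 s 1] rho[of n] s by simp
      have "emeasure circ (stolz_large \<alpha> l (\<lambda>z. g z - g (of_real s * z))) \<le> ennreal (160 * (1+\<alpha>)\<^sup>2 / l\<^sup>2 * e)"
      proof (rule stolz_weak_type_limit[OF _ a l])
        show "(\<lambda>z. g z - g (of_real s * z)) holomorphic_on ball 0 1"
          by (intro holomorphic_intros g continuous_on_dilation(2)[OF g s(1,2)])
        fix n assume n: "N \<le> n"
        have "(LINT w|circ. norm (g (of_real (rho n) * w) - g (of_real (rho n * s) * w)) powr 2) \<le> e"
          using N[OF n] rho[of n] sb[of n] by (intro L2) auto
        then show "(LINT w|circ. norm (g (of_real (rho n) * w) - g (of_real s * (of_real (rho n) * w))) powr 2) \<le> e"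
          by (simp add: mult_ac)
      qed
      also have "160 * (1+\<alpha>)\<^sup>2 / l\<^sup>2 * e = 1 / (real j + 1)"
        unfolding c_def[symmetric] using c by (simp add: e_def)
      finally show ?thesis using s by blast
    qed
    then obtain s where s: "\<And>j. 0 \<le> s j" "\<And>j. s j < 1"
      and sm: "\<And>j. emeasure circ (stolz_large \<alpha> l (\<lambda>z. g z - g (of_real (s j) * z))) \<le> ennreal (1 / (real j + 1))"
      by metis
    define Bad where "Bad = (\<Inter>j. stolz_large \<alpha> l (\<lambda>z. g z - g (of_real (s j) * z)))"
    have [measurable]: "Bad \<in> sets circ" unfolding Bad_def by measurable
    have "emeasure circ Bad \<le> ennreal (1 / (real j + 1))" for j
      by (rule order_trans[OF emeasure_mono sm]) (auto simp: Bad_def)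
    moreover have "(\<lambda>j. ennreal (1 / (real j + 1))) \<longlonglongrightarrow> ennreal 0"
      by (intro tendsto_ennrealI) real_asymp
    ultimately have "emeasure circ Bad \<le> ennreal 0"
      by (intro LIMSEQ_le_const) auto
    then have "Bad \<in> null_sets circ" by (auto simp: null_sets_def)
    then have "AE w in circ. w \<notin> Bad" by (rule AE_not_in)
    then show ?thesis
    proof (rule AE_mp, intro AE_I2 impI)
      fix w assume "w \<in> space circ" "w \<notin> Bad"
      then obtain j where w: "norm w = 1" and j: "w \<notin> stolz_large \<alpha> l (\<lambda>z. g z - g (of_real (s j) * z))"
        by (auto simp: Bad_def)
      have near: "dist (g z) (g (of_real (s j) * z)) \<le> l" if "z \<in> stolz_region \<alpha> w" for z
        using j w that by (force simp: stolz_large_def dist_norm not_less)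
      have "continuous_on (cball 0 1) (\<lambda>z. g (of_real (s j) * z))"
        by (rule continuous_on_dilation(1)[OF g s])
      then obtain d where d: "d > 0" "\<And>z. z \<in> cball 0 1 \<Longrightarrow> dist z w < d \<Longrightarrow> dist (g (of_real (s j) * z)) (g (of_real (s j) * w)) < l / 2"
        unfolding continuous_on_iff using w l by (metis half_gt_zero mem_cball_0 order_refl)
      have "dist (g x) (g y) \<le> 1 / (real k + 1)"
        if x: "x \<in> stolz_region \<alpha> w" "dist x w < d" and y: "y \<in> stolz_region \<alpha> w" "dist y w < d" for x y
      proof -
        let ?k = "\<lambda>z. g (of_real (s j) * z)"
        have "dist (?k x) (?k w) < l/2" "dist (?k y) (?k w) < l/2"
          using d(2)[OF _ x(2)] d(2)[OF _ y(2)] x(1) y(1) by (simp_all add: stolz_region_def)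
        moreover have "dist (g x) (g y) \<le> dist (g x) (?k x) + dist (?k x) (?k w) + dist (?k y) (?k w) + dist (g y) (?k y)"
          using dist_triangle[of "g x" "g y" "?k x"] dist_triangle[of "?k x" "g y" "?k w"] dist_triangle[of "?k w" "g y" "?k y"]
          by (simp add: dist_commute)
        moreover have "3 * l = 1 / (real k + 1)" by (simp add: l_def field_simps)
        ultimately show ?thesis using near[OF x(1)] near[OF y(1)] by linarith
      qed
      then show "\<exists>d>0. \<forall>x\<in>stolz_region (real i + 2) w. \<forall>y\<in>stolz_region (real i + 2) w.
        dist x w < d \<longrightarrow> dist y w < d \<longrightarrow> dist (g x) (g y) \<le> 1 / (real k + 1)"
        using d(1) unfolding \<alpha>_def by blast
    qed
  qed
  then have "AE w in circ. \<forall>i k. \<exists>d>0. \<forall>x\<in>stolz_region (real i + 2) w. \<forall>y\<in>stolz_region (real i + 2) w.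
      dist x w < d \<longrightarrow> dist y w < d \<longrightarrow> dist (g x) (g y) \<le> 1 / (real k + 1)"
    by (simp add: AE_all_countable)
  then show ?thesis
    by (rule AE_mp) (intro AE_I2 impI nontangential_limitI; simp)
qed

section \<open>Boundary zeros and the quotient of bounded functions\<close>

lemma borel_measurable_radial_limit:
  assumes "f holomorphic_on ball 0 1"
  shows "radial_limit f \<in> borel_measurable circ"
  unfolding radial_limit_def
  by (intro borel_measurable_lim_metric borel_measurable_circ_continuous continuous_on_dilation(3)[OF assms rho(3) rho(2)])

text \<open>Jensen's inequality without logarithms: |h(0)|^e is at most the mean of the e-th power
  of the boundary function. As e tends to 0 the left side tends to 1 and the right side to the
  measure of the set where the boundary function is nonzero.\<close>

lemma AE_nonzero_radial_limit:
  fixes h :: "complex \<Rightarrow> complex"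
  assumes h: "h holomorphic_on ball 0 1" and b: "\<And>z. norm z < 1 \<Longrightarrow> norm (h z) \<le> 1" and h0: "h 0 \<noteq> 0"
  shows "AE w in circ. radial_limit h w \<noteq> 0"
proof -
  note [measurable] = borel_measurable_radial_limit[OF h]
  have hc: "continuous_on (sphere 0 1) (\<lambda>w. h (of_real (rho n) * w))" for n
    by (rule continuous_on_dilation(3)[OF h rho(3) rho(2)])
  have hm[measurable]: "(\<lambda>w. h (of_real (rho n) * w)) \<in> borel_measurable circ" for n
    by (rule borel_measurable_circ_continuous[OF hc])
  have hb: "norm (h (of_real (rho n) * w)) \<le> 1" if "w \<in> space circ" for n w
    using that rho[of n] by (intro b) (simp add: norm_mult)
  have lim: "AE w in circ. (\<lambda>n. h (of_real (rho n) * w)) \<longlonglongrightarrow> radial_limit h w"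
    using bounded_nontangential_limit[OF h b]
    by (rule AE_mp) (auto intro!: AE_I2 nontangential_limit_radial)
  have lb: "AE w in circ. norm (radial_limit h w) \<le> 1"
    using lim by (rule AE_mp) (intro AE_I2 impI Lim_norm_ubound[OF _ _ always_eventually]; use hb in auto)
  define e where "e m = 1 / (real m + 1)" for m
  have e0: "e m > 0" for m by (simp add: e_def)
  have elim: "e \<longlonglongrightarrow> 0" unfolding e_def by real_asymp
  have step: "norm (h 0) powr e m \<le> (LINT w|circ. norm (radial_limit h w) powr e m)" for m
  proof -
    have "(\<lambda>n. LINT w|circ. norm (h (of_real (rho n) * w)) powr e m) \<longlonglongrightarrow> (LINT w|circ. norm (radial_limit h w) powr e m)"
    proof (rule integral_dominated_convergence[where w = "\<lambda>_. 1"])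
      show "AE w in circ. (\<lambda>n. norm (h (of_real (rho n) * w)) powr e m) \<longlonglongrightarrow> norm (radial_limit h w) powr e m"
        using lim by (rule AE_mp) (intro AE_I2 impI tendsto_powr2 tendsto_norm tendsto_const always_eventually; use e0[of m] in auto)
      show "AE w in circ. norm (norm (h (of_real (rho n) * w)) powr e m) \<le> 1" for n
        using hb[of _ n] e0[of m] by (intro AE_I2) (auto intro!: powr_le1)
    qed auto
    moreover have "norm (h 0) powr e m \<le> (LINT w|circ. norm (h (of_real (rho n) * w)) powr e m)" for n
    proof -
      have "norm (h (of_real (rho n) * 0)) powr e m \<le> (LINT w|circ. poisson 0 w * norm (h (of_real (rho n) * w)) powr e m)"
        using continuous_on_dilation[OF h rho(3) rho(2)] e0 by (intro norm_powr_le_poisson) auto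
      also have "\<dots> = (LINT w|circ. norm (h (of_real (rho n) * w)) powr e m)"
        by (intro Bochner_Integration.integral_cong refl) (simp add: poisson_def)
      finally show ?thesis by simp
    qed
    ultimately show ?thesis by (intro LIMSEQ_le_const) auto
  qed
  have "(\<lambda>m. LINT w|circ. norm (radial_limit h w) powr e m) \<longlonglongrightarrow> (LINT w|circ. indicator {w. radial_limit h w \<noteq> 0} w)"
  proof (rule integral_dominated_convergence[where w = "\<lambda>_. 1"])
    show "AE w in circ. (\<lambda>m. norm (radial_limit h w) powr e m) \<longlonglongrightarrow> indicator {w. radial_limit h w \<noteq> 0} w"
    proof (rule AE_I2)
      fix w
      show "(\<lambda>m. norm (radial_limit h w) powr e m) \<longlonglongrightarrow> indicator {w. radial_limit h w \<noteq> 0} w"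
      \<comment> \<open>At a zero all powers are 0, by the convention for \<open>powr\<close>;
        elsewhere they tend to 1.\<close>
      proof (cases "radial_limit h w = 0")
        case False
        then have "(\<lambda>m. norm (radial_limit h w) powr e m) \<longlonglongrightarrow> norm (radial_limit h w) powr 0"
          by (intro tendsto_powr elim tendsto_const) auto
        then show ?thesis using False by simp
      qed simp
    qed
    show "AE w in circ. norm (norm (radial_limit h w) powr e m) \<le> 1" for m
      using lb by (rule AE_mp) (use e0[of m] in \<open>auto intro!: AE_I2 powr_le1\<close>)
  qed auto
  moreover have h0lim: "(\<lambda>m. norm (h 0) powr e m) \<longlonglongrightarrow> norm (h 0) powr 0"
    using h0 by (intro tendsto_powr elim tendsto_const) auto
  ultimately have "norm (h 0) powr 0 \<le> (LINT w|circ. indicator {w. radial_limit h w \<noteq> 0} w)"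
    using step by (intro LIMSEQ_le[OF h0lim]) auto
  moreover have "norm (h 0) powr 0 = 1" using h0 by simp
  ultimately have ge: "1 \<le> (LINT w|circ. indicator {w. radial_limit h w \<noteq> 0} w :: real)" by (simp only:)
  let ?I = "\<lambda>w. indicator {w. radial_limit h w \<noteq> 0} w :: real"
  have int: "integrable circ ?I"
    by (rule circ.integrable_const_bound[where B = 1]) auto
  have "(LINT w|circ. 1 - ?I w) = 1 - (LINT w|circ. ?I w)"
    using int emeasure_circ_UNIV by (simp add: measure_def)
  then have "(LINT w|circ. 1 - ?I w) \<le> 0" using ge by simp
  moreover have "0 \<le> (LINT w|circ. 1 - ?I w)" by (intro integral_nonneg_AE) (auto simp: indicator_def)
  ultimately have "(LINT w|circ. 1 - ?I w) = 0" by linarith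
  then have "AE w in circ. 1 - ?I w = 0"
    using int by (subst (asm) integral_nonneg_eq_0_iff_AE) (auto simp: indicator_def)
  then show ?thesis by (rule AE_mp) (auto simp: indicator_def)
qed

text \<open>On the circle Re q_n lies between ln^+ |F_n| and ln^+ |F_n| + 2, so exp (-q_n) and F_n
  exp (-q_n) are bounded by 1. Since ln^+ x <= x, the means of order 1 bound Re q_n(0) from above;
  this keeps the limit given by Montel's theorem from vanishing at 0.\<close>

lemma bounded_factorization:
  fixes f :: "complex \<Rightarrow> complex"
  assumes f: "f holomorphic_on ball 0 1"
    and B: "\<And>n. (LINT w|circ. norm (f (of_real (rho n) * w))) \<le> B"
  obtains g h where "g holomorphic_on ball 0 1" "h holomorphic_on ball 0 1" "h 0 \<noteq> 0"
    "\<And>z. norm z < 1 \<Longrightarrow> norm (g z) \<le> 1" "\<And>z. norm z < 1 \<Longrightarrow> norm (h z) \<le> 1"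
    "\<And>z. g z = f z * h z"
proof -
  define F where "F n w = f (of_real (rho n) * w)" for n w
  note Fc = continuous_on_dilation[OF f rho(3) rho(2), folded F_def]
  have "\<exists>q :: complex poly. \<forall>w. norm w = 1 \<longrightarrow> \<bar>(ln (max 1 (norm (F n w))) + 1) - Re (poly q w)\<bar> < 1" for n
  proof -
    have "continuous_on (sphere 0 1) (\<lambda>w. ln (max 1 (norm (F n w))) + 1)"
      by (intro continuous_intros Fc) (auto simp: max_def)
    from circle_approximation[OF this, of 1] show ?thesis by (metis zero_less_one)
  qed
  then obtain q :: "nat \<Rightarrow> complex poly"
    where q: "\<And>n w. norm w = 1 \<Longrightarrow> \<bar>(ln (max 1 (norm (F n w))) + 1) - Re (poly (q n) w)\<bar> < 1"
    by metis
  define H where "H n z = exp (- poly (q n) z)" for n z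
  have Hh: "H n holomorphic_on A" for n A
    unfolding H_def by (intro holomorphic_intros)
  have Hc: "continuous_on A (H n)" for n A
    unfolding H_def by (intro continuous_intros)
  have Hb: "norm (H n z) \<le> 1" if "norm z \<le> 1" for n z
  proof (rule maximum_modulus_disc[of "H n"])
    fix w :: complex assume w: "norm w = 1"
    have "0 \<le> ln (max 1 (norm (F n w)))" by (simp add: max_def)
    then have "0 \<le> Re (poly (q n) w)" using q[OF w, of n] by linarith
    then show "norm (H n w) \<le> 1" by (simp add: H_def)
  qed (use that Hh Hc in auto)
  have FHb: "norm (F n z * H n z) \<le> 1" if "norm z \<le> 1" for n z
  proof (rule maximum_modulus_disc[where F = "\<lambda>z. F n z * H n z"])
    fix w :: complex assume w: "norm w = 1"
    have "ln (max 1 (norm (F n w))) \<le> Re (poly (q n) w)" using q[OF w, of n] by linarith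
    then have "exp (ln (max 1 (norm (F n w)))) \<le> exp (Re (poly (q n) w))"
      by (simp only: exp_le_cancel_iff)
    then have "max 1 (norm (F n w)) \<le> exp (Re (poly (q n) w))"
      by (simp add: less_max_iff_disj)
    then have "norm (F n w) * exp (- Re (poly (q n) w)) \<le> exp (Re (poly (q n) w)) * exp (- Re (poly (q n) w))"
      by (intro mult_right_mono) auto
    then show "norm (F n w * H n w) \<le> 1" by (simp add: H_def norm_mult exp_minus_inverse)
  qed (use that Hh Hc Fc in \<open>auto intro!: continuous_intros holomorphic_intros \<close>)
  \<comment> \<open>The mean value property at 0 turns the bound on ln^+ into a lower bound for |exp
    (-q_n(0))|.\<close>
  have H0: "exp (- (B + 2)) \<le> norm (H n 0)" for n
  proof -
    have "Re (poly (q n) 0) = Re (LINT w|circ. poisson 0 w *\<^sub>R poly (q n) w)"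
      by (subst poisson_integral_formula) (auto intro!: continuous_intros holomorphic_intros)
    also have "\<dots> = (LINT w|circ. Re (poisson 0 w *\<^sub>R poly (q n) w))"
      by (intro integral_Re[symmetric] integrable_circ_continuous continuous_intros continuous_on_poisson) auto
    also have "\<dots> = (LINT w|circ. Re (poly (q n) w))"
      by (intro Bochner_Integration.integral_cong refl) (simp add: poisson_def)
    also have "\<dots> \<le> (LINT w|circ. norm (F n w) + 2)"
    proof (intro integral_mono integrable_circ_continuous continuous_intros Fc)
      fix w assume "w \<in> space circ"
      then have w: "norm w = 1" by simp
      have "ln (max 1 (norm (F n w))) \<le> norm (F n w)"
        using ln_le_minus_one[of "max 1 (norm (F n w))"] norm_ge_zero[of "F n w"] by linarith
      then show "Re (poly (q n) w) \<le> norm (F n w) + 2" using q[OF w, of n] by linarith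
    qed
    also have "\<dots> = (LINT w|circ. norm (F n w)) + 2"
      using integrable_circ_continuous[OF continuous_on_norm[OF Fc(3)[of n]]] emeasure_circ_UNIV by (simp add: measure_def)
    also have "\<dots> \<le> B + 2" using B[of n] by (simp add: F_def)
    finally show ?thesis by (simp add: H_def)
  qed
  obtain h r where h: "h holomorphic_on ball 0 1" and r: "strict_mono (r :: nat \<Rightarrow> nat)"
    and lim: "\<And>x. x \<in> ball 0 1 \<Longrightarrow> (\<lambda>n. H (r n) x) \<longlonglongrightarrow> h x"
  proof (rule Montel[where S = "ball 0 1" and \<H> = "range H" and \<F> = H])
    show "\<exists>B. \<forall>h\<in>range H. \<forall>z\<in>K. norm (h z) \<le> B" if "compact K" "K \<subseteq> ball 0 1" for K
      by (rule exI[of _ 1]) (use that(2) in \<open>auto intro!: Hb\<close>)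
  qed (use Hh in auto)
  show ?thesis
  proof (rule that[of "\<lambda>z. f z * h z" h])
    show "(\<lambda>z. f z * h z) holomorphic_on ball 0 1" by (intro holomorphic_intros f h)
    show "h holomorphic_on ball 0 1" by (rule h)
    have "exp (- (B + 2)) \<le> norm (h 0)"
      using lim[of 0] by (intro LIMSEQ_le_const[OF tendsto_norm]) (use H0 in auto)
    then show "h 0 \<noteq> 0" using exp_gt_zero[of "-(B+2)"] by (auto simp del: exp_gt_zero)
    fix z :: complex assume z: "norm z < 1"
    show "norm (h z) \<le> 1"
      using lim[of z] z by (intro LIMSEQ_le_const2[OF tendsto_norm]) (use Hb[of z] in auto)
    have "isCont f z"
      using holomorphic_on_imp_continuous_on[OF f] z by (simp add: continuous_on_eq_continuous_at)
    then have "(\<lambda>n. F (r n) z) \<longlonglongrightarrow> f z"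
      unfolding F_def by (rule isCont_tendsto_compose) (rule LIMSEQ_subseq_LIMSEQ[OF tendsto_rho_mult r, unfolded o_def])
    then have "(\<lambda>n. F (r n) z * H (r n) z) \<longlonglongrightarrow> f z * h z"
      using lim[of z] z by (intro tendsto_mult) auto
    then show "norm (f z * h z) \<le> 1"
      using z by (intro LIMSEQ_le_const2[OF tendsto_norm]) (use FHb[of z] in auto)
  qed auto
qed

text \<open>The quotient of the limits of \<open>g\<close> and \<open>h\<close>. Zeros of
  \<open>h\<close> in the disc do no harm: almost everywhere the limit of \<open>h\<close> is
  nonzero, and so is \<open>h\<close> near the vertex of each Stolz region.\<close>

theorem hardy_nontangential_limit:
  fixes f :: "complex \<Rightarrow> complex"
  assumes f: "f holomorphic_on ball 0 1"
    and B: "\<And>n. (LINT w|circ. norm (f (of_real (rho n) * w))) \<le> B"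
  shows "AE w in circ. has_nontangential_limit f w (radial_limit f w)"
proof -
  obtain g h where g: "g holomorphic_on ball 0 1" and h: "h holomorphic_on ball 0 1" "h 0 \<noteq> 0"
    and gb: "\<And>z. norm z < 1 \<Longrightarrow> norm (g z) \<le> 1" and hb: "\<And>z. norm z < 1 \<Longrightarrow> norm (h z) \<le> 1"
    and gf: "\<And>z. g z = f z * h z"
    using bounded_factorization[OF f B] by metis
  have "AE w in circ. has_nontangential_limit g w (radial_limit g w) \<and>
      has_nontangential_limit h w (radial_limit h w) \<and> radial_limit h w \<noteq> 0"
    using bounded_nontangential_limit[OF g gb] bounded_nontangential_limit[OF h(1) hb] AE_nonzero_radial_limit[OF h(1) hb h(2)]
    by auto
  then show ?thesis
  proof (rule AE_mp, intro AE_I2 impI)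
    fix w assume "w \<in> space circ" and lim: "has_nontangential_limit g w (radial_limit g w) \<and>
      has_nontangential_limit h w (radial_limit h w) \<and> radial_limit h w \<noteq> 0"
    then have w: "norm w = 1" by simp
    let ?L = "radial_limit g w / radial_limit h w"
    have L: "has_nontangential_limit f w ?L"
      unfolding has_nontangential_limit_def
    proof (intro allI impI)
      fix \<alpha> :: real assume a: "\<alpha> > 1"
      let ?F = "at w within stolz_region \<alpha> w"
      have gl: "(g \<longlongrightarrow> radial_limit g w) ?F" and hl: "(h \<longlongrightarrow> radial_limit h w) ?F"
        using lim a by (auto simp: has_nontangential_limit_def)
      then have "((\<lambda>z. g z / h z) \<longlongrightarrow> ?L) ?F"
        using lim by (intro tendsto_divide) auto
      moreover have "eventually (\<lambda>z. h z \<noteq> 0) ?F"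
        using hl lim by (intro tendsto_imp_eventually_ne) auto
      then have "eventually (\<lambda>z. g z / h z = f z) ?F"
        by eventually_elim (simp add: gf)
      ultimately show "(f \<longlongrightarrow> ?L) ?F" by (rule Lim_transform_eventually)
    qed
    with nontangential_limit_eq_radial_limit[OF L w]
    show "has_nontangential_limit f w (radial_limit f w)" by simp
  qed
qed

subsection \<open>Convergence of dilations in the Hardy space\<close>

lemma dilation_integrable:
  fixes f :: "complex \<Rightarrow> complex"
  assumes f: "f holomorphic_on ball 0 1"
  shows "continuous_on (sphere 0 1) (\<lambda>w. f (of_real (rho n) * w))"
    "(\<lambda>w. f (of_real (rho n) * w)) \<in> borel_measurable circ"
    "integrable circ (\<lambda>w. f (of_real (rho n) * w))"
proof -
  show c: "continuous_on (sphere 0 1) (\<lambda>w. f (of_real (rho n) * w))"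
    by (rule continuous_on_dilation(3)[OF f rho(3) rho(2)])
  show "(\<lambda>w. f (of_real (rho n) * w)) \<in> borel_measurable circ"
    by (rule borel_measurable_circ_continuous[OF c])
  show "integrable circ (\<lambda>w. f (of_real (rho n) * w))"
    by (rule integrable_circ_continuous[OF c])
qed

text \<open>Means of order 1 along \<open>rho\<close> are the common ground of all exponents p >=
  1.\<close>

locale hardy1 =
  fixes f :: "complex \<Rightarrow> complex" and B :: real
  assumes f: "f holomorphic_on ball 0 1"
    and B: "\<And>n. (LINT w|circ. norm (f (of_real (rho n) * w))) \<le> B"
begin

abbreviation "b \<equiv> radial_limit f"
abbreviation "F n w \<equiv> f (of_real (rho n) * w)"

lemma b_measurable [measurable]: "b \<in> borel_measurable circ"
  by (rule borel_measurable_radial_limit[OF f])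

lemma F_measurable [measurable]: "F n \<in> borel_measurable circ"
  by (rule dilation_integrable(2)[OF f])

lemma F_lim: "AE w in circ. (\<lambda>n. F n w) \<longlonglongrightarrow> b w"
  using hardy_nontangential_limit[OF f B]
  by (rule AE_mp) (auto intro!: AE_I2 nontangential_limit_radial)

lemma f_lim: "norm z < 1 \<Longrightarrow> (\<lambda>n. F n z) \<longlonglongrightarrow> f z"
proof -
  assume "norm z < 1"
  then have "isCont f z"
    using holomorphic_on_imp_continuous_on[OF f] by (simp add: continuous_on_eq_continuous_at)
  then show ?thesis by (rule isCont_tendsto_compose) (rule tendsto_rho_mult)
qed

lemma B_nn: "(\<integral>\<^sup>+w. ennreal (norm (F n w)) \<partial>circ) \<le> ennreal B"
  using B[of n] dilation_integrable(3)[OF f, of n]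
  by (subst nn_integral_eq_integral) (auto intro: ennreal_leI)

text \<open>Fatou's lemma along the dilations.\<close>

lemma b_integrable: "integrable circ b"
proof (rule integrableI_bounded)
  have "(\<integral>\<^sup>+w. ennreal (norm (b w)) \<partial>circ) = (\<integral>\<^sup>+w. liminf (\<lambda>n. ennreal (norm (F n w))) \<partial>circ)"
  proof (rule nn_integral_cong_AE)
    show "AE w in circ. ennreal (norm (b w)) = liminf (\<lambda>n. ennreal (norm (F n w)))"
      using F_lim
    proof (rule AE_mp, intro AE_I2 impI)
      fix w assume "(\<lambda>n. F n w) \<longlonglongrightarrow> b w"
      then have "(\<lambda>n. ennreal (norm (F n w))) \<longlonglongrightarrow> ennreal (norm (b w))"
        by (intro tendsto_ennrealI tendsto_norm)
      then show "ennreal (norm (b w)) = liminf (\<lambda>n. ennreal (norm (F n w)))"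
        by (intro lim_imp_Liminf[symmetric]) auto
    qed
  qed
  also have "\<dots> \<le> liminf (\<lambda>n. \<integral>\<^sup>+w. ennreal (norm (F n w)) \<partial>circ)"
    by (intro nn_integral_liminf) measurable
  also have "\<dots> \<le> liminf (\<lambda>n. ennreal B)"
    by (intro Liminf_mono always_eventually allI B_nn)
  also have "\<dots> = ennreal B" by (rule Liminf_const) simp
  finally show "(\<integral>\<^sup>+w. ennreal (norm (b w)) \<partial>circ) < \<infinity>"
    using ennreal_less_top le_less_trans by (metis infinity_ennreal_def)
qed measurable

lemma poisson_measurable: "norm z < 1 \<Longrightarrow> poisson z \<in> borel_measurable circ"
  by (intro borel_measurable_circ_continuous continuous_on_poisson)

lemma poisson_bounded:
  assumes "norm z < 1"
  obtains P where "\<And>w. norm w = 1 \<Longrightarrow> poisson z w \<le> P" "P > 0"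
proof -
  have "bounded (poisson z ` sphere 0 1)"
    using assms by (intro compact_imp_bounded compact_continuous_image continuous_on_poisson) auto
  then obtain P where P: "\<forall>w\<in>sphere 0 1. norm (poisson z w) \<le> P" by (auto simp: bounded_iff)
  show ?thesis
    by (rule that[of "max P 1"]) (use P in force)+
qed

lemma integrable_poisson_sqrt:
  assumes z: "norm z < 1"
  shows "integrable circ (\<lambda>w. poisson z w * sqrt (norm (b w)))"
proof -
  have "integrable circ (\<lambda>w. sqrt (norm (b w)))"
  proof (rule Bochner_Integration.integrable_bound)
    show "integrable circ (\<lambda>w. 1 + norm (b w))" using b_integrable by simp
    show "AE w in circ. norm (sqrt (norm (b w))) \<le> norm (1 + norm (b w))"
    proof (rule AE_I2)
      fix w
      show "norm (sqrt (norm (b w))) \<le> norm (1 + norm (b w))"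
        using sqrt_le_D[of "norm (b w)" "1 + norm (b w)"] real_sqrt_ge_0_iff[of "norm (b w)"]
        by (simp add: real_le_lsqrt power2_eq_square algebra_simps)
    qed
  qed measurable
  from integrable_poisson_mult[OF z this] show ?thesis by simp
qed

text \<open>The square roots \<open>sqrt \<bar>f\<^sub>n\<bar>\<close> are bounded in \<open>L\<^sup>2\<close>, hence uniformly integrable: truncating at height \<open>K\<close>
  costs at most \<open>\<bar>f\<^sub>n\<bar> / K\<close>.\<close>

lemma sqrt_norm_le_poisson:
  assumes z: "norm z < 1"
  shows "sqrt (norm (f z)) \<le> (LINT w|circ. poisson z w * sqrt (norm (b w)))"
proof -
  note [measurable] = poisson_measurable[OF z]
  obtain P where P: "\<And>w. norm w = 1 \<Longrightarrow> poisson z w \<le> P" "P > 0" using poisson_bounded[OF z] by blast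
  have le: "sqrt (norm (f z)) \<le> (LINT w|circ. poisson z w * sqrt (norm (b w))) + P * B / K" if K: "K > 0" for K
  proof -
    have ip: "integrable circ (poisson z)" by (intro integrable_circ_continuous continuous_on_poisson z)
    have int1: "integrable circ (\<lambda>w. poisson z w * min (sqrt (norm (F n w))) K)" for n
      by (intro integrable_circ_continuous continuous_intros continuous_on_poisson z dilation_integrable(1)[OF f])
    have int2: "integrable circ (\<lambda>w. poisson z w * min (sqrt (norm (b w))) K)"
      by (rule Bochner_Integration.integrable_bound[OF integrable_poisson_sqrt[OF z]])
        (use K in \<open>auto intro!: AE_I2 mult_left_mono simp: abs_mult\<close>)
    have "(\<lambda>n. LINT w|circ. poisson z w * min (sqrt (norm (F n w))) K) \<longlonglongrightarrow> (LINT w|circ. poisson z w * min (sqrt (norm (b w))) K)"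
    proof (rule integral_dominated_convergence[where w = "\<lambda>w. poisson z w * K"])
      show "AE w in circ. (\<lambda>n. poisson z w * min (sqrt (norm (F n w))) K) \<longlonglongrightarrow> poisson z w * min (sqrt (norm (b w))) K"
        using F_lim by (rule AE_mp) (intro AE_I2 impI tendsto_intros)
      show "AE w in circ. norm (poisson z w * min (sqrt (norm (F n w))) K) \<le> poisson z w * K" for n
        using K poisson_nonneg[OF z] by (intro AE_I2) (auto simp: abs_mult intro!: mult_left_mono)
    qed (use ip in auto)
    then have "(\<lambda>n. (LINT w|circ. poisson z w * min (sqrt (norm (F n w))) K) + P * B / K)
      \<longlonglongrightarrow> (LINT w|circ. poisson z w * min (sqrt (norm (b w))) K) + P * B / K"
      by (intro tendsto_add tendsto_const)
    moreover have "sqrt (norm (F n z)) \<le> (LINT w|circ. poisson z w * min (sqrt (norm (F n w))) K) + P * B / K" for n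
    proof -
      have "norm (F n z) powr (1/2) \<le> (LINT w|circ. poisson z w * norm (F n w) powr (1/2))"
        using continuous_on_dilation[OF f rho(3) rho(2)] z by (intro norm_powr_le_poisson) auto
      then have "sqrt (norm (F n z)) \<le> (LINT w|circ. poisson z w * sqrt (norm (F n w)))"
        by (simp add: powr_half_sqrt)
      also have "\<dots> \<le> (LINT w|circ. poisson z w * min (sqrt (norm (F n w))) K + P / K * norm (F n w))"
      proof (intro integral_mono Bochner_Integration.integrable_add int1)
        show "integrable circ (\<lambda>w. poisson z w * sqrt (norm (F n w)))" "integrable circ (\<lambda>w. P / K * norm (F n w))"
          by (intro integrable_circ_continuous continuous_intros continuous_on_poisson z dilation_integrable(1)[OF f])+
        fix w assume "w \<in> space circ"
        then have w: "norm w = 1" by simp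
        let ?x = "sqrt (norm (F n w))"
        \<comment> \<open>Where x exceeds K, already x <= x^2 / K; the square is |F_n|, whose mean
          is at most \<open>B\<close>.\<close>
        have "?x \<le> min ?x K + ?x\<^sup>2 / K"
        proof (cases "?x \<le> K")
          case False
          then have "?x * K \<le> ?x * ?x" by (intro mult_left_mono) auto
          then have "?x \<le> ?x\<^sup>2 / K" using K by (simp add: field_simps power2_eq_square)
          then show ?thesis using K False by linarith
        qed (use K in simp)
        then have "poisson z w * ?x \<le> poisson z w * (min ?x K + norm (F n w) / K)"
          by (intro mult_left_mono poisson_nonneg z) simp
        also have "\<dots> = poisson z w * min ?x K + poisson z w * (norm (F n w) / K)" by (simp add: distrib_left)
        also have "poisson z w * (norm (F n w) / K) \<le> P * (norm (F n w) / K)"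
          using K by (intro mult_right_mono P w) auto
        finally show "poisson z w * ?x \<le> poisson z w * min ?x K + P / K * norm (F n w)" by simp
      qed
      also have "\<dots> = (LINT w|circ. poisson z w * min (sqrt (norm (F n w))) K) + P / K * (LINT w|circ. norm (F n w))"
        using int1 integrable_norm[OF dilation_integrable(3)[OF f]] by simp
      also have "\<dots> \<le> (LINT w|circ. poisson z w * min (sqrt (norm (F n w))) K) + P / K * B"
        using P(2) K B[of n] by (intro add_left_mono mult_left_mono) auto
      finally show ?thesis by simp
    qed
    ultimately have "sqrt (norm (f z)) \<le> (LINT w|circ. poisson z w * min (sqrt (norm (b w))) K) + P * B / K"
      by (intro LIMSEQ_le[OF tendsto_real_sqrt[OF tendsto_norm[OF f_lim[OF z]]]]) auto
    also have "(LINT w|circ. poisson z w * min (sqrt (norm (b w))) K) \<le> (LINT w|circ. poisson z w * sqrt (norm (b w)))"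
      by (intro integral_mono int2 integrable_poisson_sqrt z mult_left_mono poisson_nonneg) auto
    finally show ?thesis by simp
  qed
  \<comment> \<open>The truncation height K = n + 1 tends to infinity.\<close>
  have "(\<lambda>n. (LINT w|circ. poisson z w * sqrt (norm (b w))) + P * B / (real n + 1)) \<longlonglongrightarrow> (LINT w|circ. poisson z w * sqrt (norm (b w))) + 0"
    by (intro tendsto_add tendsto_const) real_asymp
  then show ?thesis by (intro LIMSEQ_le_const[where X = "\<lambda>n. (LINT w|circ. poisson z w * sqrt (norm (b w))) + P * B / (real n + 1)"]) (use le in auto)
qed

text \<open>The variance of sqrt |b| under the probability measure with Poisson density is
  nonnegative, so the bound for sqrt |f| may be squared.\<close>

lemma norm_le_poisson:
  assumes z: "norm z < 1"
  shows "norm (f z) \<le> (LINT w|circ. poisson z w * norm (b w))"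
proof -
  let ?m = "LINT w|circ. poisson z w * sqrt (norm (b w))"
  have ip: "integrable circ (poisson z)" by (intro integrable_circ_continuous continuous_on_poisson z)
  have ib: "integrable circ (\<lambda>w. poisson z w * norm (b w))"
    using integrable_poisson_mult[OF z integrable_norm[OF b_integrable]] by simp
  have "0 \<le> (LINT w|circ. poisson z w * (sqrt (norm (b w)) - ?m)\<^sup>2)"
    by (intro integral_nonneg_AE) (auto intro!: mult_nonneg_nonneg poisson_nonneg z)
  also have "\<dots> = (LINT w|circ. poisson z w * norm (b w) - 2 * ?m * (poisson z w * sqrt (norm (b w))) + ?m\<^sup>2 * poisson z w)"
    by (intro Bochner_Integration.integral_cong refl) (simp add: power2_diff algebra_simps)
  also have "\<dots> = (LINT w|circ. poisson z w * norm (b w)) - 2 * ?m * ?m + ?m\<^sup>2 * (LINT w|circ. poisson z w)"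
    using ip ib integrable_poisson_sqrt[OF z] by simp
  also have "\<dots> = (LINT w|circ. poisson z w * norm (b w)) - ?m\<^sup>2"
    by (simp add: integral_poisson[OF z] power2_eq_square)
  finally have "?m\<^sup>2 \<le> (LINT w|circ. poisson z w * norm (b w))" by simp
  moreover have "(sqrt (norm (f z)))\<^sup>2 \<le> ?m\<^sup>2"
    by (intro power_mono sqrt_norm_le_poisson z) auto
  ultimately show ?thesis by simp
qed

text \<open>Scheffe's lemma: pointwise convergence, with norms that do not exceed the norm of the
  limit. The latter holds because the Poisson majorant of |f|, averaged over a circle, gives the
  mean of |b|.\<close>

lemma L1_convergence: "(\<lambda>n. LINT w|circ. norm (F n w - b w)) \<longlonglongrightarrow> 0"
proof -
  have "(\<lambda>n. \<integral>\<^sup>+w. norm (F n w - b w) \<partial>circ) \<longlonglongrightarrow> 0"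
  proof (rule Scheffe_lemma2[OF _ b_integrable F_lim])
    fix n
    have "(\<integral>\<^sup>+w. norm (F n w) \<partial>circ) \<le> (\<integral>\<^sup>+v. (\<integral>\<^sup>+w. ennreal (poisson (of_real (rho n) * v) w) * norm (b w) \<partial>circ) \<partial>circ)"
    proof (intro nn_integral_mono)
      fix v assume "v \<in> space circ"
      then have z: "norm (of_real (rho n) * v) < 1" using rho[of n] by (simp add: norm_mult)
      have "ennreal (norm (F n v)) \<le> ennreal (LINT w|circ. poisson (of_real (rho n) * v) w * norm (b w))"
        by (intro ennreal_leI norm_le_poisson z)
      also have "\<dots> = (\<integral>\<^sup>+w. ennreal (poisson (of_real (rho n) * v) w * norm (b w)) \<partial>circ)"
        using integrable_poisson_mult[OF z integrable_norm[OF b_integrable]]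
        by (intro nn_integral_eq_integral[symmetric] AE_I2 mult_nonneg_nonneg poisson_nonneg z) auto
      also have "\<dots> = (\<integral>\<^sup>+w. ennreal (poisson (of_real (rho n) * v) w) * norm (b w) \<partial>circ)"
        by (simp only: ennreal_mult[OF poisson_nonneg[OF z] norm_ge_zero])
      finally show "ennreal (norm (F n v)) \<le> (\<integral>\<^sup>+w. ennreal (poisson (of_real (rho n) * v) w) * norm (b w) \<partial>circ)" .
    qed
    also have "\<dots> = (\<integral>\<^sup>+w. norm (b w) \<partial>circ)"
      by (rule nn_integral_poisson_average[OF _ rho(3) rho(2)]) measurable
    finally show "(\<integral>\<^sup>+w. norm (F n w) \<partial>circ) \<le> (\<integral>\<^sup>+w. norm (b w) \<partial>circ)" .
  qed measurable
  moreover have "(\<integral>\<^sup>+w. norm (F n w - b w) \<partial>circ) = ennreal (LINT w|circ. norm (F n w - b w))" for n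
    using dilation_integrable(3)[OF f, of n] b_integrable by (intro nn_integral_eq_integral) auto
  ultimately have "(\<lambda>n. ennreal (LINT w|circ. norm (F n w - b w))) \<longlonglongrightarrow> ennreal 0" by simp
  then show ?thesis by (subst (asm) tendsto_ennreal_iff) (auto intro!: integral_nonneg_AE)
qed

text \<open>Lipschitz functions of the boundary value, so that |b| and ||b| - m| are covered alike;
  for fixed \<open>z\<close> the kernel is bounded, and L^1 convergence suffices.\<close>

lemma poisson_limit:
  fixes u :: "complex \<Rightarrow> real"
  assumes z: "norm z < 1" and u: "\<And>x y. \<bar>u x - u y\<bar> \<le> norm (x - y)"
  shows "(\<lambda>n. LINT w|circ. poisson z w * u (F n w)) \<longlonglongrightarrow> (LINT w|circ. poisson z w * u (b w))"
    and "integrable circ (\<lambda>w. poisson z w * u (b w))"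
proof -
  note [measurable] = poisson_measurable[OF z]
  obtain P where P: "\<And>w. norm w = 1 \<Longrightarrow> poisson z w \<le> P" "P > 0" using poisson_bounded[OF z] by blast
  have uc: "continuous_on UNIV u"
    unfolding continuous_on_iff by (metis u dist_norm dist_real_def le_less_trans)
  then have [measurable]: "u \<in> borel_measurable borel" by (rule borel_measurable_continuous_onI)
  have int: "integrable circ (\<lambda>w. poisson z w * u (k w))" if k: "integrable circ k" for k
  proof -
    have [measurable]: "k \<in> borel_measurable circ" using k by simp
    have "integrable circ (\<lambda>w. u (k w))"
    proof (rule Bochner_Integration.integrable_bound)
      show "integrable circ (\<lambda>w. \<bar>u 0\<bar> + norm (k w))" using k by simp
      show "AE w in circ. norm (u (k w)) \<le> norm (\<bar>u 0\<bar> + norm (k w))"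
        using u[of _ 0] by (intro AE_I2) (smt (verit) diff_zero norm_ge_zero real_norm_def)
    qed measurable
    from integrable_poisson_mult[OF z this] show ?thesis by simp
  qed
  note iF = int[OF dilation_integrable(3)[OF f]] and ib = int[OF b_integrable]
  show "integrable circ (\<lambda>w. poisson z w * u (b w))" by (rule ib)
  have bound: "\<bar>(LINT w|circ. poisson z w * u (F n w)) - (LINT w|circ. poisson z w * u (b w))\<bar> \<le> P * (LINT w|circ. norm (F n w - b w))" for n
  proof -
    have i2: "integrable circ (\<lambda>w. P * norm (F n w - b w))"
      using dilation_integrable(3)[OF f, of n] b_integrable by simp
    have "(LINT w|circ. poisson z w * u (F n w)) - (LINT w|circ. poisson z w * u (b w)) =
      (LINT w|circ. poisson z w * u (F n w) - poisson z w * u (b w))"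
      by (rule Bochner_Integration.integral_diff[symmetric]) (rule iF ib)+
    also have "norm \<dots> \<le> (LINT w|circ. norm (poisson z w * u (F n w) - poisson z w * u (b w)))"
      by (rule integral_norm_bound)
    also have "\<dots> \<le> (LINT w|circ. P * norm (F n w - b w))"
    proof (intro integral_mono integrable_norm Bochner_Integration.integrable_diff iF ib i2)
      fix w assume "w \<in> space circ"
      then have w: "norm w = 1" by simp
      have "norm (poisson z w * u (F n w) - poisson z w * u (b w)) = poisson z w * \<bar>u (F n w) - u (b w)\<bar>"
        using poisson_nonneg[OF z, of w] by (simp add: abs_mult flip: right_diff_distrib)
      also have "\<dots> \<le> P * norm (F n w - b w)"
        using P(2) by (intro mult_mono P(1)[OF w] u) simp_all
      finally show "norm (poisson z w * u (F n w) - poisson z w * u (b w)) \<le> P * norm (F n w - b w)" .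
    qed
    finally show ?thesis by simp
  qed
  have "(\<lambda>n. P * (LINT w|circ. norm (F n w - b w))) \<longlonglongrightarrow> P * 0"
    by (intro tendsto_mult tendsto_const L1_convergence)
  then have "(\<lambda>n. P * (LINT w|circ. norm (F n w - b w))) \<longlonglongrightarrow> 0" by simp
  then have "(\<lambda>n. (LINT w|circ. poisson z w * u (F n w)) - (LINT w|circ. poisson z w * u (b w))) \<longlonglongrightarrow> 0"
    by (rule Lim_null_comparison[rotated]) (rule always_eventually, use bound in \<open>simp only: real_norm_def simp_thms\<close>)
  then show "(\<lambda>n. LINT w|circ. poisson z w * u (F n w)) \<longlonglongrightarrow> (LINT w|circ. poisson z w * u (b w))"
    by (simp add: LIM_zero_iff)
qed

text \<open>The estimate for functions continuous up to the circle, applied to dilations. Their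
  derivative brings the chain rule factor \<open>rho n\<close>, which tends to 1.\<close>

lemma derivative_bound_radial_limit:
  assumes z: "norm z < 1"
  shows "(1 - (norm z)\<^sup>2) * norm (deriv f z) \<le>
     2 * ((LINT w|circ. poisson z w * norm (b w)) - norm (f z)) +
     2 * (LINT w|circ. poisson z w * \<bar>norm (b w) - m\<bar>)"
proof -
  have "continuous_on (ball 0 1) (deriv f)"
    by (intro holomorphic_on_imp_continuous_on holomorphic_deriv f open_ball)
  then have "isCont (deriv f) z"
    using z by (simp add: continuous_on_eq_continuous_at)
  then have "(\<lambda>n. deriv f (of_real (rho n) * z)) \<longlonglongrightarrow> deriv f z"
    using tendsto_rho_mult by (rule isCont_tendsto_compose)
  from tendsto_mult[OF rho_tendsto tendsto_norm[OF this]]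
  have "(\<lambda>n. (1 - (norm z)\<^sup>2) * (rho n * norm (deriv f (of_real (rho n) * z)))) \<longlonglongrightarrow> (1 - (norm z)\<^sup>2) * (1 * norm (deriv f z))"
    by (rule tendsto_mult[OF tendsto_const])
  moreover have "(\<lambda>n. 2 * ((LINT w|circ. poisson z w * norm (F n w)) - norm (F n z)) +
     2 * (LINT w|circ. poisson z w * \<bar>norm (F n w) - m\<bar>)) \<longlonglongrightarrow>
     2 * ((LINT w|circ. poisson z w * norm (b w)) - norm (f z)) +
     2 * (LINT w|circ. poisson z w * \<bar>norm (b w) - m\<bar>)"
  proof -
    have *: "\<bar>norm x - norm y\<bar> \<le> norm (x - y)" for x y :: complex by (rule norm_triangle_ineq3)
    have **: "\<bar>\<bar>norm x - m\<bar> - \<bar>norm y - m\<bar>\<bar> \<le> norm (x - y)" for x y :: complex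
      using *[of x y] by linarith
    show ?thesis
      by (intro tendsto_add tendsto_mult tendsto_diff tendsto_const tendsto_norm f_lim[OF z]
        poisson_limit(1)[OF z, of norm, OF *] poisson_limit(1)[OF z, of "\<lambda>x. \<bar>norm x - m\<bar>", OF **])
  qed
  moreover have "(1 - (norm z)\<^sup>2) * (rho n * norm (deriv f (of_real (rho n) * z))) \<le>
     2 * ((LINT w|circ. poisson z w * norm (F n w)) - norm (F n z)) +
     2 * (LINT w|circ. poisson z w * \<bar>norm (F n w) - m\<bar>)" for n
  proof -
    have "norm (of_real (rho n) * z) < 1"
      using mult_strict_mono'[of "rho n" 1 "norm z" 1] rho[of n] z by (simp add: norm_mult)
    then have "f field_differentiable at (of_real (rho n) * z)"
      using f by (auto intro: holomorphic_on_imp_differentiable_at)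
    then have "(f has_field_derivative deriv f (of_real (rho n) * z)) (at (of_real (rho n) * z))"
      by (simp add: field_differentiable_derivI)
    then have "((\<lambda>w. F n w) has_field_derivative deriv f (of_real (rho n) * z) * of_real (rho n)) (at z)"
      by (rule DERIV_chain2[where f = f and g = "\<lambda>w. of_real (rho n) * w"]) (auto intro!: derivative_eq_intros)
    then have "deriv (\<lambda>w. F n w) z = deriv f (of_real (rho n) * z) * of_real (rho n)"
      by (rule DERIV_imp_deriv)
    then have "norm (deriv (\<lambda>w. F n w) z) = rho n * norm (deriv f (of_real (rho n) * z))"
      using rho[of n] by (simp add: norm_mult)
    then show ?thesis
      using derivative_bound[OF continuous_on_dilation(1,2)[OF f rho(3) rho(2)] z, of n m] by simp
  qed
  ultimately show ?thesis by (intro LIMSEQ_le[where X = "\<lambda>n. (1 - (norm z)\<^sup>2) * (rho n * norm (deriv f (of_real (rho n) * z)))"]) auto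
qed

end

subsection \<open>Minkowski's integral inequality\<close>

text \<open>The tangent of x^p at \<open>c\<close>. The point k = 0 is treated apart, as convexity
  is used on the open half-line.\<close>

lemma powr_above_tangent:
  fixes p c k :: real
  assumes p: "1 \<le> p" and c: "0 < c" and k: "0 \<le> k"
  shows "p * c powr (p - 1) * k \<le> k powr p + (p - 1) * c powr p"
proof (cases "k = 0")
  case False
  have cc: "c powr (p - 1) * c = c powr p" using c by (simp add: powr_diff)
  have "p * c powr (p - 1) * (k - c) \<le> k powr p - c powr p"
  proof (rule convex_on_imp_above_tangent[where A = "{0<..}" and f = "\<lambda>x. x powr p"])
    show "convex_on {0<..} (\<lambda>x. x powr p)" using p by (rule powr_convex)
    show "((\<lambda>x. x powr p) has_real_derivative p * c powr (p - 1)) (at c within {0<..})"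
      using has_real_derivative_powr[OF c] by (rule has_field_derivative_at_within)
  qed (use c k False in \<open>auto simp: interior_open\<close>)
  then have "p * c powr (p - 1) * k - p * (c powr (p - 1) * c) \<le> k powr p - c powr p"
    by (simp add: algebra_simps)
  then show ?thesis unfolding cc by (simp add: algebra_simps)
qed (use p c in simp)

text \<open>Young's inequality with the weight \<open>d\<close>, chosen so that it is sharp for \<open>k\<close> proportional to \<open>d\<close>.\<close>

lemma powr_integral_le:
  fixes k d :: "'a \<Rightarrow> real" and p :: real
  assumes p: "1 \<le> p" and k: "integrable N k" "\<And>y. y \<in> space N \<Longrightarrow> 0 \<le> k y"
    and d: "integrable N d" "\<And>y. y \<in> space N \<Longrightarrow> 0 < d y"
  shows "ennreal ((LINT y|N. k y) powr p) \<le> ennreal ((LINT y|N. d y) powr (p - 1)) * (\<integral>\<^sup>+y. ennreal (d y powr (1 - p) * k y powr p) \<partial>N)"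
proof -
  define a where "a = (LINT y|N. k y)"
  define D where "D = (LINT y|N. d y)"
  define J where "J = (\<integral>\<^sup>+y. ennreal (d y powr (1 - p) * k y powr p) \<partial>N)"
  have [measurable]: "k \<in> borel_measurable N" "d \<in> borel_measurable N" using k d by auto
  have a0: "0 \<le> a" unfolding a_def using k(2) by (intro integral_nonneg_AE) auto
  have D0: "0 \<le> D" unfolding D_def using d(2) by (intro integral_nonneg_AE AE_I2) (auto intro: less_imp_le)
  show ?thesis
  proof (cases "a = 0")
    case False
    have "D \<noteq> 0"
    proof
      assume "D = 0"
      \<comment> \<open>Since \<open>d\<close> is strictly positive, \<open>D = 0\<close> means that
        \<open>N\<close> is null, and then \<open>a\<close> is 0 too.\<close>
      then have "AE y in N. d y = 0"
        using d by (subst (asm) D_def) (subst (asm) integral_nonneg_eq_0_iff_AE, auto intro!: AE_I2 less_imp_le)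
      then have "AE y in N. False" using AE_space by eventually_elim (use d(2) in force)
      then have "AE y in N. k y = 0" by (rule AE_mp) simp
      then have "a = 0" unfolding a_def by (simp add: integral_eq_zero_AE)
      then show False using False by simp
    qed
    with D0 have D: "0 < D" by simp
    \<comment> \<open>With the ratio of the two integrals as tangent point, the term with factor p -
      1 cancels against the left side after integration.\<close>
    define c where "c = a / D"
    have c: "0 < c" using False a0 D by (simp add: c_def)
    have pt: "p * c powr (p - 1) * k y \<le> d y powr (1 - p) * k y powr p + (p - 1) * c powr p * d y"
      if y: "y \<in> space N" for y
    proof -
      note dy = d(2)[OF y]
      have "p * c powr (p - 1) * (k y / d y) \<le> (k y / d y) powr p + (p - 1) * c powr p"
        using dy k(2)[OF y] c p by (intro powr_above_tangent) auto
      then have "d y * (p * c powr (p - 1) * (k y / d y)) \<le> d y * ((k y / d y) powr p + (p - 1) * c powr p)"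
        using dy by (intro mult_left_mono) auto
      moreover have "d y * (k y / d y) powr p = d y powr (1 - p) * k y powr p"
        using dy k(2)[OF y] by (simp add: powr_divide powr_diff)
      ultimately show ?thesis using dy by (simp add: algebra_simps)
    qed
    have "ennreal (p * c powr (p - 1) * a) = ennreal (LINT y|N. p * c powr (p - 1) * k y)"
      by (simp add: a_def)
    also have "\<dots> = (\<integral>\<^sup>+y. ennreal (p * c powr (p - 1) * k y) \<partial>N)"
      using k p by (intro nn_integral_eq_integral[symmetric]) (auto intro!: AE_I2)
    also have "\<dots> \<le> (\<integral>\<^sup>+y. ennreal (d y powr (1 - p) * k y powr p) + ennreal ((p - 1) * c powr p * d y) \<partial>N)"
    proof (intro nn_integral_mono)
      fix y assume y: "y \<in> space N"
      show "ennreal (p * c powr (p - 1) * k y) \<le> ennreal (d y powr (1 - p) * k y powr p) + ennreal ((p - 1) * c powr p * d y)"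
      proof -
        have "ennreal (d y powr (1 - p) * k y powr p + (p - 1) * c powr p * d y) =
          ennreal (d y powr (1 - p) * k y powr p) + ennreal ((p - 1) * c powr p * d y)"
          using p d(2)[OF y] by (intro ennreal_plus) auto
        then show ?thesis using ennreal_leI[OF pt[OF y]] by simp
      qed
    qed
    also have "\<dots> = J + (\<integral>\<^sup>+y. ennreal ((p - 1) * c powr p * d y) \<partial>N)"
      unfolding J_def by (intro nn_integral_add) auto
    also have "(\<integral>\<^sup>+y. ennreal ((p - 1) * c powr p * d y) \<partial>N) = ennreal (LINT y|N. (p - 1) * c powr p * d y)"
      using d p by (intro nn_integral_eq_integral) (auto intro!: AE_I2 mult_nonneg_nonneg less_imp_le[OF d(2)])
    also have "(LINT y|N. (p - 1) * c powr p * d y) = (p - 1) * c powr p * D" by (simp add: D_def)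
    finally have le: "ennreal (p * c powr (p - 1) * a) \<le> J + ennreal ((p - 1) * c powr p * D)" .
    have cp: "c powr p * D = c powr (p - 1) * a" using c D False a0 by (simp add: powr_diff c_def)
    show ?thesis
    proof (cases J)
      case (real j)
      have "p * c powr (p - 1) * a \<le> j + (p - 1) * c powr p * D"
        using le real p D0 by (simp add: ennreal_plus[symmetric] ennreal_le_iff del: ennreal_plus)
      also have "(p - 1) * c powr p * D = (p - 1) * (c powr (p - 1) * a)" by (simp only: mult.assoc cp)
      finally have "c powr (p - 1) * a \<le> j" by (simp add: algebra_simps)
      then have "D powr (p - 1) * (c powr (p - 1) * a) \<le> D powr (p - 1) * j" by (intro mult_left_mono) auto
      moreover have "D powr (p - 1) * (c powr (p - 1) * a) = a powr p"
        using D a0 False by (simp add: c_def powr_divide powr_diff)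
      ultimately have "ennreal (a powr p) \<le> ennreal (D powr (p - 1) * j)" by (simp add: ennreal_leI)
      also have "\<dots> = ennreal (D powr (p - 1)) * J" using real by (simp add: ennreal_mult)
      finally show ?thesis by (simp add: a_def D_def J_def)
    next
      case top
      then show ?thesis using D by (simp add: a_def[symmetric] D_def[symmetric] J_def[symmetric] ennreal_mult_top)
    qed
  qed (use p in \<open>simp add: a_def\<close>)
qed

text \<open>The weighted bound with weight d + e, followed by Fubini: the weight cancels against the
  slice bound, (d + e)^(1-p) d^p <= d + e. The shift e > 0 keeps the weight positive and is sent to
  0. A majorant \<open>d\<close> in place of the slice norms spares their measurability.\<close>

lemma minkowski_integral:
  fixes K :: "'a \<Rightarrow> 'b \<Rightarrow> real" and d :: "'a \<Rightarrow> real" and p :: real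
  assumes "finite_measure N" "sigma_finite_measure M" and p: "1 \<le> p"
    and K: "(\<lambda>(y, x). K y x) \<in> borel_measurable (N \<Otimes>\<^sub>M M)" "\<And>y x. 0 \<le> K y x"
    and Ki: "\<And>x. x \<in> space M \<Longrightarrow> integrable N (\<lambda>y. K y x)"
    and d: "integrable N d" "\<And>y. 0 \<le> d y"
    and Kd: "\<And>y. y \<in> space N \<Longrightarrow> (\<integral>\<^sup>+x. ennreal (K y x powr p) \<partial>M) \<le> ennreal (d y powr p)"
  shows "(\<integral>\<^sup>+x. ennreal ((LINT y|N. K y x) powr p) \<partial>M) \<le> ennreal ((LINT y|N. d y) powr p)"
proof -
  interpret N: finite_measure N by fact
  interpret M: sigma_finite_measure M by fact
  interpret P: pair_sigma_finite N M ..
  have [measurable]: "(\<lambda>(y, x). K y x) \<in> borel_measurable (N \<Otimes>\<^sub>M M)" "d \<in> borel_measurable N"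
    using K d by auto
  have pos: "(\<integral>\<^sup>+x. ennreal ((LINT y|N. K y x) powr p) \<partial>M) \<le> ennreal ((LINT y|N. d y + e) powr p)" if e: "e > 0" for e
  proof -
    define D where "D = (LINT y|N. d y + e)"
    have di: "integrable N (\<lambda>y. d y + e)" using d by auto
    have dp: "0 < d y + e" for y using d(2)[of y] e by simp
    have D0: "0 \<le> D" unfolding D_def using dp by (intro integral_nonneg_AE AE_I2) (auto intro: less_imp_le)
    have "(\<integral>\<^sup>+x. ennreal ((LINT y|N. K y x) powr p) \<partial>M) \<le>
      (\<integral>\<^sup>+x. ennreal (D powr (p - 1)) * (\<integral>\<^sup>+y. ennreal ((d y + e) powr (1 - p) * K y x powr p) \<partial>N) \<partial>M)"
      unfolding D_def using p Ki K(2) di dp by (intro nn_integral_mono powr_integral_le) auto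
    also have "\<dots> = ennreal (D powr (p - 1)) * (\<integral>\<^sup>+x. (\<integral>\<^sup>+y. ennreal ((d y + e) powr (1 - p) * K y x powr p) \<partial>N) \<partial>M)"
      by (rule nn_integral_cmult) measurable
    also have "(\<integral>\<^sup>+x. (\<integral>\<^sup>+y. ennreal ((d y + e) powr (1 - p) * K y x powr p) \<partial>N) \<partial>M) =
       (\<integral>\<^sup>+y. (\<integral>\<^sup>+x. ennreal ((d y + e) powr (1 - p) * K y x powr p) \<partial>M) \<partial>N)"
      by (rule P.Fubini') measurable
    also have "ennreal (D powr (p - 1)) * \<dots> \<le> ennreal (D powr (p - 1)) * (\<integral>\<^sup>+y. ennreal (d y + e) \<partial>N)"
    proof (intro mult_left_mono nn_integral_mono)
      fix y assume y: "y \<in> space N"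
      have "(\<integral>\<^sup>+x. ennreal ((d y + e) powr (1 - p) * K y x powr p) \<partial>M) = ennreal ((d y + e) powr (1 - p)) * (\<integral>\<^sup>+x. ennreal (K y x powr p) \<partial>M)"
        using y by (subst nn_integral_cmult[symmetric]) (auto simp: ennreal_mult)
      also have "\<dots> \<le> ennreal ((d y + e) powr (1 - p)) * ennreal (d y powr p)"
        by (intro mult_left_mono Kd y) auto
      also have "\<dots> \<le> ennreal ((d y + e) powr (1 - p)) * ennreal ((d y + e) powr p)"
        using p e d(2)[of y] by (intro mult_left_mono ennreal_leI powr_mono2) auto
      also have "\<dots> = ennreal (d y + e)"
        using dp[of y] by (simp add: powr_diff flip: ennreal_mult)
      finally show "(\<integral>\<^sup>+x. ennreal ((d y + e) powr (1 - p) * K y x powr p) \<partial>M) \<le> ennreal (d y + e)" .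
    qed simp
    also have "(\<integral>\<^sup>+y. ennreal (d y + e) \<partial>N) = ennreal D"
      unfolding D_def using di dp by (intro nn_integral_eq_integral) (auto intro!: AE_I2 less_imp_le)
    also have "ennreal (D powr (p - 1)) * ennreal D = ennreal (D powr p)"
      using D0 p by (cases "D = 0") (auto simp: powr_diff simp flip: ennreal_mult)
    finally show ?thesis by (simp add: D_def)
  qed
  have "(\<lambda>n. (LINT y|N. d y + 1 / (real n + 1)) powr p) \<longlonglongrightarrow> (LINT y|N. d y) powr p"
  proof (rule tendsto_powr2)
    have eq: "(LINT y|N. d y + e) = (LINT y|N. d y) + e * measure N (space N)" for e
      using d by simp
    have "(\<lambda>n. 1 / (real n + 1)) \<longlonglongrightarrow> 0" by real_asymp
    from tendsto_add[OF tendsto_const tendsto_mult[OF this tendsto_const]]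
    show "(\<lambda>n. (LINT y|N. d y + 1 / (real n + 1))) \<longlonglongrightarrow> (LINT y|N. d y)"
      unfolding eq by force
    show "\<forall>\<^sub>F n in sequentially. 0 \<le> (LINT y|N. d y + 1 / (real n + 1))"
      using d(2) by (intro always_eventually allI integral_nonneg_AE AE_I2) (auto intro!: add_nonneg_nonneg)
  qed (use p in auto)
  then have "(\<lambda>n. ennreal ((LINT y|N. d y + 1 / (real n + 1)) powr p)) \<longlonglongrightarrow> ennreal ((LINT y|N. d y) powr p)"
    by (rule tendsto_ennrealI)
  then show ?thesis by (rule LIMSEQ_le_const) (auto intro!: pos)
qed

section \<open>Power means over the circle and differences along segments\<close>

definition pmean :: "real \<Rightarrow> (complex \<Rightarrow> complex) \<Rightarrow> real \<Rightarrow> real" where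
  "pmean p g r = (LINT w|circ. norm (g (of_real r * w)) powr p) powr (1 / p)"

lemma pmean_nonneg: "0 \<le> pmean p g r"
  by (simp add: pmean_def)

lemma nn_integral_powr_dilation:
  assumes g: "g holomorphic_on ball 0 1" and p: "1 \<le> p" and r: "0 \<le> r" "r < 1"
  shows "(\<integral>\<^sup>+w. ennreal (norm (g (of_real r * w)) powr p) \<partial>circ) = ennreal (pmean p g r powr p)"
proof -
  have "integrable circ (\<lambda>w. norm (g (of_real r * w)) powr p)"
    using p by (intro integrable_circ_continuous continuous_on_powr' continuous_intros continuous_on_dilation(3)[OF g r]) auto
  then have "(\<integral>\<^sup>+w. ennreal (norm (g (of_real r * w)) powr p) \<partial>circ) = ennreal (LINT w|circ. norm (g (of_real r * w)) powr p)"
    by (intro nn_integral_eq_integral) auto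
  also have "(LINT w|circ. norm (g (of_real r * w)) powr p) = pmean p g r powr p"
    using p by (simp add: pmean_def powr_powr integral_nonneg_AE)
  finally show ?thesis .
qed

lemma pmean_mono:
  assumes g: "g holomorphic_on ball 0 1" and p: "1 \<le> p" and r: "0 \<le> r" "r \<le> R" "R < 1"
  shows "pmean p g r \<le> pmean p g R"
  unfolding pmean_def using p r by (intro powr_mono2 power_mean_mono g integral_nonneg_AE) auto

lemma dilation_holomorphic_complex:
  assumes g: "g holomorphic_on ball 0 1" and a: "norm a < 1"
  shows "(\<lambda>w. g (a * w)) holomorphic_on ball 0 1" "continuous_on (sphere 0 1) (\<lambda>w. g (a * w))"
proof -
  have sub: "(\<lambda>w. a * w) ` cball 0 1 \<subseteq> ball 0 1"
  proof clarsimp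
    fix w :: complex assume "norm w \<le> 1"
    then have "norm a * norm w \<le> norm a * 1" by (intro mult_left_mono) auto
    then show "norm (a * w) < 1" using a by (simp add: norm_mult)
  qed
  have "g \<circ> (\<lambda>w. a * w) holomorphic_on ball 0 1"
    using sub by (intro holomorphic_on_compose_gen[OF _ g] holomorphic_intros) force
  then show "(\<lambda>w. g (a * w)) holomorphic_on ball 0 1" by (simp add: o_def)
  show "continuous_on (sphere 0 1) (\<lambda>w. g (a * w))"
    using sub by (intro continuous_on_compose2[OF holomorphic_on_imp_continuous_on[OF g]] continuous_intros) force
qed

text \<open>Rotation invariance leaves only the modulus of \<open>a\<close>, and the means increase
  with the radius.\<close>

lemma nn_integral_powr_complex_dilation:
  assumes g: "g holomorphic_on ball 0 1" and p: "1 \<le> p" and a: "norm a \<le> r" "r < 1"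
  shows "(\<integral>\<^sup>+w. ennreal (norm (g (a * w)) powr p) \<partial>circ) \<le> ennreal (pmean p g r powr p)"
proof -
  obtain v where v: "norm v = 1" "a = v * of_real (norm a)"
  proof (cases "a = 0")
    case False
    then show ?thesis using that[of "a / of_real (norm a)"] by (simp add: norm_divide)
  qed (use that[of 1] in auto)
  let ?u = "\<lambda>w. ennreal (norm (g (of_real (norm a) * w)) powr p)"
  have "norm a < 1" using a by simp
  from borel_measurable_circ_continuous[OF continuous_on_dilation(3)[OF g norm_ge_zero this]]
  have "?u \<in> borel_measurable circ" by measurable
  from nn_integral_circ_rotate[OF v(1) this]
  have "(\<integral>\<^sup>+w. ennreal (norm (g (of_real (norm a) * (v * w))) powr p) \<partial>circ) = (\<integral>\<^sup>+w. ?u w \<partial>circ)" .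
  also have "\<dots> = ennreal (pmean p g (norm a) powr p)"
    using a by (intro nn_integral_powr_dilation g p) auto
  also have "\<dots> \<le> ennreal (pmean p g r powr p)"
    using a p by (intro ennreal_leI powr_mono2 pmean_mono g p pmean_nonneg) auto
  finally show ?thesis by (subst v(2)) (simp add: mult_ac)
qed

text \<open>The fundamental theorem of calculus on the segment from a w to c w, and Minkowski over
  its parameter. Radial moves and moves along chords are both of this form.\<close>

lemma segment_bound:
  fixes f :: "complex \<Rightarrow> complex"
  assumes f: "f holomorphic_on ball 0 1" and p: "1 \<le> p" and a: "norm a \<le> r" and c: "norm c \<le> r" and r: "r < 1"
  shows "(\<integral>\<^sup>+w. ennreal (norm (f (c * w) - f (a * w)) powr p) \<partial>circ) \<le> ennreal ((norm (c - a) * pmean p (deriv f) r) powr p)"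
proof -
  define N where "N = restrict_space lborel {0..1::real}"
  define l where "l u = a + of_real u * (c - a)" for u :: real
  define K where "K u w = norm (c - a) * norm (deriv f (l u * w))" for u w
  have df: "deriv f holomorphic_on ball 0 1" by (intro holomorphic_deriv f open_ball)
  have l: "norm (l u) \<le> r" if "u \<in> {0..1}" for u
  proof -
    have "l u = of_real (1 - u) * a + of_real u * c" by (simp add: l_def algebra_simps)
    also have "norm \<dots> \<le> (1 - u) * norm a + u * norm c"
      using that norm_triangle_ineq[of "of_real (1 - u) * a" "of_real u * c"] by (simp add: norm_mult del: of_real_diff)
    also have "\<dots> \<le> (1 - u) * r + u * r" using that a c by (intro add_mono mult_left_mono) auto
    finally show ?thesis by (simp add: algebra_simps)
  qed
  have lw: "norm (l u * w) < 1" if "u \<in> {0..1}" "norm w = 1" for u w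
    using l[OF that(1)] that r by (simp add: norm_mult)
  interpret N: finite_measure N
    by (standard) (simp add: N_def emeasure_restrict_space space_restrict_space)
  have spN: "space N = {0..1}" by (simp add: N_def space_restrict_space)
  have cont: "continuous_on {0..1} (\<lambda>u. deriv f (l u * w))" if "norm w = 1" for w
    unfolding l_def using lw[OF _ that]
    by (intro continuous_on_compose2[OF holomorphic_on_imp_continuous_on[OF df]] continuous_intros) (auto simp: l_def)
  have Nint: "integrable N h \<longleftrightarrow> set_integrable lborel {0..1} h" "(LINT u|N. h u) = (LINT u:{0..1}|lborel. h u)" for h :: "real \<Rightarrow> real"
    by (simp_all add: N_def integrable_restrict_space integral_restrict_space set_integrable_def set_lebesgue_integral_def)
  have Ki: "integrable N (\<lambda>u. K u w)" if "norm w = 1" for w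
    unfolding Nint K_def by (intro borel_integrable_atLeastAtMost' continuous_intros cont that)
  have Km: "(\<lambda>(u, w). K u w) \<in> borel_measurable (N \<Otimes>\<^sub>M circ)"
  proof -
    \<comment> \<open>Cut off outside the disc, \<open>deriv f\<close> becomes Borel on the whole
      plane, which gives joint measurability in (u, w).\<close>
    define D where "D z = indicator (ball 0 1) z *\<^sub>R deriv f z" for z
    have D[measurable]: "D \<in> borel_measurable borel" unfolding D_def
      by (intro borel_measurable_continuous_on_indicator holomorphic_on_imp_continuous_on df) auto
    have [measurable]: "fst \<in> borel_measurable (N \<Otimes>\<^sub>M circ)"
      using measurable_compose[OF measurable_fst, of "\<lambda>x. x" N borel] by (simp add: N_def measurable_restrict_space1)
    have "(\<lambda>x. norm (c - a) * norm (D (l (fst x) * snd x))) \<in> borel_measurable (N \<Otimes>\<^sub>M circ)"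
      unfolding l_def by measurable
    moreover have "(\<lambda>(u, w). K u w) \<in> borel_measurable (N \<Otimes>\<^sub>M circ) \<longleftrightarrow> (\<lambda>x. norm (c - a) * norm (D (l (fst x) * snd x))) \<in> borel_measurable (N \<Otimes>\<^sub>M circ)"
      by (intro measurable_cong) (use lw in \<open>auto simp: space_pair_measure spN K_def D_def\<close>)
    ultimately show ?thesis by simp
  qed
  have "(\<integral>\<^sup>+w. ennreal (norm (f (c * w) - f (a * w)) powr p) \<partial>circ) \<le> (\<integral>\<^sup>+w. ennreal ((LINT u|N. K u w) powr p) \<partial>circ)"
  proof (intro nn_integral_mono ennreal_leI powr_mono2)
    fix w assume "w \<in> space circ"
    then have w: "norm w = 1" by simp
    have "((\<lambda>u. (c - a) * w * deriv f (l u * w)) has_integral f (l 1 * w) - f (l 0 * w)) {0..1}"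
    proof (rule fundamental_theorem_of_calculus)
      fix u :: real assume u: "u \<in> {0..1}"
      have "(f has_field_derivative deriv f (l u * w)) (at (l u * w))"
        using lw[OF u w] f by (intro holomorphic_derivI[OF f open_ball]) auto
      moreover have "((\<lambda>u. l u * w) has_vector_derivative (c - a) * w) (at u within {0..1})"
        unfolding l_def by (auto intro!: derivative_eq_intros)
      ultimately show "((\<lambda>u. f (l u * w)) has_vector_derivative (c - a) * w * deriv f (l u * w)) (at u within {0..1})"
        using field_vector_diff_chain_within[of "\<lambda>u. l u * w" "(c - a) * w" u "{0..1}" f "deriv f (l u * w)"]
        by (simp add: o_def has_field_derivative_at_within)
    qed simp
    then have "integral {0..1} (\<lambda>u. (c - a) * w * deriv f (l u * w)) = f (l 1 * w) - f (l 0 * w)"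
      by (rule integral_unique)
    moreover have "l 1 = c" "l 0 = a" by (simp_all add: l_def)
    ultimately have "f (c * w) - f (a * w) = integral {0..1} (\<lambda>u. (c - a) * w * deriv f (l u * w))"
      by (simp only:)
    also have "norm \<dots> \<le> integral {0..1} (\<lambda>u. K u w)"
    proof (rule integral_norm_bound_integral)
      show "(\<lambda>u. (c - a) * w * deriv f (l u * w)) integrable_on {0..1}"
        "(\<lambda>u. K u w) integrable_on {0..1}"
        unfolding K_def by (intro integrable_continuous_interval continuous_intros cont w)+
    qed (simp add: K_def norm_mult w)
    also have "\<dots> = (LINT u|N. K u w)"
      unfolding Nint by (rule set_borel_integral_eq_integral(2)[symmetric]) (use Ki[OF w] in \<open>simp add: Nint\<close>)
    finally show "norm (f (c * w) - f (a * w)) \<le> (LINT u|N. K u w)" .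
  qed (use p in auto)
  also have "\<dots> \<le> ennreal ((LINT u|N. norm (c - a) * pmean p (deriv f) r) powr p)"
  proof (rule minkowski_integral[OF N.finite_measure_axioms _ p Km])
    show "sigma_finite_measure circ" ..
    fix u assume "u \<in> space N"
    then have u: "u \<in> {0..1}" by (simp add: spN)
    have "(\<integral>\<^sup>+w. ennreal (K u w powr p) \<partial>circ) = (\<integral>\<^sup>+w. ennreal (norm (c - a) powr p) * ennreal (norm (deriv f (l u * w)) powr p) \<partial>circ)"
      by (intro nn_integral_cong) (simp add: K_def powr_mult ennreal_mult)
    also have "\<dots> = ennreal (norm (c - a) powr p) * (\<integral>\<^sup>+w. ennreal (norm (deriv f (l u * w)) powr p) \<partial>circ)"
    proof -
      have "norm (l u) < 1" using l[OF u] r by simp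
      from borel_measurable_circ_continuous[OF dilation_holomorphic_complex(2)[OF df this]]
      have "(\<lambda>w. ennreal (norm (deriv f (l u * w)) powr p)) \<in> borel_measurable circ" by measurable
      then show ?thesis by (rule nn_integral_cmult)
    qed
    also have "\<dots> \<le> ennreal (norm (c - a) powr p) * ennreal (pmean p (deriv f) r powr p)"
      by (intro mult_left_mono nn_integral_powr_complex_dilation df p l u r) auto
    also have "\<dots> = ennreal ((norm (c - a) * pmean p (deriv f) r) powr p)"
      by (simp add: powr_mult pmean_nonneg ennreal_mult)
    finally show "(\<integral>\<^sup>+w. ennreal (K u w powr p) \<partial>circ) \<le> ennreal ((norm (c - a) * pmean p (deriv f) r) powr p)" .
  qed (use Ki in \<open>auto simp: K_def pmean_nonneg\<close>)
  also have "(LINT u|N. norm (c - a) * pmean p (deriv f) r) = norm (c - a) * pmean p (deriv f) r"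
  proof -
    have "measure N (space N) = 1" by (simp add: N_def space_restrict_space measure_restrict_space)
    then show ?thesis by simp
  qed
  finally show ?thesis .
qed

subsection \<open>Radial weights\<close>

text \<open>For a non-measurable function \<open>nn_integral\<close> is a lower integral. A maximal measurable minorant makes it
  linear on measurable multiples of the function, so the radial profile of a weight, about which only the
  integrability over the disc is known, need not be shown to be measurable.\<close>

lemma measurable_minorant:
  fixes w :: "'a \<Rightarrow> ennreal"
  assumes fin: "(\<integral>\<^sup>+x. w x \<partial>M) < \<infinity>"
  obtains v where "v \<in> borel_measurable M" "v \<le> w"
    "\<And>a. a \<in> borel_measurable M \<Longrightarrow> (\<And>x. a x < \<infinity>) \<Longrightarrow> (\<integral>\<^sup>+x. a x * w x \<partial>M) = (\<integral>\<^sup>+x. a x * v x \<partial>M)"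
proof -
  let ?S = "{g. simple_function M g \<and> g \<le> w}"
  have "?S \<noteq> {}" by (auto intro!: exI[of _ "\<lambda>_. 0"] simp: le_fun_def)
  then obtain I :: "nat \<Rightarrow> ennreal" where I: "range I \<subseteq> integral\<^sup>S M ` ?S" "(SUP g\<in>?S. integral\<^sup>S M g) = (SUP n. I n)"
    using ennreal_SUP_countable_SUP[of ?S "integral\<^sup>S M"] by (auto simp: image_comp)
  from I(1) have "\<forall>n. \<exists>g\<in>?S. I n = integral\<^sup>S M g" by auto
  then obtain s where s: "\<And>n. s n \<in> ?S" "\<And>n. I n = integral\<^sup>S M (s n)" by metis
  define v where "v x = (SUP n. s n x)" for x
  have sm: "s n \<in> borel_measurable M" for n using s(1)[of n] by (auto intro: borel_measurable_simple_function)
  have vm[measurable]: "v \<in> borel_measurable M" unfolding v_def using sm by measurable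
  have vw: "v \<le> w" unfolding v_def le_fun_def using s(1) by (auto intro!: SUP_least simp: le_fun_def)
  have wv: "(\<integral>\<^sup>+x. w x \<partial>M) = (\<integral>\<^sup>+x. v x \<partial>M)"
  proof (rule antisym)
    have "(\<integral>\<^sup>+x. w x \<partial>M) = (SUP n. I n)" unfolding nn_integral_def using I(2) by simp
    also have "\<dots> \<le> (\<integral>\<^sup>+x. v x \<partial>M)"
    proof (rule SUP_least)
      fix n
      have "I n = (\<integral>\<^sup>+x. s n x \<partial>M)" using s by (simp add: nn_integral_eq_simple_integral)
      also have "\<dots> \<le> (\<integral>\<^sup>+x. v x \<partial>M)" unfolding v_def by (intro nn_integral_mono SUP_upper) auto
      finally show "I n \<le> (\<integral>\<^sup>+x. v x \<partial>M)" .
    qed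
    finally show "(\<integral>\<^sup>+x. w x \<partial>M) \<le> (\<integral>\<^sup>+x. v x \<partial>M)" .
    show "(\<integral>\<^sup>+x. v x \<partial>M) \<le> (\<integral>\<^sup>+x. w x \<partial>M)" using vw by (intro nn_integral_mono) (auto simp: le_fun_def)
  qed
  \<comment> \<open>The maximum of \<open>v\<close> and \<open>g\<close> is again a minorant of
    \<open>w\<close>, so its integral does not exceed that of \<open>v\<close>; finiteness turns
    this into g <= v almost everywhere.\<close>
  have maximal: "AE x in M. g x \<le> v x" if g[measurable]: "g \<in> borel_measurable M" and gw: "g \<le> w" for g
  proof -
    have "(\<integral>\<^sup>+x. max (v x) (g x) \<partial>M) \<le> (\<integral>\<^sup>+x. v x \<partial>M)"
      unfolding wv[symmetric] using vw gw by (intro nn_integral_mono) (auto simp: le_fun_def)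
    then have "(\<integral>\<^sup>+x. max (v x) (g x) - v x \<partial>M) = 0"
      using fin by (subst nn_integral_diff) (auto simp: wv diff_eq_0_iff_ennreal less_top[symmetric] top_unique)
    then have "AE x in M. max (v x) (g x) - v x = 0"
      by (subst (asm) nn_integral_0_iff_AE) auto
    moreover have "AE x in M. v x \<noteq> \<infinity>"
      using fin by (intro nn_integral_PInf_AE vm) (simp add: wv)
    ultimately show ?thesis
      by eventually_elim (auto simp: diff_eq_0_iff_ennreal max_def split: if_splits)
  qed
  show ?thesis
  proof (rule that[OF vm vw])
    fix a :: "'a \<Rightarrow> ennreal" assume a[measurable]: "a \<in> borel_measurable M" and afin: "\<And>x. a x < \<infinity>"
    show "(\<integral>\<^sup>+x. a x * w x \<partial>M) = (\<integral>\<^sup>+x. a x * v x \<partial>M)"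
    proof (rule antisym)
      show "(\<integral>\<^sup>+x. a x * v x \<partial>M) \<le> (\<integral>\<^sup>+x. a x * w x \<partial>M)"
        using vw by (intro nn_integral_mono mult_left_mono) (auto simp: le_fun_def)
      show "(\<integral>\<^sup>+x. a x * w x \<partial>M) \<le> (\<integral>\<^sup>+x. a x * v x \<partial>M)"
        unfolding nn_integral_def[of M "\<lambda>x. a x * w x"]
      proof (rule SUP_least)
        fix g assume "g \<in> {g. simple_function M g \<and> g \<le> (\<lambda>x. a x * w x)}"
        then have g: "simple_function M g" "\<And>x. g x \<le> a x * w x" by (auto simp: le_fun_def)
        have [measurable]: "g \<in> borel_measurable M" using g(1) by (rule borel_measurable_simple_function)
        \<comment> \<open>A simple minorant of a w, divided by \<open>a\<close>, becomes a
          measurable minorant of \<open>w\<close>.\<close>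
        have "AE x in M. (if a x = 0 then 0 else g x / a x) \<le> v x"
        proof (rule maximal)
          show "(\<lambda>x. if a x = 0 then 0 else g x / a x) \<le> w"
          proof (rule le_funI)
            fix x
            show "(if a x = 0 then 0 else g x / a x) \<le> w x"
              using g(2)[of x] afin[of x] by (auto intro!: divide_le_posI_ennreal simp: mult.commute zero_less_iff_neq_zero)
          qed
        qed measurable
        then have "AE x in M. g x \<le> a x * v x"
        proof eventually_elim
          fix x assume le: "(if a x = 0 then 0 else g x / a x) \<le> v x"
          show "g x \<le> a x * v x"
          proof (cases "a x = 0")
            case False
            then have "a x * (g x / a x) \<le> a x * v x" using le by (intro mult_left_mono) auto
            moreover have "a x * (g x / a x) = g x"
              using False afin[of x] by (metis ennreal_times_divide infinity_ennreal_def less_irrefl mult.commute mult_divide_eq_ennreal)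
            ultimately show ?thesis by simp
          qed (use g(2)[of x] in simp)
        qed
        then have "(\<integral>\<^sup>+x. g x \<partial>M) \<le> (\<integral>\<^sup>+x. a x * v x \<partial>M)" by (rule nn_integral_mono_AE)
        then show "integral\<^sup>S M g \<le> (\<integral>\<^sup>+x. a x * v x \<partial>M)" using g(1) by (simp add: nn_integral_eq_simple_integral)
      qed
    qed
  qed
qed

text \<open>Polar coordinates: the distribution of the modulus on the disc and the density 2 pi r
  agree on all half-lines {x<..}, for 0 <= x < 1 with the value pi - pi x^2.\<close>

lemma nn_integral_ball_radial:
  fixes s :: "real \<Rightarrow> ennreal"
  assumes [measurable]: "s \<in> borel_measurable borel"
  shows "(\<integral>\<^sup>+z. s (norm z) * indicator (ball 0 1 :: complex set) z \<partial>lborel) = (\<integral>\<^sup>+r. s r * ennreal (2 * pi * r) * indicator {0<..<1} r \<partial>lborel)"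
proof -
  define M where "M = distr (density lborel (indicator (ball 0 1 :: complex set))) borel norm"
  define N where "N = density lborel (\<lambda>r::real. ennreal (2 * pi * r) * indicator {0<..<1} r)"
  have M: "emeasure M {x<..} = (if x < 1 then ennreal (pi - pi * (max x 0)\<^sup>2) else 0)" for x
  proof -
    have "emeasure M {x<..} = emeasure lborel ({z. x < norm z} \<inter> ball 0 1 :: complex set)"
    proof -
      have "{z::complex. x < norm z} \<in> sets borel" by (intro borel_open open_Collect_less continuous_intros)
      then show ?thesis
        unfolding M_def by (simp add: emeasure_distr vimage_def emeasure_restricted Int_commute)
    qed
    also have "\<dots> = (if x < 1 then ennreal (pi - pi * (max x 0)\<^sup>2) else 0)"
    proof (cases "0 \<le> x \<and> x < 1")
      case True
      have "({z. x < norm z} \<inter> ball 0 1 :: complex set) = ball 0 1 - cball 0 x" by auto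
      also have "emeasure lborel (ball 0 1 - cball 0 x :: complex set) = emeasure lborel (ball 0 1 :: complex set) - emeasure lborel (cball 0 x :: complex set)"
        using True by (intro emeasure_Diff) (auto simp: emeasure_cball)
      also have "\<dots> = ennreal pi - ennreal (pi * x\<^sup>2)"
        using True by (simp add: emeasure_ball emeasure_cball unit_ball_vol_2 DIM_complex)
      also have "\<dots> = ennreal (pi - pi * x\<^sup>2)" by (simp add: ennreal_minus)
      finally show ?thesis using True by (simp add: max_absorb1)
    next
      case False
      show ?thesis
      proof (cases "x < 1")
        case True
        with False have "x < 0" by simp
        then have "({z. x < norm z} \<inter> ball 0 1 :: complex set) = ball 0 1" by (auto intro: less_le_trans)
        then show ?thesis using True \<open>x < 0\<close> by (simp add: emeasure_ball unit_ball_vol_2 DIM_complex max_def)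
      next
        case False
        then have "({z. x < norm z} \<inter> ball 0 1 :: complex set) = {}" by auto
        then show ?thesis using False by simp
      qed
    qed
    finally show ?thesis .
  qed
  have N: "emeasure N {x<..} = (if x < 1 then ennreal (pi - pi * (max x 0)\<^sup>2) else 0)" for x
  proof (cases "x < 1")
    case True
    have "emeasure N {x<..} = (\<integral>\<^sup>+r. ennreal (2 * pi * r) * indicator {max x 0..1} r \<partial>lborel)"
      unfolding N_def using AE_lborel_singleton[of "max x 0"] AE_lborel_singleton[of 1]
      by (subst emeasure_density) (auto intro!: nn_integral_cong_AE simp: indicator_def)
    also have "\<dots> = ennreal (pi * 1\<^sup>2 - pi * (max x 0)\<^sup>2)"
      by (rule nn_integral_FTC_Icc) (use True in \<open>auto intro!: derivative_eq_intros\<close>)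
    finally show ?thesis using True by simp
  next
    case False
    then have "(\<lambda>r. ennreal (2 * pi * r) * indicator {0<..<1} r * indicator {x<..} r) = (\<lambda>_. 0)"
      by (auto simp: indicator_def fun_eq_iff)
    then show ?thesis using False unfolding N_def by (subst emeasure_density) simp_all
  qed
  have "M = N"
    by (rule measure_eqI_lessThan) (simp_all add: M N, simp_all add: M_def N_def)
  then have "(\<integral>\<^sup>+r. s r \<partial>M) = (\<integral>\<^sup>+r. s r \<partial>N)" by simp
  moreover have "(\<integral>\<^sup>+z. s (norm z) \<partial>density lborel (indicator (ball 0 1 :: complex set))) =
      (\<integral>\<^sup>+z. indicator (ball 0 1 :: complex set) z * s (norm z) \<partial>lborel)"
    using borel_measurable_indicator[of "ball 0 1 :: complex set" lborel]
    by (intro nn_integral_density) (simp_all add: measurable_lborel2)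
  ultimately show ?thesis
    unfolding M_def N_def
    by (simp add: nn_integral_distr nn_integral_density mult_ac)
qed

lemma tail_eq: "tail \<nu> r = (\<integral>\<^sup>+s\<in>{r..<1}. ennreal (\<nu> (of_real s)) \<partial>lborel)"
  unfolding tail_def by (rule nn_integral_completion)

text \<open>On [1/2, 1) the factor 2 s from polar coordinates is at least 1. The profile is not
  known to be measurable, so the comparison is made for the simple functions below it.\<close>

lemma tail_half_finite:
  assumes "weight \<nu>"
  shows "tail \<nu> (1/2) < \<infinity>"
proof -
  have int: "set_integrable lebesgue (ball 0 1) \<nu>" and nn: "\<And>z. z \<in> ball 0 1 \<Longrightarrow> 0 \<le> \<nu> z"
    and rad: "\<And>z. z \<in> ball 0 1 \<Longrightarrow> \<nu> z = \<nu> (of_real (norm z))"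
    using assms unfolding weight_def by blast+
  define J where "J = (\<integral>\<^sup>+z. ennreal (\<nu> z) * indicator (ball 0 1) z \<partial>lborel)"
  have "(\<integral>\<^sup>+z. ennreal (norm (indicator (ball 0 1) z *\<^sub>R \<nu> z)) \<partial>lebesgue) < \<infinity>"
    using int by (simp add: set_integrable_def integrable_iff_bounded)
  also have "(\<integral>\<^sup>+z. ennreal (norm (indicator (ball 0 1) z *\<^sub>R \<nu> z)) \<partial>lebesgue) = J"
    unfolding J_def nn_integral_completion using nn by (intro nn_integral_cong) (auto simp: indicator_def)
  finally have J: "J < \<infinity>" .
  have "tail \<nu> (1/2) \<le> ennreal (1 / pi) * J"
    unfolding tail_eq nn_integral_def[of _ "\<lambda>s. ennreal (\<nu> (of_real s)) * indicator {1/2..<1} s"]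
  proof (rule SUP_least)
    fix g assume "g \<in> {g. simple_function lborel g \<and> g \<le> (\<lambda>s. ennreal (\<nu> (of_real s)) * indicator {1/2..<1} s)}"
    then have g: "simple_function lborel g" "\<And>s. g s \<le> ennreal (\<nu> (of_real s)) * indicator {1/2..<1} s" by (auto simp: le_fun_def)
    have [measurable]: "g \<in> borel_measurable borel" using borel_measurable_simple_function[OF g(1)] by simp
    have "(\<integral>\<^sup>+s. g s \<partial>lborel) \<le> (\<integral>\<^sup>+s. ennreal (1/pi) * (g s * ennreal (2 * pi * s) * indicator {0<..<1} s) \<partial>lborel)"
    proof (intro nn_integral_mono)
      fix s :: real
      show "g s \<le> ennreal (1/pi) * (g s * ennreal (2 * pi * s) * indicator {0<..<1} s)"
      proof (cases "s \<in> {1/2..<1}")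
        case True
        have "g s * 1 \<le> g s * ennreal (2 * s)" using True by (intro mult_left_mono) (auto simp: ennreal_ge_1)
        also have "ennreal (2 * s) = ennreal (1/pi) * ennreal (2 * pi * s)"
          using True by (subst ennreal_mult[symmetric]) auto
        finally show ?thesis using True by (simp add: mult_ac)
      qed (use g(2)[of s] in simp)
    qed
    also have "\<dots> = ennreal (1/pi) * (\<integral>\<^sup>+s. g s * ennreal (2 * pi * s) * indicator {0<..<1} s \<partial>lborel)"
      by (rule nn_integral_cmult) measurable
    also have "\<dots> = ennreal (1/pi) * (\<integral>\<^sup>+z. g (norm z) * indicator (ball 0 1 :: complex set) z \<partial>lborel)"
      by (subst nn_integral_ball_radial) simp_all
    also have "\<dots> \<le> ennreal (1/pi) * J"
      unfolding J_def
    proof (intro mult_left_mono nn_integral_mono)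
      fix z :: complex
      show "g (norm z) * indicator (ball 0 1) z \<le> ennreal (\<nu> z) * indicator (ball 0 1) z"
      proof (cases "z \<in> ball 0 1")
        case True
        have "g (norm z) \<le> ennreal (\<nu> (of_real (norm z)))" using g(2)[of "norm z"] by (cases "norm z \<in> {1/2..<1}") auto
        then show ?thesis using rad[OF True] True by simp
      qed simp
    qed simp
    finally have "(\<integral>\<^sup>+s. g s \<partial>lborel) \<le> ennreal (1/pi) * J" .
    then show "integral\<^sup>S lborel g \<le> ennreal (1/pi) * J" using g(1) by (simp add: nn_integral_eq_simple_integral)
  qed
  also have "\<dots> < \<infinity>" using J by (simp add: ennreal_mult_less_top)
  finally show ?thesis .
qed

text \<open>The density is the maximal measurable minorant of the profile, so the measure represents
  integrals of nonnegative Borel functions against the profile. Finiteness at the origin is the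
  upper doubling condition at r = 0.\<close>

lemma radial_measure:
  assumes "\<nu> \<in> D_hat"
  shows "\<exists>\<mu> :: real measure. sets \<mu> = sets borel \<and> emeasure \<mu> {0..<1} < \<infinity> \<and>
    (\<forall>r\<in>{0..<1}. tail \<nu> r = emeasure \<mu> {r..<1}) \<and>
    (\<forall>a. set_borel_measurable borel {0..<1} a \<longrightarrow> (\<forall>r\<in>{0..<1}. 0 \<le> a r) \<longrightarrow>
      (\<integral>\<^sup>+r\<in>{0..<1}. ennreal (a r * \<nu> (of_real r)) \<partial>lebesgue) = (\<integral>\<^sup>+r\<in>{0..<1}. ennreal (a r) \<partial>\<mu>))"
proof -
  obtain C where wt: "weight \<nu>" and C: "\<And>r. r \<in> {0..<1} \<Longrightarrow> tail \<nu> r \<le> ennreal C * tail \<nu> ((1 + r) / 2)"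
    using assms unfolding D_hat_def by blast
  have nn: "\<And>z. z \<in> ball 0 1 \<Longrightarrow> 0 \<le> \<nu> z" using wt unfolding weight_def by blast
  define w where "w r = ennreal (\<nu> (of_real r)) * indicator {0..<1} r" for r :: real
  have "tail \<nu> 0 \<le> ennreal C * tail \<nu> (1/2)" using C[of 0] by simp
  also have "\<dots> < \<infinity>" using tail_half_finite[OF wt] by (simp add: ennreal_mult_less_top)
  finally have fin: "(\<integral>\<^sup>+r. w r \<partial>lborel) < \<infinity>" by (simp add: tail_eq w_def)
  obtain v where vm[measurable]: "v \<in> borel_measurable lborel" and vw: "v \<le> w"
    and v: "\<And>a. a \<in> borel_measurable lborel \<Longrightarrow> (\<And>x. a x < \<infinity>) \<Longrightarrow> (\<integral>\<^sup>+x. a x * w x \<partial>lborel) = (\<integral>\<^sup>+x. a x * v x \<partial>lborel)"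
    using measurable_minorant[OF fin] by metis
  have eq: "(\<integral>\<^sup>+x. a x * w x \<partial>lborel) = (\<integral>\<^sup>+x. a x \<partial>density lborel v)"
    if "a \<in> borel_measurable borel" "\<And>x. a x < \<infinity>" for a
    using v[of a] that by (simp add: nn_integral_density mult.commute)
  have t: "tail \<nu> r = emeasure (density lborel v) {r..<1}" if "r \<in> {0..<1}" for r
  proof -
    have "tail \<nu> r = (\<integral>\<^sup>+x. indicator {r..<1} x * w x \<partial>lborel)"
      unfolding tail_eq w_def using that by (intro nn_integral_cong) (auto simp: indicator_def)
    also have "\<dots> = (\<integral>\<^sup>+x. indicator {r..<1} x \<partial>density lborel v)"
      by (rule eq) (auto simp: indicator_def)
    finally show ?thesis by simp
  qed
  show ?thesis
  proof (intro exI[of _ "density lborel v"] conjI ballI allI impI t)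
    show "sets (density lborel v) = sets borel" by simp
    show "emeasure (density lborel v) {0..<1} < \<infinity>"
      using fin t[of 0] by (simp add: tail_eq w_def)
    fix a :: "real \<Rightarrow> real"
    assume m: "set_borel_measurable borel {0..<1} a" and a: "\<forall>r\<in>{0..<1}. 0 \<le> a r"
    have "(\<integral>\<^sup>+r\<in>{0..<1}. ennreal (a r * \<nu> (of_real r)) \<partial>lebesgue) = (\<integral>\<^sup>+r. ennreal (indicator {0..<1} r *\<^sub>R a r) * w r \<partial>lborel)"
      unfolding nn_integral_completion
    proof (intro nn_integral_cong)
      fix r :: real
      show "ennreal (a r * \<nu> (of_real r)) * indicator {0..<1} r = ennreal (indicator {0..<1} r *\<^sub>R a r) * w r"
        using a nn[of "of_real r"] by (auto simp: w_def indicator_def ennreal_mult)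
    qed
    also have "\<dots> = (\<integral>\<^sup>+r. ennreal (indicator {0..<1} r *\<^sub>R a r) \<partial>density lborel v)"
      using m unfolding set_borel_measurable_def by (intro eq) (auto simp del: real_scaleR_def)
    also have "\<dots> = (\<integral>\<^sup>+r\<in>{0..<1}. ennreal (a r) \<partial>density lborel v)"
      by (intro nn_integral_cong) (auto simp: indicator_def)
    finally show "(\<integral>\<^sup>+r\<in>{0..<1}. ennreal (a r * \<nu> (of_real r)) \<partial>lebesgue) = (\<integral>\<^sup>+r\<in>{0..<1}. ennreal (a r) \<partial>density lborel v)" .
  qed
qed

section \<open>Dyadic radii and the tail sequence of the weight\<close>

definition dyadic :: "nat \<Rightarrow> real" where "dyadic n = 1 - 1 / 2 ^ n"

lemma dyadic_0: "dyadic 0 = 0"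
  by (simp add: dyadic_def)

lemma dyadic: "0 \<le> dyadic n" "dyadic n < 1"
  by (auto simp: dyadic_def field_simps)

lemma dyadic_mono: "m \<le> n \<Longrightarrow> dyadic m \<le> dyadic n"
  by (auto simp: dyadic_def intro!: divide_left_mono power_increasing)

lemma dyadic_unbounded:
  assumes "r < 1"
  obtains n where "r < dyadic n"
proof -
  obtain n where "1 / (1 - r) < 2 ^ n" using real_arch_pow[of 2 "1 / (1 - r)"] by auto
  then have "r < dyadic n" using assms by (simp add: dyadic_def field_simps)
  then show ?thesis by (rule that)
qed

lemma dyadic_interval:
  assumes "0 \<le> r" "r < 1"
  obtains n where "dyadic n \<le> r" "r < dyadic (Suc n)"
proof -
  obtain N where N: "r < dyadic N" using dyadic_unbounded[OF assms(2)] .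
  define n where "n = (LEAST n. r < dyadic n)"
  have n: "r < dyadic n" unfolding n_def by (rule LeastI) (rule N)
  with assms(1) have "n \<noteq> 0" by (intro notI) (simp add: dyadic_0)
  then obtain k where k: "n = Suc k" by (cases n) auto
  then have "\<not> r < dyadic k" unfolding n_def by (metis lessI not_less_Least)
  with n k show ?thesis using that[of k] by auto
qed

lemma dyadic_interval_unique:
  assumes "dyadic n \<le> r" "r < dyadic (Suc n)" "dyadic m \<le> r" "r < dyadic (Suc m)"
  shows "n = m"
proof (rule ccontr)
  assume "n \<noteq> m"
  then have "Suc n \<le> m \<or> Suc m \<le> n" by auto
  then show False using dyadic_mono[of "Suc n" m] dyadic_mono[of "Suc m" n] assms by auto
qed

lemma one_minus_dyadic_powr: "(1 - dyadic n) powr q = 2 powr - (real n * q)"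
proof -
  have "1 - dyadic n = 2 powr - real n" by (simp add: dyadic_def powr_minus powr_realpow divide_inverse)
  then show ?thesis by (simp add: powr_powr)
qed

text \<open>The three conditions on the weight, sampled at dyadic radii. The later estimates see the
  weight through these facts and the representing measure.\<close>

lemma weight_sequence:
  assumes nu: "\<nu> \<in> D_two_sided \<inter> D_hat_sub q" and q: "0 < q"
    and mu: "sets \<mu> = sets borel" "emeasure \<mu> {0..<1} < \<infinity>" "\<And>r. r \<in> {0..<1} \<Longrightarrow> tail \<nu> r = emeasure \<mu> {r..<1}"
      "\<And>a :: real \<Rightarrow> real. set_borel_measurable borel {0..<1} a \<Longrightarrow> (\<And>r. r \<in> {0..<1} \<Longrightarrow> 0 \<le> a r) \<Longrightarrow>
      (\<integral>\<^sup>+r\<in>{0..<1}. ennreal (a r * \<nu> (of_real r)) \<partial>lebesgue) = (\<integral>\<^sup>+r\<in>{0..<1}. ennreal (a r) \<partial>\<mu>)"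
  defines "V \<equiv> \<lambda>n. measure \<mu> {dyadic n..<1}"
  shows "\<And>n. 0 < V n" "decseq V" "\<And>n. emeasure \<mu> {dyadic n..<dyadic (Suc n)} = ennreal (V n - V (n + 1))"
    "\<exists>c m. 1 < c \<and> 0 < m \<and> (\<forall>n. c * V (n + m) \<le> V n)"
    "\<exists>K>0. \<forall>n. (\<Sum>k<n. 2 powr (real k * q) * (V k - V (k + 1))) \<le> K * (2 powr (real n * q) * V n)"
    "\<exists>L>0. \<forall>n. V n \<le> L * V (Suc n)"
proof -
  have D1: "\<nu> \<in> D_hat" and D2: "\<nu> \<in> D_check" and D3: "\<nu> \<in> D_hat_sub q" using nu by (auto simp: D_two_sided_def)
  have wt: "weight \<nu>" using D1 by (simp add: D_hat_def)
  have sm[measurable]: "{a..<b} \<in> sets \<mu>" for a b :: real unfolding mu(1) by simp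
  have fin: "emeasure \<mu> A < \<infinity>" if "A \<subseteq> {0..<1}" for A
    using emeasure_mono[OF that sm] mu(2) by (rule le_less_trans)
  have sub: "{dyadic n..<1} \<subseteq> {0..<1}" for n using dyadic(1)[of n] by auto
  have tV: "tail \<nu> (dyadic n) = ennreal (V n)" for n
    using fin[OF sub[of n]] mu(3)[of "dyadic n"] dyadic[of n] by (simp add: V_def emeasure_eq_ennreal_measure)
  show V0: "0 < V n" for n
  proof -
    have "0 < tail \<nu> (dyadic n)" using wt dyadic[of n] unfolding weight_def by auto
    then show ?thesis by (simp add: tV)
  qed
  have tmono: "tail \<nu> s \<le> tail \<nu> r" if "0 \<le> r" "r \<le> s" "s < 1" for r s
    using that mu(3)[of r] mu(3)[of s] by (auto intro!: emeasure_mono)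
  show dec: "decseq V"
  proof (rule decseq_SucI)
    fix n
    have "tail \<nu> (dyadic (Suc n)) \<le> tail \<nu> (dyadic n)" by (intro tmono dyadic dyadic_mono) auto
    then show "V (Suc n) \<le> V n" using V0[of n] by (simp add: tV)
  qed
  show diff: "emeasure \<mu> {dyadic n..<dyadic (Suc n)} = ennreal (V n - V (n + 1))" for n
  proof -
    have "{dyadic n..<dyadic (Suc n)} = {dyadic n..<1} - {dyadic (Suc n)..<1}"
      using dyadic(2)[of "Suc n"] by auto
    moreover have "{dyadic (Suc n)..<1} \<subseteq> {dyadic n..<1}" using dyadic_mono[of n "Suc n"] by auto
    ultimately have "emeasure \<mu> {dyadic n..<dyadic (Suc n)} = emeasure \<mu> {dyadic n..<1} - emeasure \<mu> {dyadic (Suc n)..<1}"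
      using fin[OF sub[of "Suc n"]] by (simp add: emeasure_Diff)
    also have "\<dots> = ennreal (V n) - ennreal (V (Suc n))"
      using tV[of n] tV[of "Suc n"] mu(3) dyadic by simp
    also have "\<dots> = ennreal (V n - V (Suc n))" using V0[of "Suc n"] by (simp add: ennreal_minus)
    finally show ?thesis by simp
  qed
  show "\<exists>c m. 1 < c \<and> 0 < m \<and> (\<forall>n. c * V (n + m) \<le> V n)"
  proof -
    obtain K c where K: "1 < K" and c: "1 < c" and le: "\<And>r. r \<in> {0..<1} \<Longrightarrow> ennreal c * tail \<nu> (1 - (1 - r) / K) \<le> tail \<nu> r"
      using D2 unfolding D_check_def by blast
    \<comment> \<open>With 2^m > K the radius 1 - (1 - r) / K at r = \<open>dyadic n\<close> lies
      below \<open>dyadic (n + m)\<close>.\<close>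
    obtain m where m: "K < 2 ^ m" using real_arch_pow[of 2 K] by auto
    have "m \<noteq> 0" using m K by (intro notI) simp
    have "c * V (n + m) \<le> V n" for n
    proof -
      have rr: "0 \<le> 1 - (1 - dyadic n) / K" "1 - (1 - dyadic n) / K \<le> dyadic (n + m)"
      proof -
        have "(1 - dyadic n) / K \<le> 1 / 1" using dyadic[of n] K by (intro frac_le) auto
        then show "0 \<le> 1 - (1 - dyadic n) / K" by simp
        have "1 / 2 ^ n * (1 / 2 ^ m) \<le> 1 / 2 ^ n * (1 / K)"
          using m K by (intro mult_left_mono divide_left_mono) auto
        then show "1 - (1 - dyadic n) / K \<le> dyadic (n + m)" by (simp add: dyadic_def power_add)
      qed
      have "ennreal c * tail \<nu> (dyadic (n + m)) \<le> ennreal c * tail \<nu> (1 - (1 - dyadic n) / K)"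
        using rr dyadic by (intro mult_left_mono tmono) auto
      also have "\<dots> \<le> tail \<nu> (dyadic n)" using dyadic[of n] by (intro le) auto
      finally have "ennreal (c * V (n + m)) \<le> ennreal (V n)"
        using c V0[of "n + m"] by (simp add: tV ennreal_mult)
      then show ?thesis using V0[of n] by (subst (asm) ennreal_le_iff) auto
    qed
    then show ?thesis using c \<open>m \<noteq> 0\<close> by blast
  qed
  show "\<exists>L>0. \<forall>n. V n \<le> L * V (Suc n)"
  proof -
    obtain C where C: "C > 0" "\<And>r. r \<in> {0..<1} \<Longrightarrow> tail \<nu> r \<le> ennreal C * tail \<nu> ((1 + r) / 2)"
      using D1 unfolding D_hat_def by blast
    have "V n \<le> C * V (Suc n)" for n
    proof -
      have "(1 + dyadic n) / 2 = dyadic (Suc n)" by (simp add: dyadic_def field_simps)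
      then have "ennreal (V n) \<le> ennreal (C * V (Suc n))"
        using C(2)[of "dyadic n"] dyadic[of n] C(1) V0[of "Suc n"] by (simp add: tV ennreal_mult)
      then show ?thesis using C(1) V0[of "Suc n"] by (subst (asm) ennreal_le_iff) auto
    qed
    then show ?thesis using C(1) by blast
  qed
  show "\<exists>K>0. \<forall>n. (\<Sum>k<n. 2 powr (real k * q) * (V k - V (k + 1))) \<le> K * (2 powr (real n * q) * V n)"
  proof -
    define T where "T r = ennreal ((1 - r) powr q) / tail \<nu> r *
        (\<integral>\<^sup>+s\<in>{0..<r}. ennreal (\<nu> (of_real s) / (1 - s) powr q) \<partial>lebesgue)" for r
    have "(SUP r\<in>{0..<1}. T r) < \<infinity>" using D3 by (simp add: D_hat_sub_def T_def)
    then obtain S where S: "(SUP r\<in>{0..<1}. T r) = ennreal S" "S \<ge> 0"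
      by (cases "SUP r\<in>{0..<1}. T r") auto
    have TS: "T r \<le> ennreal S" if "r \<in> {0..<1}" for r
      unfolding S(1)[symmetric] using that by (rule SUP_upper)
    \<comment> \<open>On the k-th ring (1 - s)^-q is at least 2^(k q), so the sum is a lower bound
      for the integral in the condition; \<open>S + 1\<close> makes the constant positive.\<close>
    have "(\<Sum>k<n. 2 powr (real k * q) * (V k - V (k + 1))) \<le> (S + 1) * (2 powr (real n * q) * V n)" for n
    proof -
      define I where "I = (\<integral>\<^sup>+s\<in>{0..<dyadic n}. ennreal (\<nu> (of_real s) / (1 - s) powr q) \<partial>lebesgue)"
      define a where "a s = indicator {0..<dyadic n} s * (1 - s) powr (- q)" for s :: real
      have "(\<lambda>s. indicator {0..<1} s *\<^sub>R a s) \<in> borel_measurable borel" unfolding a_def by measurable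
      then have am: "set_borel_measurable borel {0..<1} a" by (simp add: set_borel_measurable_def)
      have "I = (\<integral>\<^sup>+r\<in>{0..<1}. ennreal (a r * \<nu> (of_real r)) \<partial>lebesgue)"
        unfolding I_def a_def using dyadic(2)[of n]
        by (intro nn_integral_cong) (auto simp: indicator_def powr_minus divide_inverse mult.commute)
      also have "\<dots> = (\<integral>\<^sup>+r\<in>{0..<1}. ennreal (a r) \<partial>\<mu>)"
        by (rule mu(4)[OF am]) (simp add: a_def)
      finally have Ieq: "I = (\<integral>\<^sup>+r\<in>{0..<1}. ennreal (a r) \<partial>\<mu>)" .
      have "(\<Sum>k<n. ennreal (2 powr (real k * q)) * emeasure \<mu> {dyadic k..<dyadic (Suc k)})
         = (\<integral>\<^sup>+r. (\<Sum>k<n. ennreal (2 powr (real k * q)) * indicator {dyadic k..<dyadic (Suc k)} r) \<partial>\<mu>)"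
        by (subst nn_integral_sum) (auto simp: nn_integral_cmult_indicator)
      also have "\<dots> \<le> I"
        unfolding Ieq
      proof (intro nn_integral_mono)
        fix r :: real
        show "(\<Sum>k<n. ennreal (2 powr (real k * q)) * indicator {dyadic k..<dyadic (Suc k)} r) \<le> ennreal (a r) * indicator {0..<1} r"
        proof (cases "\<exists>k<n. r \<in> {dyadic k..<dyadic (Suc k)}")
          case True
          then obtain k where k: "k < n" "r \<in> {dyadic k..<dyadic (Suc k)}" by blast
          have "(\<Sum>j<n. ennreal (2 powr (real j * q)) * indicator {dyadic j..<dyadic (Suc j)} r) = (\<Sum>j\<in>{k}. ennreal (2 powr (real j * q)) * indicator {dyadic j..<dyadic (Suc j)} r)"
            using k dyadic_interval_unique[of k r] by (intro sum.mono_neutral_right) (auto simp: indicator_def)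
          also have "\<dots> = ennreal (2 powr (real k * q))" using k by simp
          also have "\<dots> \<le> ennreal ((1 - r) powr (- q))"
          proof (rule ennreal_leI)
            have "2 powr (real k * q) = (1 - dyadic k) powr (- q)" by (simp add: one_minus_dyadic_powr)
            also have "\<dots> \<le> (1 - r) powr (- q)"
              using k(2) q dyadic(2)[of "Suc k"] by (intro powr_mono2') auto
            finally show "2 powr (real k * q) \<le> (1 - r) powr (- q)" .
          qed
          also have "\<dots> = ennreal (a r) * indicator {0..<1} r"
          proof -
            have "r < dyadic n" using k dyadic_mono[of "Suc k" n] by auto
            moreover have "0 \<le> r" "r < 1" using k(2) dyadic(1)[of k] dyadic(2)[of "Suc k"] by auto
            ultimately show ?thesis by (simp add: a_def)
          qed
          finally show ?thesis .
        next
          case False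
          then have "(\<Sum>k<n. ennreal (2 powr (real k * q)) * indicator {dyadic k..<dyadic (Suc k)} r) = 0"
            by (intro sum.neutral) auto
          then show ?thesis by simp
        qed
      qed
      also have "I \<le> ennreal (S * (2 powr (real n * q) * V n))"
      proof -
        have "T (dyadic n) = ennreal (2 powr - (real n * q)) / ennreal (V n) * I"
          by (simp add: T_def I_def tV one_minus_dyadic_powr)
        also have "ennreal (2 powr - (real n * q)) / ennreal (V n) = ennreal (2 powr - (real n * q) / V n)"
          using V0[of n] by (simp add: divide_ennreal)
        finally have "ennreal (2 powr - (real n * q) / V n) * I \<le> ennreal S"
          using TS[of "dyadic n"] dyadic[of n] by simp
        then have "ennreal (V n * 2 powr (real n * q)) * (ennreal (2 powr - (real n * q) / V n) * I) \<le> ennreal (V n * 2 powr (real n * q)) * ennreal S"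
          by (rule mult_left_mono) simp
        also have "ennreal (V n * 2 powr (real n * q)) * (ennreal (2 powr - (real n * q) / V n) * I) = I"
        proof -
          have "ennreal (V n * 2 powr (real n * q)) * ennreal (2 powr - (real n * q) / V n) = ennreal 1"
            using V0[of n] by (subst ennreal_mult[symmetric]) (auto simp: powr_minus field_simps)
          then show ?thesis by (simp add: mult.assoc[symmetric])
        qed
        finally show ?thesis using V0[of n] S(2) by (simp add: ennreal_mult mult_ac)
      qed
      finally have "(\<Sum>k<n. ennreal (2 powr (real k * q)) * emeasure \<mu> {dyadic k..<dyadic (Suc k)}) \<le> ennreal (S * (2 powr (real n * q) * V n))" .
      moreover have "(\<Sum>k<n. ennreal (2 powr (real k * q)) * emeasure \<mu> {dyadic k..<dyadic (Suc k)}) = ennreal (\<Sum>k<n. 2 powr (real k * q) * (V k - V (k + 1)))"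
        unfolding diff using dec by (subst sum_ennreal[symmetric]) (auto simp: ennreal_mult decseqD)
      ultimately have "(\<Sum>k<n. 2 powr (real k * q) * (V k - V (k + 1))) \<le> S * (2 powr (real n * q) * V n)"
        using S(2) V0[of n] by (simp add: ennreal_le_iff)
      also have "\<dots> \<le> (S + 1) * (2 powr (real n * q) * V n)" using V0[of n] by (intro mult_right_mono) auto
      finally show ?thesis .
    qed
    moreover have "S + 1 > 0" using S(2) by simp
    ultimately show ?thesis by blast
  qed
qed

subsection \<open>A weighted discrete Hardy inequality\<close>

text \<open>The distance |n - k|: at least one of the two truncated differences is 0.\<close>

definition ndist :: "nat \<Rightarrow> nat \<Rightarrow> nat" where "ndist n k = (n - k) + (k - n)"

lemma ndist_commute: "ndist n k = ndist k n"
  by (simp add: ndist_def)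

text \<open>Induction on \<open>n\<close>: shifting both indices by one preserves the distance, and
  only the term at index 0 is new.\<close>

lemma sum_power_ndist_le:
  fixes \<theta> :: real
  assumes t: "0 \<le> \<theta>" "\<theta> < 1"
  shows "(\<Sum>k<K. \<theta> ^ ndist n k) \<le> 2 / (1 - \<theta>)"
proof -
  have geo: "(\<Sum>i<K. \<theta> ^ i) \<le> 1 / (1 - \<theta>)" for K
  proof -
    have "(\<Sum>i<K. \<theta> ^ i) = (1 - \<theta> ^ K) / (1 - \<theta>)" using t by (simp add: sum_gp_strict)
    also have "\<dots> \<le> 1 / (1 - \<theta>)" using t by (intro divide_right_mono) auto
    finally show ?thesis .
  qed
  have "(\<Sum>k<K. \<theta> ^ ndist n k) \<le> (\<Sum>i<n. \<theta> ^ Suc i) + 1 / (1 - \<theta>)"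
  proof (induction n arbitrary: K)
    case 0
    show ?case using geo[of K] by (simp add: ndist_def)
  next
    case (Suc n)
    show ?case
    proof (cases K)
      case 0
      then show ?thesis using t by (auto intro!: add_nonneg_nonneg sum_nonneg)
    next
      case (Suc K')
      have "(\<Sum>k<K. \<theta> ^ ndist (Suc n) k) = \<theta> ^ Suc n + (\<Sum>k<K'. \<theta> ^ ndist n k)"
        unfolding Suc by (subst sum.lessThan_Suc_shift) (simp add: ndist_def)
      also have "\<dots> \<le> \<theta> ^ Suc n + ((\<Sum>i<n. \<theta> ^ Suc i) + 1 / (1 - \<theta>))"
        using Suc.IH by simp
      finally show ?thesis by simp
    qed
  qed
  also have "(\<Sum>i<n. \<theta> ^ Suc i) \<le> (\<Sum>i<n. \<theta> ^ i)"
    using t by (intro sum_mono) (simp add: mult_left_le_one_le)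
  also have "(\<Sum>i<n. \<theta> ^ i) \<le> 1 / (1 - \<theta>)" by (rule geo)
  finally show ?thesis by simp
qed

lemma summable_power_ndist:
  fixes \<theta> :: real
  assumes "0 \<le> \<theta>" "\<theta> < 1"
  shows "summable (\<lambda>k. \<theta> ^ ndist n k)" "(\<Sum>k. \<theta> ^ ndist n k) \<le> 2 / (1 - \<theta>)"
proof -
  show s: "summable (\<lambda>k. \<theta> ^ ndist n k)"
    using assms sum_power_ndist_le[OF assms]
    by (intro summableI_nonneg_bounded[where x = "2 / (1 - \<theta>)"]) auto
  show "(\<Sum>k. \<theta> ^ ndist n k) \<le> 2 / (1 - \<theta>)"
    using sum_power_ndist_le[OF assms] by (intro suminf_le_const s) auto
qed

text \<open>Splitting the kernel as a product of two square roots, one factor absorbs a supremum, which after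
  taking \<open>q\<close>-th powers is at most a sum. This avoids distinguishing \<open>q < 1\<close> and \<open>q \<ge> 1\<close>.\<close>

lemma geometric_kernel_bound:
  fixes \<eta> q :: real
  assumes eta: "0 < \<eta>" "\<eta> < 1" and q: "0 < q"
  shows "\<exists>C>0. \<forall>y X. (\<forall>k. 0 \<le> y k) \<longrightarrow> (\<forall>N. (\<Sum>k<N. y k powr q) \<le> X) \<longrightarrow>
    (\<forall>n. summable (\<lambda>k. \<eta> ^ ndist n k * y k)) \<and> (\<forall>N. (\<Sum>n<N. (\<Sum>k. \<eta> ^ ndist n k * y k) powr q) \<le> C * X)"
proof -
  define \<theta> where "\<theta> = sqrt \<eta>"
  have t: "0 < \<theta>" "\<theta> < 1" and tt: "\<theta> * \<theta> = \<eta>" using eta by (auto simp: \<theta>_def)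
  define \<tau> where "\<tau> = \<theta> powr q"
  have u: "0 < \<tau>" "\<tau> < 1" using t q powr_less_mono2[of q \<theta> 1] by (auto simp: \<tau>_def)
  define D where "D = 2 / (1 - \<theta>)"
  have D: "D > 0" using t by (simp add: D_def)
  define C where "C = D powr q * (2 / (1 - \<tau>))"
  have main: "summable (\<lambda>k. \<eta> ^ ndist n k * y k) \<and>
      (\<Sum>k. \<eta> ^ ndist n k * y k) powr q \<le> D powr q * (\<Sum>k. \<tau> ^ ndist n k * y k powr q) \<and>
      summable (\<lambda>k. \<tau> ^ ndist n k * y k powr q)"
    if y: "\<And>k. 0 \<le> y k" and X: "\<And>N. (\<Sum>k<N. y k powr q) \<le> X" for y X n
  proof -
    have sy: "summable (\<lambda>k. y k powr q)" by (rule summableI_nonneg_bounded[OF _ X]) simp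
    have sZ: "summable (\<lambda>k. \<tau> ^ ndist n k * y k powr q)"
      using u by (intro summable_comparison_test'[OF sy]) (auto simp: power_le_one intro!: mult_left_le_one_le)
    define Z where "Z = (\<Sum>k. \<tau> ^ ndist n k * y k powr q)"
    have Z0: "0 \<le> Z" unfolding Z_def using u by (intro suminf_nonneg sZ) auto
    \<comment> \<open>A single term of the series for \<open>Z\<close>, after a q-th root: the
      supremum bounded by the sum.\<close>
    have le: "\<theta> ^ ndist n k * y k \<le> Z powr (1/q)" for k
    proof -
      have "(\<theta> ^ ndist n k * y k) powr q = \<tau> ^ ndist n k * y k powr q"
      proof -
        have "(\<theta> ^ ndist n k) powr q = \<tau> ^ ndist n k"
          using t u(1) by (simp add: \<tau>_def powr_powr mult.commute flip: powr_realpow)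
        then show ?thesis using t y by (simp add: powr_mult)
      qed
      also have "\<dots> \<le> Z" unfolding Z_def
        using sum_le_suminf[OF sZ, of "{k}"] u by simp
      finally have "((\<theta> ^ ndist n k * y k) powr q) powr (1/q) \<le> Z powr (1/q)"
        using q by (intro powr_mono2) auto
      then show ?thesis using q t y[of k] by (simp add: powr_powr)
    qed
    have trm: "\<eta> ^ ndist n k * y k \<le> \<theta> ^ ndist n k * Z powr (1/q)" for k
    proof -
      have "\<eta> ^ ndist n k * y k = \<theta> ^ ndist n k * (\<theta> ^ ndist n k * y k)"
        by (simp add: power_mult_distrib flip: tt)
      also have "\<dots> \<le> \<theta> ^ ndist n k * Z powr (1/q)"
        using t by (intro mult_left_mono le) auto
      finally show ?thesis .
    qed
    have st: "summable (\<lambda>k. \<theta> ^ ndist n k * Z powr (1/q))"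
      using t by (intro summable_mult2 summable_power_ndist) auto
    have s: "summable (\<lambda>k. \<eta> ^ ndist n k * y k)"
      using trm eta y by (intro summable_comparison_test'[OF st]) auto
    have "(\<Sum>k. \<eta> ^ ndist n k * y k) \<le> (\<Sum>k. \<theta> ^ ndist n k * Z powr (1/q))"
      by (intro suminf_le trm s st)
    also have "\<dots> = (\<Sum>k. \<theta> ^ ndist n k) * Z powr (1/q)"
      using t by (intro suminf_mult2[symmetric] summable_power_ndist) auto
    also have "\<dots> \<le> D * Z powr (1/q)"
      unfolding D_def using t by (intro mult_right_mono summable_power_ndist) auto
    finally have "(\<Sum>k. \<eta> ^ ndist n k * y k) powr q \<le> (D * Z powr (1/q)) powr q"
      using q eta y by (intro powr_mono2 suminf_nonneg s) auto
    also have "\<dots> = D powr q * Z" using D q Z0 by (simp add: powr_mult powr_powr)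
    finally show ?thesis using s sZ by (simp add: Z_def)
  qed
  show ?thesis
  proof (intro exI[of _ C] conjI allI impI)
    show "C > 0" using D u by (simp add: C_def)
    fix y :: "nat \<Rightarrow> real" and X :: real
    assume "\<forall>k. 0 \<le> y k" and "\<forall>N. (\<Sum>k<N. y k powr q) \<le> X"
    then have y: "\<And>k. 0 \<le> y k" and X: "\<And>N. (\<Sum>k<N. y k powr q) \<le> X" by auto
    show "summable (\<lambda>k. \<eta> ^ ndist n k * y k)" for n using main[OF y X] by blast
    fix N
    have sy: "summable (\<lambda>k. y k powr q)" by (rule summableI_nonneg_bounded[OF _ X]) simp
    have sZ: "summable (\<lambda>k. \<tau> ^ ndist n k * y k powr q)" for n using main[OF y X] by blast
    have "(\<Sum>n<N. (\<Sum>k. \<eta> ^ ndist n k * y k) powr q) \<le> (\<Sum>n<N. D powr q * (\<Sum>k. \<tau> ^ ndist n k * y k powr q))"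
      using main[OF y X] by (intro sum_mono) blast
    also have "\<dots> = D powr q * (\<Sum>n<N. (\<Sum>k. \<tau> ^ ndist n k * y k powr q))"
      by (rule sum_distrib_left[symmetric])
    \<comment> \<open>The remaining kernel is summed over \<open>n\<close> first; by symmetry this
      obeys the same bound as a sum over \<open>k\<close>.\<close>
    also have "(\<Sum>n<N. (\<Sum>k. \<tau> ^ ndist n k * y k powr q)) = (\<Sum>k. \<Sum>n<N. \<tau> ^ ndist n k * y k powr q)"
      by (intro suminf_sum[symmetric] sZ)
    also have "\<dots> = (\<Sum>k. (\<Sum>n<N. \<tau> ^ ndist k n) * y k powr q)"
      by (simp add: sum_distrib_right ndist_commute)
    also have "\<dots> \<le> (\<Sum>k. (2 / (1 - \<tau>)) * y k powr q)"
    proof (intro suminf_le mult_right_mono sum_power_ndist_le summable_mult sy)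
      show "summable (\<lambda>k. (\<Sum>n<N. \<tau> ^ ndist k n) * y k powr q)"
      proof (rule summable_comparison_test'[OF summable_mult[OF sy, of "2 / (1 - \<tau>)"], of 0])
        fix k
        have "(\<Sum>n<N. \<tau> ^ ndist k n) * y k powr q \<le> 2 / (1 - \<tau>) * y k powr q"
          using u by (intro mult_right_mono sum_power_ndist_le) auto
        then show "norm ((\<Sum>n<N. \<tau> ^ ndist k n) * y k powr q) \<le> 2 / (1 - \<tau>) * y k powr q"
          using u by (simp add: abs_mult sum_nonneg)
      qed
    qed (use u in auto)
    also have "\<dots> = (2 / (1 - \<tau>)) * (\<Sum>k. y k powr q)" by (intro suminf_mult sy)
    also have "\<dots> \<le> (2 / (1 - \<tau>)) * X"
      using u X by (intro mult_left_mono suminf_le_const sy) auto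
    finally show "(\<Sum>n<N. (\<Sum>k. \<eta> ^ ndist n k * y k) powr q) \<le> C * X"
      by (simp add: C_def mult_left_mono mult.assoc)
  qed
qed

text \<open>Iteration in steps of \<open>m\<close>, with ratio the m-th root of 1 / c; the constant
  \<open>c\<close> absorbs the incomplete last step.\<close>

lemma weight_sequence_decay:
  fixes V :: "nat \<Rightarrow> real"
  assumes V: "\<And>n. 0 < V n" "decseq V" and m: "0 < m" and c: "1 < c" "\<And>n. c * V (n + m) \<le> V n"
  obtains \<mu> A where "0 < \<mu>" "\<mu> < 1" "0 < A" "\<And>n i. V (n + i) \<le> A * \<mu> ^ i * V n"
proof -
  define \<mu> where "\<mu> = (1/c) powr (1 / real m)"
  have l: "0 < \<mu>" "\<mu> < 1" using c m powr_less_mono2[of "1 / real m" "1/c" 1] by (auto simp: \<mu>_def)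
  have lm: "\<mu> ^ m = 1 / c"
    using c m by (simp add: \<mu>_def powr_powr flip: powr_realpow)
  have "V (n + i) \<le> c * \<mu> ^ i * V n" for n i
  proof (induction i rule: less_induct)
    case (less i)
    show ?case
    proof (cases "i < m")
      case True
      have "1 = c * \<mu> ^ m" using c by (simp add: lm)
      also have "\<dots> \<le> c * \<mu> ^ i" using c l True by (intro mult_left_mono power_decreasing) auto
      finally have "1 * V n \<le> c * \<mu> ^ i * V n" using V(1)[of n] by (intro mult_right_mono) auto
      moreover have "V (n + i) \<le> V n" using V(2) by (simp add: decseqD)
      ultimately show ?thesis by simp
    next
      case False
      then have i: "i = (i - m) + m" by simp
      have "c * V (n + i) \<le> V (n + (i - m))" using c(2)[of "n + (i - m)"] i by (simp add: add.assoc)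
      also have "\<dots> \<le> c * \<mu> ^ (i - m) * V n" using False m by (intro less.IH) auto
      finally have "V (n + i) \<le> \<mu> ^ m * (c * \<mu> ^ (i - m) * V n)"
        using c by (simp add: lm field_simps)
      also have "\<dots> = c * \<mu> ^ ((i - m) + m) * V n" by (simp add: power_add)
      finally show ?thesis using i by simp
    qed
  qed
  then show ?thesis using that[of \<mu> c] l c by auto
qed

text \<open>At least the share 1 - 1 / c of the tail is used up within the next \<open>m\<close>
  rings.\<close>

lemma weight_sequence_tail_le:
  fixes V :: "nat \<Rightarrow> real"
  assumes c: "1 < c" "c * V (n + m) \<le> V n"
  shows "V n \<le> c / (c - 1) * (\<Sum>i<m. V (n + i) - V (n + i + 1))"
proof -
  have eq: "(\<Sum>i<m. V (n + i) - V (n + i + 1)) = V n - V (n + m)"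
    by (induction m) auto
  have "V n * (c - 1) \<le> c * (V n - V (n + m))" using c by (simp add: algebra_simps)
  then have "V n \<le> c * (V n - V (n + m)) / (c - 1)" using c by (simp add: pos_le_divide_eq)
  then show ?thesis unfolding eq by simp
qed

text \<open>If the partial sums s_n of a positive sequence are at most \<open>B\<close> times the
  last term, they grow geometrically: s_n <= (1 - 1 / B) s_(n+1). For W_n = 2^(n q) V_n this
  hypothesis follows by replacing V with \<open>m\<close> of its increments and using the bound
  \<open>K\<close>.\<close>

lemma weight_sequence_growth:
  fixes V :: "nat \<Rightarrow> real" and q :: real
  assumes V: "\<And>n. 0 < V n" "decseq V" and c: "1 < c" "\<And>n. c * V (n + m) \<le> V n" and q: "0 < q"
    and K: "0 < K" "\<And>n. (\<Sum>k<n. 2 powr (real k * q) * (V k - V (k + 1))) \<le> K * (2 powr (real n * q) * V n)"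
  obtains \<kappa> A where "0 < \<kappa>" "\<kappa> < 1" "0 < A"
    "\<And>n i. 2 powr (real n * q) * V n \<le> A * \<kappa> ^ i * (2 powr (real (n + i) * q) * V (n + i))"
proof -
  define W where "W n = 2 powr (real n * q) * V n" for n
  define d where "d k = V k - V (k + 1)" for k
  have d0: "0 \<le> d k" for k using V(2) by (simp add: d_def decseqD)
  have W0: "0 < W n" for n using V(1) by (simp add: W_def)
  define s where "s n = (\<Sum>k\<le>n. W k)" for n
  define c' where "c' = c / (c - 1)"
  have c'0: "c' > 0" using c by (simp add: c'_def)
  \<comment> \<open>The summand 2 ensures B > 1, so that \<kappa> will lie in (0, 1).\<close>
  define B where "B = c' * real m * K * 2 powr (real m * q) + 2"
  have "0 \<le> c' * real m * K * 2 powr (real m * q)" using c'0 K(1) by (intro mult_nonneg_nonneg) auto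
  then have B: "B > 1" by (simp add: B_def)
  have sB: "s n \<le> B * W n" for n
  proof -
    have "s n \<le> (\<Sum>k\<le>n. c' * (\<Sum>i<m. 2 powr (real (k + i) * q) * d (k + i)))"
      unfolding s_def
    proof (intro sum_mono)
      fix k
      have "W k \<le> 2 powr (real k * q) * (c' * (\<Sum>i<m. d (k + i)))"
        unfolding W_def c'_def d_def using weight_sequence_tail_le[of c V k m] c by (intro mult_left_mono) auto
      also have "\<dots> = c' * (\<Sum>i<m. 2 powr (real k * q) * d (k + i))" by (simp add: sum_distrib_left mult_ac)
      also have "\<dots> \<le> c' * (\<Sum>i<m. 2 powr (real (k + i) * q) * d (k + i))"
        using c'0 q d0 by (intro mult_left_mono sum_mono mult_right_mono powr_mono) auto
      finally show "W k \<le> c' * (\<Sum>i<m. 2 powr (real (k + i) * q) * d (k + i))" .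
    qed
    also have "\<dots> = c' * (\<Sum>i<m. \<Sum>k\<le>n. 2 powr (real (k + i) * q) * d (k + i))"
      by (subst sum.swap) (simp add: sum_distrib_left)
    also have "\<dots> \<le> c' * (\<Sum>i<m. K * W (n + m))"
    proof (intro mult_left_mono sum_mono)
      fix i assume i: "i \<in> {..<m}"
      have "(\<Sum>k\<le>n. 2 powr (real (k + i) * q) * d (k + i)) = (\<Sum>k\<in>(\<lambda>k. k + i) ` {..n}. 2 powr (real k * q) * d k)"
        by (subst sum.reindex) (auto simp: inj_on_def)
      also have "\<dots> \<le> (\<Sum>k<n+m. 2 powr (real k * q) * d k)"
        using i d0 by (intro sum_mono2) auto
      also have "\<dots> \<le> K * W (n + m)" using K(2)[of "n + m"] by (simp add: d_def W_def)
      finally show "(\<Sum>k\<le>n. 2 powr (real (k + i) * q) * d (k + i)) \<le> K * W (n + m)" .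
    qed (use c'0 in auto)
    also have "\<dots> = c' * real m * K * W (n + m)" by simp
    also have "W (n + m) \<le> 2 powr (real m * q) * W n"
    proof -
      have "W (n + m) = 2 powr (real m * q) * (2 powr (real n * q) * V (n + m))"
        by (simp add: W_def powr_add algebra_simps)
      also have "\<dots> \<le> 2 powr (real m * q) * (2 powr (real n * q) * V n)"
        using V(2) by (intro mult_left_mono) (auto simp: decseqD)
      finally show ?thesis by (simp add: W_def)
    qed
    then have "c' * real m * K * W (n + m) \<le> c' * real m * K * (2 powr (real m * q) * W n)"
      using c'0 K by (intro mult_left_mono) auto
    also have "\<dots> \<le> B * W n" using W0[of n] by (simp add: B_def algebra_simps)
    finally show ?thesis .
  qed
  define \<kappa> where "\<kappa> = 1 - 1 / B"
  have k: "0 < \<kappa>" "\<kappa> < 1" using B by (auto simp: \<kappa>_def)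
  have step: "s n \<le> \<kappa> * s (Suc n)" for n
  proof -
    have "s (Suc n) = s n + W (Suc n)" by (simp add: s_def)
    moreover have "s (Suc n) / B \<le> W (Suc n)" using sB[of "Suc n"] B by (simp add: field_simps)
    ultimately show ?thesis by (simp add: \<kappa>_def left_diff_distrib)
  qed
  have "s n \<le> \<kappa> ^ i * s (n + i)" for n i
  proof (induction i)
    case (Suc i)
    note Suc
    also have "\<kappa> ^ i * s (n + i) \<le> \<kappa> ^ i * (\<kappa> * s (Suc (n + i)))"
      using k by (intro mult_left_mono step) auto
    finally show ?case by (simp add: mult_ac)
  qed simp
  then have "W n \<le> B * \<kappa> ^ i * W (n + i)" for n i
  proof -
    have "W n \<le> s n" unfolding s_def using W0 by (intro member_le_sum) (auto intro: less_imp_le)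
    also have "\<dots> \<le> \<kappa> ^ i * s (n + i)" by fact
    also have "\<dots> \<le> \<kappa> ^ i * (B * W (n + i))" using k by (intro mult_left_mono sB) auto
    finally show ?thesis by (simp add: mult_ac)
  qed
  then show ?thesis using that[of \<kappa> B] k B by (auto simp: W_def)
qed

text \<open>Exchanged, the double sum is a sum over \<open>k\<close> with coefficients at most
  2^-(k-n) for k > n and 1 otherwise. Conjugated by e_n = V_n^(1/q), this kernel is dominated by a
  geometric one in |n - k|: by decay of V for k <= n, by growth of 2^(n q) V_n for k > n. As
  \<open>M\<close> increases, sums against V are bounded by sums against its increments.\<close>

lemma weighted_hardy_inequality:
  fixes V :: "nat \<Rightarrow> real" and q :: real
  assumes V: "\<And>n. 0 < V n" "decseq V" and c: "1 < c" "0 < m" "\<And>n. c * V (n + m) \<le> V n" and q: "0 < q"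
    and K: "0 < K" "\<And>n. (\<Sum>k<n. 2 powr (real k * q) * (V k - V (k + 1))) \<le> K * (2 powr (real n * q) * V n)"
    and L: "0 < L" "\<And>n. V n \<le> L * V (Suc n)"
  shows "\<exists>C>0. \<forall>M X N. (\<forall>n. 0 \<le> M n) \<longrightarrow> incseq M \<longrightarrow> (\<forall>N. (\<Sum>n<N. M n powr q * (V n - V (n + 1))) \<le> X) \<longrightarrow>
      summable (\<lambda>k. M (Suc k) / 2 ^ Suc k) \<and>
      (\<Sum>n<N. (\<Sum>j\<le>n. 2 ^ j * (\<Sum>k. if j \<le> k then M (Suc k) / 2 ^ Suc k else 0)) powr q * (V n - V (n + 1))) \<le> C * X"
proof -
  obtain \<mu> A1 where mu: "0 < \<mu>" "\<mu> < 1" "0 < A1" "\<And>n i. V (n + i) \<le> A1 * \<mu> ^ i * V n"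
    using weight_sequence_decay[OF V c(2,1,3)] by blast
  obtain \<kappa> A2 where ka: "0 < \<kappa>" "\<kappa> < 1" "0 < A2"
    "\<And>n i. 2 powr (real n * q) * V n \<le> A2 * \<kappa> ^ i * (2 powr (real (n + i) * q) * V (n + i))"
    using weight_sequence_growth[OF V c(1,3) q K] by blast
  define \<nu> where "\<nu> = max \<mu> \<kappa>"
  define \<eta> where "\<eta> = \<nu> powr (1/q)"
  define A where "A = max A1 A2 powr (1/q)"
  define e where "e n = V n powr (1/q)" for n
  have nu: "0 < \<nu>" "\<nu> < 1" using mu ka by (auto simp: \<nu>_def)
  have eta: "0 < \<eta>" "\<eta> < 1" using nu q powr_less_mono2[of "1/q" \<nu> 1] by (auto simp: \<eta>_def)
  have A0: "0 < A" using mu by (auto simp: A_def)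
  have e0: "0 < e n" for n using V(1)[of n] by (simp add: e_def)
  have kernel: "e n / 2 ^ (k - n) \<le> A * \<eta> ^ ndist n k * e k" for n k
  proof -
    \<comment> \<open>The q-th power of the claim, in which decay and growth appear
      directly.\<close>
    have "V n / 2 powr (real (k - n) * q) \<le> max A1 A2 * \<nu> ^ ndist n k * V k"
    proof (cases "k \<le> n")
      case True
      then have "V n \<le> A1 * \<mu> ^ (n - k) * V k" using mu(4)[of k "n - k"] by simp
      also have "\<dots> \<le> max A1 A2 * \<nu> ^ (n - k) * V k"
        using mu V(1)[of k] by (intro mult_right_mono mult_mono power_mono) (auto simp: \<nu>_def)
      finally show ?thesis using True by (simp add: ndist_def)
    next
      case False
      have "2 powr (real n * q) * V n \<le> A2 * \<kappa> ^ (k - n) * (2 powr (real k * q) * V k)"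
        using ka(4)[of n "k - n"] False by simp
      also have "2 powr (real k * q) = 2 powr (real n * q) * 2 powr (real (k - n) * q)"
        using False by (simp add: of_nat_diff algebra_simps flip: powr_add)
      finally have "2 powr (real n * q) * V n \<le> 2 powr (real n * q) * (A2 * \<kappa> ^ (k - n) * (2 powr (real (k - n) * q) * V k))"
        by (simp add: mult_ac)
      then have "V n \<le> A2 * \<kappa> ^ (k - n) * (2 powr (real (k - n) * q) * V k)"
        by (subst (asm) mult_le_cancel_left_pos) auto
      then have "V n / 2 powr (real (k - n) * q) \<le> A2 * \<kappa> ^ (k - n) * V k" by (simp add: field_simps)
      also have "\<dots> \<le> max A1 A2 * \<nu> ^ (k - n) * V k"
        using ka V(1)[of k] by (intro mult_right_mono mult_mono power_mono) (auto simp: \<nu>_def)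
      finally show ?thesis using False by (simp add: ndist_def)
    qed
    then have "(V n / 2 powr (real (k - n) * q)) powr (1/q) \<le> (max A1 A2 * \<nu> ^ ndist n k * V k) powr (1/q)"
      using q V(1)[of n] by (intro powr_mono2) auto
    moreover have "(V n / 2 powr (real (k - n) * q)) powr (1/q) = e n / 2 ^ (k - n)"
      using q V(1)[of n] by (simp add: powr_divide powr_powr e_def powr_realpow)
    moreover have "(\<nu> ^ ndist n k) powr (1/q) = \<eta> ^ ndist n k"
      using nu by (simp add: \<eta>_def powr_powr mult.commute flip: powr_realpow)
    ultimately show ?thesis
      using mu nu V(1)[of k] by (simp add: powr_mult A_def e_def)
  qed
  obtain D where D0: "D > 0" and "\<forall>y X. (\<forall>k. 0 \<le> y k) \<longrightarrow> (\<forall>N. (\<Sum>k<N. y k powr q) \<le> X) \<longrightarrow>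
    (\<forall>n. summable (\<lambda>k. \<eta> ^ ndist n k * y k)) \<and> (\<forall>N. (\<Sum>n<N. (\<Sum>k. \<eta> ^ ndist n k * y k) powr q) \<le> D * X)"
    using geometric_kernel_bound[OF eta q] by blast
  then have D: "summable (\<lambda>k. \<eta> ^ ndist n k * y k)" "(\<Sum>n<N. (\<Sum>k. \<eta> ^ ndist n k * y k) powr q) \<le> D * X"
    if "\<And>k. 0 \<le> y k" "\<And>N. (\<Sum>k<N. y k powr q) \<le> X" for y X n N
    using that by blast+
  define c' where "c' = L * (c / (c - 1) * real m)"
  have c'0: "c' > 0" using c L by (simp add: c'_def)
  have pos: "A powr q * D * c' > 0" using A0 D0 c'0 by simp
  show ?thesis
  proof (rule exI[of _ "A powr q * D * c'"], rule conjI[OF pos], intro allI impI)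
    fix M :: "nat \<Rightarrow> real" and X N
    assume "\<forall>n. 0 \<le> M n" and inc: "incseq M"
      and "\<forall>N. (\<Sum>n<N. M n powr q * (V n - V (n + 1))) \<le> X"
    then have M0: "\<And>n. 0 \<le> M n" and X: "\<And>N. (\<Sum>n<N. M n powr q * (V n - V (n + 1))) \<le> X" by auto
    have d0: "0 \<le> V k - V (k + 1)" for k using V(2) by (simp add: decseqD)
    \<comment> \<open>The tail is replaced by \<open>m\<close> increments; since \<open>M\<close>
      increases, each increment V_(n+i) - V_(n+i+1) may take M_(n+i) in place of M_n.\<close>
    have MV: "(\<Sum>n<N. M n powr q * V n) \<le> c / (c - 1) * real m * X" for N
    proof -
      have "(\<Sum>n<N. M n powr q * V n) \<le> (\<Sum>n<N. c / (c - 1) * (\<Sum>i<m. M (n + i) powr q * (V (n + i) - V (n + i + 1))))"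
      proof (intro sum_mono)
        fix n
        have "M n powr q * V n \<le> M n powr q * (c / (c - 1) * (\<Sum>i<m. V (n + i) - V (n + i + 1)))"
          using c by (intro mult_left_mono weight_sequence_tail_le) auto
        also have "\<dots> = c / (c - 1) * (\<Sum>i<m. M n powr q * (V (n + i) - V (n + i + 1)))"
          by (simp add: sum_distrib_left mult_ac)
        also have "\<dots> \<le> c / (c - 1) * (\<Sum>i<m. M (n + i) powr q * (V (n + i) - V (n + i + 1)))"
          using c d0 q M0 inc
          by (intro mult_left_mono sum_mono mult_right_mono powr_mono2) (auto simp: incseqD)
        finally show "M n powr q * V n \<le> c / (c - 1) * (\<Sum>i<m. M (n + i) powr q * (V (n + i) - V (n + i + 1)))" .
      qed
      also have "\<dots> = c / (c - 1) * (\<Sum>i<m. \<Sum>n<N. M (n + i) powr q * (V (n + i) - V (n + i + 1)))"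
        by (subst sum.swap) (simp add: sum_distrib_left)
      also have "\<dots> \<le> c / (c - 1) * (\<Sum>i<m. X)"
      proof (intro mult_left_mono sum_mono)
        fix i
        have "(\<Sum>n<N. M (n + i) powr q * (V (n + i) - V (n + i + 1)))
            = (\<Sum>n\<in>(\<lambda>n. n + i) ` {..<N}. M n powr q * (V n - V (n + 1)))"
          by (subst sum.reindex) (auto simp: inj_on_def)
        also have "\<dots> \<le> (\<Sum>n<N+i. M n powr q * (V n - V (n + 1)))"
        proof (rule sum_mono2)
          show "0 \<le> M b powr q * (V b - V (b + 1))" for b using d0[of b] by (intro mult_nonneg_nonneg) auto
        qed auto
        also have "\<dots> \<le> X" by (rule X)
        finally show "(\<Sum>n<N. M (n + i) powr q * (V (n + i) - V (n + i + 1))) \<le> X" .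
      qed (use c in auto)
      finally show ?thesis by simp
    qed
    define x where "x k = M (Suc k)" for k
    define y where "y k = x k * e k" for k
    have x0: "0 \<le> x k" for k using M0 by (simp add: x_def)
    have y0: "0 \<le> y k" for k using x0 e0[of k] by (simp add: y_def)
    \<comment> \<open>The constant \<open>L\<close> compensates that \<open>x\<close> is
      \<open>M\<close> shifted by one while \<open>e\<close> is not shifted.\<close>
    have yX: "(\<Sum>k<N. y k powr q) \<le> c' * X" for N
    proof -
      have "(\<Sum>k<N. y k powr q) \<le> (\<Sum>k<N. L * (M (Suc k) powr q * V (Suc k)))"
      proof (intro sum_mono)
        fix k
        have "y k powr q = M (Suc k) powr q * V k"
          using q V(1)[of k] M0 by (simp add: y_def x_def e_def powr_mult powr_powr)
        also have "\<dots> \<le> M (Suc k) powr q * (L * V (Suc k))" by (intro mult_left_mono L) auto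
        finally show "y k powr q \<le> L * (M (Suc k) powr q * V (Suc k))" by (simp add: mult_ac)
      qed
      also have "\<dots> = L * (\<Sum>k<N. M (Suc k) powr q * V (Suc k))" by (rule sum_distrib_left[symmetric])
      also have "\<dots> \<le> L * (\<Sum>k<Suc N. M k powr q * V k)"
      proof (intro mult_left_mono)
        have "0 \<le> M 0 powr q * V 0" using V(1)[of 0] by simp
        then show "(\<Sum>k<N. M (Suc k) powr q * V (Suc k)) \<le> (\<Sum>k<Suc N. M k powr q * V k)"
          unfolding sum.lessThan_Suc_shift by linarith
      qed (use L in simp)
      also have "\<dots> \<le> L * (c / (c - 1) * real m * X)" using L by (intro mult_left_mono MV) auto
      finally show ?thesis by (simp add: c'_def mult_ac)
    qed
    have trm: "x k / 2 ^ (k - n) \<le> A / e n * (\<eta> ^ ndist n k * y k)" for n k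
    proof -
      have "x k * (e n / 2 ^ (k - n)) \<le> x k * (A * \<eta> ^ ndist n k * e k)"
        by (intro mult_left_mono kernel x0)
      then show ?thesis using e0[of n] by (simp add: y_def field_simps)
    qed
    have sk: "summable (\<lambda>k. \<eta> ^ ndist n k * y k)" for n by (rule D(1)[OF y0 yX])
    have sx: "summable (\<lambda>k. x k / 2 ^ (k - n))" for n
      using trm x0 by (intro summable_comparison_test'[OF summable_mult[OF sk, of "A / e n" n]]) auto
    have sm: "summable (\<lambda>k. x k / 2 ^ Suc k)"
    proof -
      have "summable (\<lambda>k. (1/2) * (x k / 2 ^ (k - 0)))" by (intro summable_mult sx)
      then show ?thesis by simp
    qed
    define S where "S n = (\<Sum>j\<le>n. 2 ^ j * (\<Sum>k. if j \<le> k then x k / 2 ^ Suc k else 0))" for n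
    have sif: "summable (\<lambda>k. if j \<le> k then x k / 2 ^ Suc k else 0)" for j
      using x0 by (intro summable_comparison_test'[OF sm]) auto
    have Sle: "S n * e n \<le> A * (\<Sum>k. \<eta> ^ ndist n k * y k)" for n
    proof -
      have "S n = (\<Sum>j\<le>n. (\<Sum>k. 2 ^ j * (if j \<le> k then x k / 2 ^ Suc k else 0)))"
        unfolding S_def by (intro sum.cong refl suminf_mult[symmetric] sif)
      also have "\<dots> = (\<Sum>k. \<Sum>j\<le>n. 2 ^ j * (if j \<le> k then x k / 2 ^ Suc k else 0))"
        by (intro suminf_sum[symmetric] summable_mult sif)
      also have "\<dots> \<le> (\<Sum>k. x k / 2 ^ (k - n))"
      proof (intro suminf_le summable_sum summable_mult sif sx)
        fix k
        have "(\<Sum>j\<le>n. 2 ^ j * (if j \<le> k then x k / 2 ^ Suc k else 0)) = (\<Sum>j\<in>{j. j \<le> n \<and> j \<le> k}. 2 ^ j) * (x k / 2 ^ Suc k)"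
          unfolding sum_distrib_right by (intro sum.mono_neutral_cong_right) auto
        also have "{j. j \<le> n \<and> j \<le> k} = {..<Suc (min n k)}" by auto
        \<comment> \<open>The powers sum to less than 2^(min n k + 1), which leaves 2^-(k-n) with
          truncated subtraction.\<close>
        also have "(\<Sum>j<Suc (min n k). 2 ^ j :: real) = 2 ^ Suc (min n k) - 1" by (subst sum_gp_strict) auto
        also have "(2 ^ Suc (min n k) - 1) * (x k / 2 ^ Suc k) \<le> 2 ^ Suc (min n k) * (x k / 2 ^ Suc k)"
          using x0[of k] by (intro mult_right_mono) auto
        also have "\<dots> = x k / 2 ^ (k - n)"
        proof (cases "k \<le> n")
          case False
          then have "Suc k = (k - n) + Suc n" by simp
          then have "(2::real) ^ Suc k = 2 ^ (k - n) * 2 ^ Suc n" by (metis power_add)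
          then show ?thesis using False by (simp add: min_def)
        qed (simp add: min_def)
        finally show "(\<Sum>j\<le>n. 2 ^ j * (if j \<le> k then x k / 2 ^ Suc k else 0)) \<le> x k / 2 ^ (k - n)" .
      qed
      also have "\<dots> \<le> (\<Sum>k. A / e n * (\<eta> ^ ndist n k * y k))"
        by (intro suminf_le trm sx summable_mult sk)
      also have "\<dots> = A / e n * (\<Sum>k. \<eta> ^ ndist n k * y k)" by (intro suminf_mult sk)
      finally show ?thesis using e0[of n] by (simp add: field_simps)
    qed
    have S0: "0 \<le> S n" for n
      unfolding S_def using x0 by (intro sum_nonneg mult_nonneg_nonneg suminf_nonneg sif) auto
    have "(\<Sum>n<N. S n powr q * (V n - V (n + 1))) \<le> (\<Sum>n<N. A powr q * (\<Sum>k. \<eta> ^ ndist n k * y k) powr q)"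
    proof (intro sum_mono)
      fix n
      have k0: "0 \<le> (\<Sum>k. \<eta> ^ ndist n k * y k)" using eta y0 by (intro suminf_nonneg sk) auto
      have "S n powr q * (V n - V (n + 1)) \<le> S n powr q * V n"
        using V(1)[of "n + 1"] by (intro mult_left_mono) auto
      also have "\<dots> = (S n * e n) powr q" using S0 q V(1)[of n] by (simp add: powr_mult e_def powr_powr)
      also have "\<dots> \<le> (A * (\<Sum>k. \<eta> ^ ndist n k * y k)) powr q"
        using S0 e0[of n] q by (intro powr_mono2 Sle) auto
      also have "\<dots> = A powr q * (\<Sum>k. \<eta> ^ ndist n k * y k) powr q" using A0 k0 by (simp add: powr_mult)
      finally show "S n powr q * (V n - V (n + 1)) \<le> A powr q * (\<Sum>k. \<eta> ^ ndist n k * y k) powr q" .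
    qed
    also have "\<dots> = A powr q * (\<Sum>n<N. (\<Sum>k. \<eta> ^ ndist n k * y k) powr q)" by (rule sum_distrib_left[symmetric])
    also have "\<dots> \<le> A powr q * (D * (c' * X))" by (intro mult_left_mono D(2) y0 yX) auto
    finally show "summable (\<lambda>k. M (Suc k) / 2 ^ Suc k) \<and>
      (\<Sum>n<N. (\<Sum>j\<le>n. 2 ^ j * (\<Sum>k. if j \<le> k then M (Suc k) / 2 ^ Suc k else 0)) powr q * (V n - V (n + 1))) \<le> A powr q * D * c' * X"
      using sm unfolding S_def x_def mult.assoc by (intro conjI)
  qed
qed

subsection \<open>Mean oscillation against the Poisson kernel\<close>

lemma measurable_circ_rotate:
  assumes "norm w = 1"
  shows "(\<lambda>x. w * x) \<in> circ \<rightarrow>\<^sub>M circ"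
proof -
  have "(\<lambda>x. w * x) \<in> restrict_space borel (sphere 0 1) \<rightarrow>\<^sub>M restrict_space borel (sphere 0 1)"
    using assms by (intro measurable_restrict_space2 measurable_restrict_space1)
      (auto simp: norm_mult space_restrict_space)
  then show ?thesis by (simp add: measurable_cong_sets[OF sets_circ sets_circ])
qed

lemma distr_circ_rotate:
  assumes w: "norm w = 1"
  shows "distr circ circ (\<lambda>x. w * x) = circ"
proof (rule measure_eqI)
  note m = measurable_circ_rotate[OF w]
  fix A assume "A \<in> sets (distr circ circ (\<lambda>x. w * x))"
  then have A: "A \<in> sets circ" by simp
  have "emeasure (distr circ circ (\<lambda>x. w * x)) A = (\<integral>\<^sup>+x. indicator A x \<partial>distr circ circ (\<lambda>x. w * x))"
    using A by simp
  also have "\<dots> = (\<integral>\<^sup>+x. indicator A (w * x) \<partial>circ)"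
    using A by (intro nn_integral_distr m) auto
  also have "\<dots> = (\<integral>\<^sup>+x. indicator A x \<partial>circ)"
    using A by (intro nn_integral_circ_rotate w) auto
  finally show "emeasure (distr circ circ (\<lambda>x. w * x)) A = emeasure circ A" using A by simp
qed simp

lemma AE_circ_rotate:
  assumes w: "norm w = 1" and "AE x in circ. P x"
  shows "AE x in circ. P (w * x)"
proof -
  have "AE x in distr circ circ (\<lambda>x. w * x). P x"
    unfolding distr_circ_rotate[OF w] by fact
  then show ?thesis by (rule AE_distrD[OF measurable_circ_rotate[OF w]])
qed

lemma integral_circ_rotate:
  fixes u :: "complex \<Rightarrow> real"
  assumes w: "norm w = 1" and u: "u \<in> borel_measurable circ"
  shows "(LINT x|circ. u (w * x)) = (LINT x|circ. u x)"
  using integral_distr[OF measurable_circ_rotate[OF w] u] by (simp add: distr_circ_rotate[OF w])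

lemma poisson_rotate:
  assumes "norm w = 1"
  shows "poisson (z * w) (v * w) = poisson z v"
proof -
  have "norm (v * w - z * w) = norm (v - z)"
    using assms by (simp add: norm_mult flip: left_diff_distrib)
  then show ?thesis using assms by (simp add: poisson_def norm_mult)
qed

lemma add3_powr_le:
  fixes x y z p :: real
  assumes "0 \<le> x" "0 \<le> y" "0 \<le> z" "1 \<le> p"
  shows "(x + y + z) powr p \<le> 3 powr p * (x powr p + y powr p + z powr p)"
proof -
  define m where "m = max x (max y z)"
  have "x + y + z \<le> 3 * m" by (simp add: m_def)
  then have "(x + y + z) powr p \<le> (3 * m) powr p" using assms by (intro powr_mono2) auto
  also have "\<dots> = 3 powr p * m powr p" using assms by (intro powr_mult)
  also have "m powr p \<le> x powr p + y powr p + z powr p"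
    unfolding m_def by (auto simp: max_def add_nonneg_nonneg)
  finally show ?thesis by simp
qed

locale hardy1_summable = hardy1 +
  fixes p :: real
  assumes p: "1 \<le> p"
    and summ: "summable (\<lambda>k. pmean p (deriv f) (dyadic (Suc k)) / 2 ^ Suc k)"
begin

abbreviation "M n \<equiv> pmean p (deriv f) (dyadic n)"

text \<open>The tail of the series of means from index \<open>j\<close>. The \<open>if\<close> keeps
  the summation range fixed, as in \<open>weighted_hardy_inequality\<close>.\<close>

definition Psi :: "nat \<Rightarrow> real" where
  "Psi j = (\<Sum>k. if j \<le> k then M (Suc k) / 2 ^ Suc k else 0)"

lemma summ_if: "summable (\<lambda>k. if j \<le> k then M (Suc k) / 2 ^ Suc k else 0)"
  using pmean_nonneg by (intro summable_comparison_test'[OF summ]) (auto simp: pmean_nonneg)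

lemma sum_le_Psi: "(\<Sum>k=j..<K. M (Suc k) / 2 ^ Suc k) \<le> Psi j"
proof -
  have "(\<Sum>k=j..<K. M (Suc k) / 2 ^ Suc k) = (\<Sum>k=j..<K. if j \<le> k then M (Suc k) / 2 ^ Suc k else 0)"
    by (intro sum.cong) auto
  also have "\<dots> \<le> Psi j" unfolding Psi_def
    by (intro sum_le_suminf summ_if) (auto simp: pmean_nonneg)
  finally show ?thesis .
qed

lemma term_le_Psi: "M (Suc j) / 2 ^ Suc j \<le> Psi j"
  using sum_le_Psi[of j "Suc j"] by simp

lemma Psi_nonneg: "0 \<le> Psi j"
  using term_le_Psi[of j] by (rule order_trans[rotated]) (simp add: pmean_nonneg)

text \<open>Telescoping over the dyadic radii, cut off at \<open>R\<close>. The step across ring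
  \<open>k\<close> has length at most 2^-(k+1) and stays within the radius
  \<open>dyadic (Suc k)\<close>; Minkowski for a counting measure adds the pieces.\<close>

lemma dilation_difference_radial:
  assumes R: "dyadic j \<le> R" "R < 1"
  shows "(\<integral>\<^sup>+w. ennreal (norm (f (of_real R * w) - f (of_real (dyadic j) * w)) powr p) \<partial>circ) \<le> ennreal (Psi j powr p)"
proof -
  obtain J where J: "R < dyadic J" using dyadic_unbounded[OF R(2)] .
  have jJ: "j \<le> J"
  proof (rule ccontr)
    assume "\<not> j \<le> J"
    then have "dyadic J \<le> dyadic j" by (intro dyadic_mono) auto
    then show False using J R by linarith
  qed
  define a where "a k = min (dyadic k) R" for k
  have a: "a j = dyadic j" "a J = R" using R J by (auto simp: a_def)
  have R0: "0 \<le> R" using R(1) dyadic(1)[of j] by linarith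
  have a01: "0 \<le> a k" "a k < 1" "a k \<le> dyadic k" for k using dyadic[of k] R R0 by (auto simp: a_def)
  have step: "0 \<le> a (Suc k) - a k" "a (Suc k) - a k \<le> 1 / 2 ^ Suc k" for k
  proof -
    have *: "dyadic (Suc k) = dyadic k + 1 / 2 ^ Suc k" by (simp add: dyadic_def field_simps)
    have "0 \<le> 1 / (2::real) ^ Suc k" by simp
    then show "0 \<le> a (Suc k) - a k" "a (Suc k) - a k \<le> 1 / 2 ^ Suc k"
      unfolding a_def * by linarith+
  qed
  define K where "K k w = norm (f (of_real (a (Suc k)) * w) - f (of_real (a k) * w))" for k w
  have cm: "(\<lambda>w. f (of_real (a k) * w)) \<in> borel_measurable circ" for k
    by (intro borel_measurable_circ_continuous continuous_on_dilation(3)[OF f] a01)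
  have "(\<integral>\<^sup>+w. ennreal (norm (f (of_real R * w) - f (of_real (dyadic j) * w)) powr p) \<partial>circ) \<le>
    (\<integral>\<^sup>+w. ennreal ((LINT k|count_space {j..<J}. K k w) powr p) \<partial>circ)"
  proof (intro nn_integral_mono ennreal_leI powr_mono2)
    fix w
    have "f (of_real R * w) - f (of_real (dyadic j) * w) = (\<Sum>k=j..<J. f (of_real (a (Suc k)) * w) - f (of_real (a k) * w))"
      using sum_Suc_diff'[OF jJ, of "\<lambda>k. f (of_real (a k) * w)"] by (simp add: a)
    also have "norm \<dots> \<le> (\<Sum>k=j..<J. K k w)" unfolding K_def by (rule norm_sum)
    also have "\<dots> = (LINT k|count_space {j..<J}. K k w)" by (simp add: lebesgue_integral_count_space_finite)
    finally show "norm (f (of_real R * w) - f (of_real (dyadic j) * w)) \<le> (LINT k|count_space {j..<J}. K k w)" .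
  qed (use p in auto)
  also have "\<dots> \<le> ennreal ((LINT k|count_space {j..<J}. M (Suc k) / 2 ^ Suc k) powr p)"
  proof (rule minkowski_integral[OF _ _ p])
    show "finite_measure (count_space {j..<J})" by (rule finite_measure_count_space) simp
    show "sigma_finite_measure circ" ..
    show "(\<lambda>(k, w). K k w) \<in> borel_measurable (count_space {j..<J} \<Otimes>\<^sub>M circ)"
      unfolding K_def using cm by (intro measurable_pair_measure_countable1) (auto intro!: borel_measurable_diff borel_measurable_norm)
    fix k assume "k \<in> space (count_space {j..<J})"
    have "(\<integral>\<^sup>+w. ennreal (K k w powr p) \<partial>circ) \<le> ennreal ((norm (of_real (a (Suc k)) - of_real (a k) :: complex) * M (Suc k)) powr p)"
      unfolding K_def
    proof (rule segment_bound[OF f p])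
      show "norm (complex_of_real (a k)) \<le> dyadic (Suc k)" "norm (complex_of_real (a (Suc k))) \<le> dyadic (Suc k)" "dyadic (Suc k) < 1"
        using a01[of k] a01[of "Suc k"] dyadic_mono[of k "Suc k"] dyadic by auto
    qed
    also have "norm (of_real (a (Suc k)) - of_real (a k) :: complex) = a (Suc k) - a k"
      using step(1)[of k] by (simp flip: of_real_diff)
    also have "ennreal (((a (Suc k) - a k) * M (Suc k)) powr p) \<le> ennreal ((1 / 2 ^ Suc k * M (Suc k)) powr p)"
      using p step[of k] by (intro ennreal_leI powr_mono2 mult_right_mono mult_nonneg_nonneg pmean_nonneg) auto
    finally show "(\<integral>\<^sup>+w. ennreal (K k w powr p) \<partial>circ) \<le> ennreal ((M (Suc k) / 2 ^ Suc k) powr p)" by simp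
  qed (auto simp: K_def pmean_nonneg integrable_count_space)
  also have "(LINT k|count_space {j..<J}. M (Suc k) / 2 ^ Suc k) = (\<Sum>k=j..<J. M (Suc k) / 2 ^ Suc k)"
    by (simp add: lebesgue_integral_count_space_finite)
  also have "ennreal (\<dots> powr p) \<le> ennreal (Psi j powr p)"
    using p by (intro ennreal_leI powr_mono2 sum_le_Psi sum_nonneg) (auto simp: pmean_nonneg)
  finally show ?thesis .
qed

text \<open>Inwards from R v w to the radius \<open>dyadic j\<close>, along the chord, outwards to r
  w. The chord costs 4 / 2^j times \<open>M (Suc j)\<close>, at most 8 Psi j; for the three pieces
  together 3 * 3^p <= 9^p, and 9 * 8 = 72.\<close>

lemma dilation_difference:
  assumes v: "norm v = 1" "norm (v - 1) \<le> 4 / 2 ^ j" and r: "dyadic j \<le> r" "r < 1" and R: "dyadic j \<le> R" "R < 1"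
  shows "(\<integral>\<^sup>+w. ennreal (norm (f (of_real R * (v * w)) - f (of_real r * w)) powr p) \<partial>circ) \<le> ennreal ((72 * Psi j) powr p)"
proof -
  define s where "s = dyadic j"
  have s: "0 \<le> s" "s < 1" using dyadic by (auto simp: s_def)
  have rR: "0 \<le> r" "0 \<le> R" using r R s by (auto simp: s_def)
  define X where "X w = norm (f (of_real R * (v * w)) - f (of_real s * (v * w)))" for w
  define Y where "Y w = norm (f (of_real s * v * w) - f (of_real s * w))" for w
  define Z where "Z w = norm (f (of_real r * w) - f (of_real s * w))" for w
  have cm: "(\<lambda>w. f (of_real t * w)) \<in> borel_measurable circ" if "0 \<le> t" "t < 1" for t
    using that by (intro borel_measurable_circ_continuous continuous_on_dilation(3)[OF f])
  have cm2: "(\<lambda>w. f (of_real t * (v * w))) \<in> borel_measurable circ" if "0 \<le> t" "t < 1" for t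
    using borel_measurable_circ_rotate[OF v(1) cm[OF that]] .
  note [measurable] = cm[OF rR(1) r(2)] cm[OF rR(2) R(2)] cm[OF s] cm2[OF rR(1) r(2)] cm2[OF rR(2) R(2)] cm2[OF s]
  have [measurable]: "X \<in> borel_measurable circ" "Y \<in> borel_measurable circ" "Z \<in> borel_measurable circ"
    unfolding X_def Y_def Z_def mult.assoc by measurable
  have XX: "(\<integral>\<^sup>+w. ennreal (X w powr p) \<partial>circ) \<le> ennreal ((8 * Psi j) powr p)"
  proof -
    have "(\<integral>\<^sup>+w. ennreal (X w powr p) \<partial>circ) = (\<integral>\<^sup>+w. ennreal (norm (f (of_real R * w) - f (of_real s * w)) powr p) \<partial>circ)"
      unfolding X_def by (rule nn_integral_circ_rotate[OF v(1)]) measurable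
    also have "\<dots> \<le> ennreal (Psi j powr p)" unfolding s_def by (rule dilation_difference_radial[OF R])
    also have "\<dots> \<le> ennreal ((8 * Psi j) powr p)" using p Psi_nonneg[of j] by (intro ennreal_leI powr_mono2) auto
    finally show ?thesis .
  qed
  have ZZ: "(\<integral>\<^sup>+w. ennreal (Z w powr p) \<partial>circ) \<le> ennreal ((8 * Psi j) powr p)"
  proof -
    have "(\<integral>\<^sup>+w. ennreal (Z w powr p) \<partial>circ) \<le> ennreal (Psi j powr p)"
      unfolding Z_def s_def by (rule dilation_difference_radial[OF r])
    also have "\<dots> \<le> ennreal ((8 * Psi j) powr p)" using p Psi_nonneg[of j] by (intro ennreal_leI powr_mono2) auto
    finally show ?thesis .
  qed
  have YY: "(\<integral>\<^sup>+w. ennreal (Y w powr p) \<partial>circ) \<le> ennreal ((8 * Psi j) powr p)"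
  proof -
    have "(\<integral>\<^sup>+w. ennreal (Y w powr p) \<partial>circ) \<le> ennreal ((norm (of_real s * v - of_real s) * M (Suc j)) powr p)"
      unfolding Y_def
      by (rule segment_bound[OF f p]) (use s v dyadic[of "Suc j"] dyadic_mono[of j "Suc j"] in \<open>auto simp: norm_mult s_def\<close>)
    also have "\<dots> \<le> ennreal ((8 * Psi j) powr p)"
    proof (intro ennreal_leI powr_mono2)
      have "norm (of_real s * v - of_real s) = norm (of_real s * (v - 1))" by (simp add: algebra_simps)
      also have "\<dots> = s * norm (v - 1)" using s by (simp add: norm_mult)
      also have "\<dots> \<le> 1 * (4 / 2 ^ j)" using s v by (intro mult_mono) auto
      finally have "norm (of_real s * v - of_real s) * M (Suc j) \<le> 4 / 2 ^ j * M (Suc j)"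
        by (intro mult_right_mono pmean_nonneg) simp
      also have "\<dots> = 8 * (M (Suc j) / 2 ^ Suc j)" by simp
      also have "\<dots> \<le> 8 * Psi j" by (intro mult_left_mono term_le_Psi) simp
      finally show "norm (of_real s * v - of_real s) * M (Suc j) \<le> 8 * Psi j" .
    qed (use p in \<open>auto simp: pmean_nonneg\<close>)
    finally show ?thesis .
  qed
  have "(\<integral>\<^sup>+w. ennreal (norm (f (of_real R * (v * w)) - f (of_real r * w)) powr p) \<partial>circ) \<le>
     (\<integral>\<^sup>+w. ennreal (3 powr p) * (ennreal (X w powr p) + ennreal (Y w powr p) + ennreal (Z w powr p)) \<partial>circ)"
  proof (intro nn_integral_mono)
    fix w
    have "norm (f (of_real R * (v * w)) - f (of_real r * w)) = norm ((f (of_real R * (v * w)) - f (of_real s * (v * w)))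
       + (f (of_real s * v * w) - f (of_real s * w)) - (f (of_real r * w) - f (of_real s * w)))"
      by (simp add: mult.assoc)
    also have "\<dots> \<le> X w + Y w + Z w"
      unfolding X_def Y_def Z_def by (meson norm_triangle_ineq4 norm_triangle_ineq add_mono order_refl order_trans)
    finally have "norm (f (of_real R * (v * w)) - f (of_real r * w)) powr p \<le> (X w + Y w + Z w) powr p"
      using p by (intro powr_mono2) auto
    also have "\<dots> \<le> 3 powr p * (X w powr p + Y w powr p + Z w powr p)"
      using p by (intro add3_powr_le) (auto simp: X_def Y_def Z_def)
    finally have "ennreal (norm (f (of_real R * (v * w)) - f (of_real r * w)) powr p) \<le> ennreal (3 powr p * (X w powr p + Y w powr p + Z w powr p))"
      by (rule ennreal_leI)
    then show "ennreal (norm (f (of_real R * (v * w)) - f (of_real r * w)) powr p) \<le> ennreal (3 powr p) * (ennreal (X w powr p) + ennreal (Y w powr p) + ennreal (Z w powr p))"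
      by (simp add: ennreal_mult ennreal_plus)
  qed
  also have "\<dots> = ennreal (3 powr p) * ((\<integral>\<^sup>+w. ennreal (X w powr p) \<partial>circ) + (\<integral>\<^sup>+w. ennreal (Y w powr p) \<partial>circ) + (\<integral>\<^sup>+w. ennreal (Z w powr p) \<partial>circ))"
    by (simp add: nn_integral_cmult nn_integral_add)
  also have "\<dots> \<le> ennreal (3 powr p) * (ennreal ((8 * Psi j) powr p) + ennreal ((8 * Psi j) powr p) + ennreal ((8 * Psi j) powr p))"
    by (intro mult_left_mono add_mono XX YY ZZ) auto
  also have "\<dots> = ennreal (3 powr p * (3 * (8 * Psi j) powr p))"
  proof -
    have "ennreal t + ennreal t + ennreal t = ennreal (3 * t)" if "0 \<le> t" for t
    proof -
      have "ennreal (3 * t) = ennreal ((t + t) + t)" by simp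
      also have "\<dots> = ennreal t + ennreal t + ennreal t"
        using that by (simp only: ennreal_plus add_nonneg_nonneg)
      finally show ?thesis by simp
    qed
    then show ?thesis by (simp add: ennreal_mult)
  qed
  also have "\<dots> \<le> ennreal (3 powr p * (3 powr p * (8 * Psi j) powr p))"
  proof -
    have "(3::real) powr 1 \<le> 3 powr p" using p by (intro powr_mono) auto
    then show ?thesis by (intro ennreal_leI mult_left_mono mult_right_mono) auto
  qed
  also have "3 powr p * (3 powr p * (8 * Psi j) powr p) = (72 * Psi j) powr p"
    using Psi_nonneg[of j] by (simp flip: powr_mult)
  finally show ?thesis .
qed

text \<open>Fatou's lemma, with \<open>R\<close> running through the late terms of
  \<open>rho\<close>.\<close>

lemma boundary_difference:
  assumes v: "norm v = 1" "norm (v - 1) \<le> 4 / 2 ^ j" and r: "dyadic j \<le> r" "r < 1"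
  shows "(\<integral>\<^sup>+w. ennreal (norm (b (v * w) - f (of_real r * w)) powr p) \<partial>circ) \<le> ennreal ((72 * Psi j) powr p)"
proof -
  have r0: "0 \<le> r" using r dyadic(1)[of j] by linarith
  from order_tendstoD(1)[OF rho_tendsto dyadic(2)[of j]] obtain n0 where n0: "\<And>n. n0 \<le> n \<Longrightarrow> dyadic j < rho n"
    by (auto simp: eventually_sequentially)
  define G where "G n w = f (of_real (rho (n + n0)) * (v * w))" for n w
  have [measurable]: "(\<lambda>w. f (of_real r * w)) \<in> borel_measurable circ"
    using r r0 by (intro borel_measurable_circ_continuous continuous_on_dilation(3)[OF f])
  have [measurable]: "G n \<in> borel_measurable circ" for n
    unfolding G_def by (rule borel_measurable_circ_rotate[OF v(1) F_measurable])
  have "(\<integral>\<^sup>+w. ennreal (norm (b (v * w) - f (of_real r * w)) powr p) \<partial>circ)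
    = (\<integral>\<^sup>+w. liminf (\<lambda>n. ennreal (norm (G n w - f (of_real r * w)) powr p)) \<partial>circ)"
  proof (rule nn_integral_cong_AE)
    show "AE w in circ. ennreal (norm (b (v * w) - f (of_real r * w)) powr p) = liminf (\<lambda>n. ennreal (norm (G n w - f (of_real r * w)) powr p))"
      using AE_circ_rotate[OF v(1) F_lim]
    proof (rule AE_mp, intro AE_I2 impI)
      fix w assume "(\<lambda>n. F n (v * w)) \<longlonglongrightarrow> b (v * w)"
      then have "(\<lambda>n. G n w) \<longlonglongrightarrow> b (v * w)" unfolding G_def by (rule LIMSEQ_ignore_initial_segment)
      then have "(\<lambda>n. norm (G n w - f (of_real r * w)) powr p) \<longlonglongrightarrow> norm (b (v * w) - f (of_real r * w)) powr p"
        using p by (intro tendsto_powr2 tendsto_norm tendsto_diff tendsto_const) auto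
      then show "ennreal (norm (b (v * w) - f (of_real r * w)) powr p) = liminf (\<lambda>n. ennreal (norm (G n w - f (of_real r * w)) powr p))"
        by (intro lim_imp_Liminf[symmetric] tendsto_ennrealI) auto
    qed
  qed
  also have "\<dots> \<le> liminf (\<lambda>n. \<integral>\<^sup>+w. ennreal (norm (G n w - f (of_real r * w)) powr p) \<partial>circ)"
    by (intro nn_integral_liminf) measurable
  also have "\<dots> \<le> liminf (\<lambda>n. ennreal ((72 * Psi j) powr p))"
    unfolding G_def using n0 rho by (intro Liminf_mono always_eventually allI dilation_difference v r) (auto intro: less_imp_le)
  also have "\<dots> = ennreal ((72 * Psi j) powr p)" by (rule Liminf_const) simp
  finally show ?thesis .
qed

text \<open>Beyond i = n the truncated difference n - i stays 0: these terms add at most Psi 0 /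
  2^n, no more than the main sum once again, whence the factor 2.\<close>

lemma dyadic_sum_le:
  "(\<Sum>i\<le>J. Psi (n - i) / 2 ^ i) \<le> 2 / 2 ^ n * (\<Sum>j\<le>n. 2 ^ j * Psi j)"
proof -
  let ?S = "\<Sum>j\<le>n. 2 ^ j * Psi j"
  have n: "(\<Sum>i\<le>n. Psi (n - i) / 2 ^ i) = ?S / 2 ^ n"
  proof -
    have "(\<Sum>i\<le>n. Psi (n - i) / 2 ^ i) = (\<Sum>i\<le>n. 2 ^ i * Psi i / 2 ^ n)"
      by (rule sum.reindex_bij_witness[of _ "\<lambda>i. n - i" "\<lambda>i. n - i"]) (auto simp: power_diff)
    then show ?thesis by (simp add: sum_divide_distrib)
  qed
  have "(\<Sum>i\<le>n + k. Psi (n - i) / 2 ^ i) \<le> ?S / 2 ^ n + (1 / 2 ^ n - 1 / 2 ^ (n + k)) * Psi 0" for k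
  proof (induction k)
    case (Suc k)
    have "(\<Sum>i\<le>n + Suc k. Psi (n - i) / 2 ^ i) = (\<Sum>i\<le>n + k. Psi (n - i) / 2 ^ i) + Psi 0 / 2 ^ Suc (n + k)"
      by simp
    also have "\<dots> \<le> ?S / 2 ^ n + (1 / 2 ^ n - 1 / 2 ^ (n + k)) * Psi 0 + Psi 0 / 2 ^ Suc (n + k)"
      using Suc.IH by simp
    also have "\<dots> = ?S / 2 ^ n + (1 / 2 ^ n - 1 / 2 ^ (n + Suc k)) * Psi 0"
      by (simp add: field_simps)
    finally show ?case .
  qed (simp add: n)
  from this[of J] have "(\<Sum>i\<le>n + J. Psi (n - i) / 2 ^ i) \<le> ?S / 2 ^ n + (1 / 2 ^ n - 1 / 2 ^ (n + J)) * Psi 0" .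
  also have "\<dots> \<le> ?S / 2 ^ n + 1 / 2 ^ n * Psi 0"
    by (intro add_left_mono mult_right_mono Psi_nonneg) simp
  also have "Psi 0 \<le> ?S"
    using member_le_sum[of 0 "{..n}" "\<lambda>j. 2 ^ j * Psi j"] Psi_nonneg by auto
  then have "1 / 2 ^ n * Psi 0 \<le> 1 / 2 ^ n * ?S" by (intro mult_left_mono) auto
  finally have "(\<Sum>i\<le>n + J. Psi (n - i) / 2 ^ i) \<le> 2 / 2 ^ n * ?S" by simp
  moreover have "(\<Sum>i\<le>J. Psi (n - i) / 2 ^ i) \<le> (\<Sum>i\<le>n + J. Psi (n - i) / 2 ^ i)"
    by (intro sum_mono2) (auto simp: Psi_nonneg)
  ultimately show ?thesis by linarith
qed

text \<open>Substituting x = v w frees the kernel from \<open>w\<close>, so Minkowski in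
  \<open>v\<close> applies. For |v - 1| <= 2^i h the difference is at most 72 Psi (n - i) in L^p,
  and the i-th term of the kernel bound has mass at most 32 / 2^i, where 32 = 8 * 2^2 from b = 2.
  Then 4608 = 2 * 32 * 72.\<close>

lemma poisson_deviation:
  assumes r: "dyadic n \<le> r" "r < 1"
  assumes r2: "r < dyadic (Suc n)"
  shows "(\<integral>\<^sup>+w. ennreal ((LINT x|circ. poisson (of_real r * w) x * norm (b x - f (of_real r * w))) powr p) \<partial>circ)
    \<le> ennreal ((4608 / 2 ^ n * (\<Sum>j\<le>n. 2 ^ j * Psi j)) powr p)"
proof -
  define h where "h = 1 - r"
  have r0: "0 \<le> r" using r dyadic(1)[of n] by linarith
  have h: "0 < h" "h \<le> 1 / 2 ^ n" using r by (auto simp: h_def dyadic_def)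
  have zr: "norm (complex_of_real r) < 1" "1 - norm (complex_of_real r) = h" using r0 r by (auto simp: h_def)
  obtain J where J: "1 / h < 2 ^ J" using real_arch_pow[of 2 "1/h"] by auto
  then have J': "1 \<le> 2 ^ J * h" using h by (simp add: field_simps)
  define K where "K v w = poisson (of_real r) v * norm (b (v * w) - f (of_real r * w))" for v w
  define c where "c i v = 32 / (4 ^ i * h) * indicator (cball 1 (2 ^ i * h) \<inter> sphere 0 1) v" for i :: nat and v :: complex
  define d where "d v = (\<Sum>i\<le>Suc J. c i v * (72 * Psi (n - i)))" for v
  have c0: "0 \<le> c i v" for i v using h by (simp add: c_def)
  have d0: "0 \<le> d v" for v unfolding d_def using c0 Psi_nonneg by (intro sum_nonneg mult_nonneg_nonneg) auto
  have ci: "integrable circ (c i)" for i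
    unfolding c_def by (intro integrable_mult_right) (auto simp: circ.emeasure_finite less_top[symmetric] intro!: integrable_real_indicator)
  have bi: "integrable circ (\<lambda>x. norm (b x - y))" for y
    using b_integrable by auto
  have P: "poisson (of_real r) v \<le> (\<Sum>i\<le>Suc J. c i v)" if v: "norm v = 1" for v
  proof -
    have "dist 1 v \<le> 2 * dist (of_real r) v"
    proof -
      have "h \<le> dist (of_real r) v"
        using norm_triangle_ineq2[of v "of_real r"] v r0 by (simp add: h_def dist_norm norm_minus_commute)
      moreover have "dist 1 (complex_of_real r) = h"
        using r unfolding h_def dist_norm by (metis abs_of_pos diff_gt_0_iff_gt norm_of_real of_real_1 of_real_diff)
      ultimately show ?thesis using dist_triangle[of 1 v "of_real r"] by simp
    qed
    then have "poisson (of_real r) v \<le> (\<Sum>i\<le>Suc J. 8 * 2\<^sup>2 / (4 ^ i * h) * indicator (cball 1 (2 ^ i * h)) v)"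
      using poisson_dyadic_bound[OF zr(1) v, of 1 2 J] J' unfolding zr(2) by simp
    also have "\<dots> = (\<Sum>i\<le>Suc J. c i v)"
      using v by (intro sum.cong refl) (auto simp: c_def indicator_def)
    finally show ?thesis .
  qed
  have Ksec: "(LINT x|circ. poisson (of_real r * w) x * norm (b x - f (of_real r * w))) = (LINT v|circ. K v w)" if w: "norm w = 1" for w
  proof -
    have z: "norm (of_real r * w) < 1" using r r0 w by (simp add: norm_mult)
    have "(\<lambda>x. poisson (of_real r * w) x * norm (b x - f (of_real r * w))) \<in> borel_measurable circ"
      using poisson_measurable[OF z] by measurable
    from integral_circ_rotate[OF w this]
    have "(LINT x|circ. poisson (of_real r * w) x * norm (b x - f (of_real r * w))) =
      (LINT v|circ. poisson (of_real r * w) (w * v) * norm (b (w * v) - f (of_real r * w)))" by simp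
    also have "\<dots> = (LINT v|circ. K v w)"
      unfolding K_def by (intro Bochner_Integration.integral_cong refl) (simp add: mult.commute[of w] poisson_rotate[OF w])
    finally show ?thesis .
  qed
  have mm: "(\<lambda>(v, w). v * w) \<in> circ \<Otimes>\<^sub>M circ \<rightarrow>\<^sub>M circ"
  proof -
    have "(\<lambda>(v, w). v * w) \<in> circ \<Otimes>\<^sub>M circ \<rightarrow>\<^sub>M restrict_space borel (sphere 0 1)"
      by (intro measurable_restrict_space2) (auto simp: space_pair_measure norm_mult)
    then show ?thesis by (simp add: measurable_cong_sets[OF refl sets_circ])
  qed
  have Km: "(\<lambda>(v, w). K v w) \<in> borel_measurable (circ \<Otimes>\<^sub>M circ)"
  proof -
    have 1: "(\<lambda>x. b (fst x * snd x)) \<in> borel_measurable (circ \<Otimes>\<^sub>M circ)"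
      using measurable_compose[OF mm b_measurable] by (simp add: case_prod_beta)
    have 2: "(\<lambda>x. f (of_real r * snd x)) \<in> borel_measurable (circ \<Otimes>\<^sub>M circ)"
      using measurable_compose[OF measurable_snd borel_measurable_circ_continuous[OF continuous_on_dilation(3)[OF f r0 r(2)]]] .
    have 3: "(\<lambda>x. poisson (of_real r) (fst x)) \<in> borel_measurable (circ \<Otimes>\<^sub>M circ)"
      using measurable_compose[OF measurable_fst poisson_measurable[OF zr(1)]] .
    show ?thesis unfolding K_def case_prod_beta using 1 2 3 by measurable
  qed
  have Ki: "integrable circ (\<lambda>v. K v w)" if w: "norm w = 1" for w
  proof -
    have "integrable circ (\<lambda>v. norm (b (w * v) - f (of_real r * w)))"
      using integrable_distr[OF measurable_circ_rotate[OF w], of "\<lambda>x. norm (b x - f (of_real r * w))"] bi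
      by (simp add: distr_circ_rotate[OF w])
    from integrable_poisson_mult[OF zr(1) this] show ?thesis by (simp add: K_def mult.commute)
  qed
  have Kd: "(\<integral>\<^sup>+w. ennreal (K v w powr p) \<partial>circ) \<le> ennreal (d v powr p)" if v: "norm v = 1" for v
  proof -
    define Q where "Q = (\<integral>\<^sup>+w. ennreal (norm (b (v * w) - f (of_real r * w)) powr p) \<partial>circ)"
    have Qle: "Q \<le> ennreal ((72 * Psi (n - i)) powr p)" if "c i v \<noteq> 0" for i
    proof -
      have vi: "norm (v - 1) \<le> 2 ^ i * h" using that by (auto simp: c_def indicator_def dist_norm norm_minus_commute split: if_splits)
      have "norm (v - 1) \<le> 4 / 2 ^ (n - i)"
      proof (cases "i \<le> n")
        case True
        note vi
        also have "2 ^ i * h \<le> 2 ^ i * (1 / 2 ^ n)" using h by (intro mult_left_mono) auto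
        also have "\<dots> = 1 / 2 ^ (n - i)" using True by (simp add: power_diff)
        also have "\<dots> \<le> 4 / 2 ^ (n - i)" by (intro divide_right_mono) auto
        finally show ?thesis .
      next
        case False
        \<comment> \<open>Here n - i is 0, and the whole circle satisfies the requirement.\<close>
        have "norm (v - 1) \<le> 2" using dist_sphere_le_2[of v 1] v by (simp add: dist_norm)
        then show ?thesis using False by simp
      qed
      moreover have "dyadic (n - i) \<le> r" using dyadic_mono[of "n - i" n] r by simp
      ultimately show ?thesis unfolding Q_def using v r by (intro boundary_difference) auto
    qed
    have "poisson (of_real r) v > 0"
    proof -
      have "v \<noteq> of_real r" using v zr by auto
      moreover have "(norm (complex_of_real r))\<^sup>2 < 1" using zr(1) r0 by (simp add: abs_square_less_1)
      ultimately show ?thesis by (simp add: poisson_def)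
    qed
    \<comment> \<open>A positive kernel forces some ball of the dyadic bound to contain
      \<open>v\<close>, which makes \<open>Q\<close> finite.\<close>
    with P[OF v] have "(\<Sum>i\<le>Suc J. c i v) \<noteq> 0" by linarith
    then obtain i0 where "c i0 v \<noteq> 0" by (meson sum.neutral)
    from Qle[OF this] have "Q < \<infinity>" using ennreal_less_top le_less_trans by (metis infinity_ennreal_def)
    then obtain Q' where Q': "Q = ennreal Q'" "0 \<le> Q'" by (cases Q) auto
    define q where "q = Q' powr (1 / p)"
    have qp: "q powr p = Q'" using p Q' by (simp add: q_def powr_powr)
    have qle: "q \<le> 72 * Psi (n - i)" if "c i v \<noteq> 0" for i
    proof -
      have "Q' \<le> (72 * Psi (n - i)) powr p" using Qle[OF that] Q' by (simp add: ennreal_le_iff)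
      then have "q \<le> ((72 * Psi (n - i)) powr p) powr (1 / p)"
        unfolding q_def using p Q' by (intro powr_mono2) auto
      then show ?thesis using p Psi_nonneg[of "n - i"] by (simp add: powr_powr)
    qed
    have "(\<integral>\<^sup>+w. ennreal (K v w powr p) \<partial>circ) = (\<integral>\<^sup>+w. ennreal (poisson (of_real r) v powr p) * ennreal (norm (b (v * w) - f (of_real r * w)) powr p) \<partial>circ)"
      unfolding K_def by (intro nn_integral_cong) (simp add: powr_mult poisson_nonneg zr ennreal_mult)
    also have "\<dots> = ennreal (poisson (of_real r) v powr p) * Q"
      unfolding Q_def
    proof (rule nn_integral_cmult)
      have 1: "(\<lambda>w. b (v * w)) \<in> borel_measurable circ" by (rule borel_measurable_circ_rotate[OF v b_measurable])
      have 2: "(\<lambda>w. f (of_real r * w)) \<in> borel_measurable circ"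
        using borel_measurable_circ_continuous[OF continuous_on_dilation(3)[OF f r0 r(2)]] .
      show "(\<lambda>w. ennreal (norm (b (v * w) - f (of_real r * w)) powr p)) \<in> borel_measurable circ" using 1 2 by measurable
    qed
    also have "\<dots> = ennreal ((poisson (of_real r) v * q) powr p)"
    proof -
      have "0 \<le> q" by (simp add: q_def)
      then have "(poisson (of_real r) v * q) powr p = poisson (of_real r) v powr p * Q'"
        by (simp only: powr_mult poisson_nonneg[OF zr(1)] qp)
      then show ?thesis unfolding Q'(1) using Q'(2) by (simp only: ennreal_mult powr_ge_zero)
    qed
    also have "\<dots> \<le> ennreal (d v powr p)"
    proof (intro ennreal_leI powr_mono2)
      have "poisson (of_real r) v * q \<le> (\<Sum>i\<le>Suc J. c i v) * q"
        by (intro mult_right_mono P v) (simp add: q_def)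
      also have "\<dots> = (\<Sum>i\<le>Suc J. c i v * q)" by (rule sum_distrib_right)
      also have "\<dots> \<le> d v" unfolding d_def
      proof (intro sum_mono)
        fix i show "c i v * q \<le> c i v * (72 * Psi (n - i))"
          using qle[of i] c0[of i v] by (cases "c i v = 0") (auto intro!: mult_left_mono)
      qed
      finally show "poisson (of_real r) v * q \<le> d v" .
    qed (use p in \<open>auto simp: poisson_nonneg[OF zr(1)] q_def intro!: mult_nonneg_nonneg\<close>)
    finally show ?thesis .
  qed
  have di: "integrable circ d" unfolding d_def by (intro Bochner_Integration.integrable_sum integrable_mult_left ci)
  have dint: "(LINT v|circ. d v) \<le> 4608 / 2 ^ n * (\<Sum>j\<le>n. 2 ^ j * Psi j)"
  proof -
    have "(LINT v|circ. d v) = (\<Sum>i\<le>Suc J. (LINT v|circ. c i v) * (72 * Psi (n - i)))"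
      unfolding d_def using ci by (subst Bochner_Integration.integral_sum) auto
    also have "\<dots> \<le> (\<Sum>i\<le>Suc J. 32 / 2 ^ i * (72 * Psi (n - i)))"
    proof (intro sum_mono mult_right_mono)
      fix i
      have "measure circ (cball 1 (2 ^ i * h) \<inter> sphere 0 1) \<le> 2 ^ i * h"
        using emeasure_circ_cball[of 1 "2 ^ i * h"] h by (simp add: circ.emeasure_eq_measure ennreal_le_iff)
      then have "32 / (4 ^ i * h) * measure circ (cball 1 (2 ^ i * h) \<inter> sphere 0 1) \<le> 32 / (4 ^ i * h) * (2 ^ i * h)"
        using h by (intro mult_left_mono) auto
      also have "\<dots> = 32 / 2 ^ i"
      proof -
        have "(4::real) ^ i = 2 ^ i * 2 ^ i" by (simp flip: power_mult_distrib)
        then show ?thesis using h by simp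
      qed
      finally show "(LINT v|circ. c i v) \<le> 32 / 2 ^ i" by (simp add: c_def Int_absorb2)
    qed (simp add: Psi_nonneg)
    also have "\<dots> = 2304 * (\<Sum>i\<le>Suc J. Psi (n - i) / 2 ^ i)" by (simp add: sum_distrib_left)
    also have "\<dots> \<le> 2304 * (2 / 2 ^ n * (\<Sum>j\<le>n. 2 ^ j * Psi j))" by (intro mult_left_mono dyadic_sum_le) simp
    finally show ?thesis by simp
  qed
  have "(\<integral>\<^sup>+w. ennreal ((LINT x|circ. poisson (of_real r * w) x * norm (b x - f (of_real r * w))) powr p) \<partial>circ)
     = (\<integral>\<^sup>+w. ennreal ((LINT v|circ. K v w) powr p) \<partial>circ)"
    by (intro nn_integral_cong) (simp add: Ksec)
  also have "\<dots> \<le> ennreal ((LINT v|circ. d v) powr p)"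
  proof (rule minkowski_integral[OF circ.finite_measure_axioms _ p Km])
    show "sigma_finite_measure circ" ..
    show "integrable circ (\<lambda>v. K v w)" if "w \<in> space circ" for w using that by (intro Ki) simp
    show "integrable circ d" by (rule di)
    show "0 \<le> K v w" for v w unfolding K_def by (intro mult_nonneg_nonneg poisson_nonneg zr norm_ge_zero)
    show "(\<integral>\<^sup>+w. ennreal (K v w powr p) \<partial>circ) \<le> ennreal (d v powr p)" if "v \<in> space circ" for v
      using that by (intro Kd) simp
  qed (rule d0)
  also have "\<dots> \<le> ennreal ((4608 / 2 ^ n * (\<Sum>j\<le>n. 2 ^ j * Psi j)) powr p)"
    using p d0 by (intro ennreal_leI powr_mono2 dint integral_nonneg_AE) auto
  finally show ?thesis .
qed

end

subsection \<open>The quantities on the boundary\<close>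

lemma set_integral_lebesgue_circ:
  fixes u :: "complex \<Rightarrow> real"
  assumes u: "u \<in> borel_measurable circ"
  shows "(LINT t:{0..<2*pi}|lebesgue. u (cis t)) = 2 * pi * (LINT x|circ. u x)"
proof -
  have um: "u \<in> borel_measurable (restrict_space borel (sphere 0 1))"
    using u by (simp add: measurable_cong_sets[OF sets_circ refl])
  have "(\<lambda>t. indicator {0..<2*pi} t *\<^sub>R u (cis t)) \<in> borel_measurable lborel"
    using measurable_compose[OF cis_measurable_sphere um] by simp
  then have "(LINT t:{0..<2*pi}|lebesgue. u (cis t)) = (LINT t:{0..<2*pi}|lborel. u (cis t))"
    unfolding set_lebesgue_integral_def by (rule integral_completion)
  then show ?thesis by (simp add: integral_circ(1)[OF u])
qed

lemma integral_mean_eq_pmean: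
  assumes g: "g holomorphic_on ball 0 1" and r: "0 \<le> r" "r < 1"
  shows "integral_mean p r g = pmean p g r"
proof -
  have "(\<lambda>w. norm (g (of_real r * w)) powr p) \<in> borel_measurable circ"
    using borel_measurable_circ_continuous[OF continuous_on_dilation(3)[OF g r]] by measurable
  from set_integral_lebesgue_circ[OF this] show ?thesis
    by (simp add: integral_mean_def pmean_def)
qed

text \<open>x <= 1 + x^p reduces every exponent to means of order 1.\<close>

lemma hardy_space_imp_hardy1:
  assumes f: "f \<in> hardy_space p" and p: "1 \<le> p"
  obtains B where "hardy1 f B"
proof -
  have hol: "f holomorphic_on ball 0 1" and "bdd_above ((\<lambda>r. integral_mean p r f) ` {0..<1})"
    using f by (auto simp: hardy_space_def)
  then obtain S where S: "\<forall>r\<in>{0..<1}. integral_mean p r f \<le> S" by (auto simp: bdd_above_def)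
  have "(LINT w|circ. norm (f (of_real (rho n) * w))) \<le> 1 + S powr p" for n
  proof -
    note c = dilation_integrable(1)[OF hol, of n]
    have i: "integrable circ (\<lambda>w. norm (f (of_real (rho n) * w)) powr p)"
      using p by (intro integrable_circ_continuous continuous_on_powr' continuous_intros c) auto
    have "(LINT w|circ. norm (f (of_real (rho n) * w))) \<le> (LINT w|circ. 1 + norm (f (of_real (rho n) * w)) powr p)"
    proof (intro integral_mono)
      show "integrable circ (\<lambda>w. norm (f (of_real (rho n) * w)))"
        by (intro integrable_circ_continuous continuous_intros c)
      show "integrable circ (\<lambda>w. 1 + norm (f (of_real (rho n) * w)) powr p)" using i by simp
      fix w
      let ?x = "norm (f (of_real (rho n) * w))"
      show "?x \<le> 1 + ?x powr p"
      proof (cases "?x \<le> 1")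
        case False
        then have "?x powr 1 \<le> ?x powr p" using p by (intro powr_mono) auto
        then show ?thesis using False by simp
      qed (simp add: add_increasing2)
    qed
    also have "\<dots> = 1 + (LINT w|circ. norm (f (of_real (rho n) * w)) powr p)"
      using i emeasure_circ_UNIV by (simp add: measure_def)
    also have "(LINT w|circ. norm (f (of_real (rho n) * w)) powr p) = pmean p f (rho n) powr p"
      using p by (simp add: pmean_def powr_powr integral_nonneg_AE)
    also have "\<dots> \<le> S powr p"
      using S[rule_format, of "rho n"] rho[of n] p by (intro powr_mono2) (auto simp: integral_mean_eq_pmean[OF hol] pmean_nonneg)
    finally show ?thesis by simp
  qed
  then show ?thesis using that hol by (auto simp: hardy1_def)
qed

context hardy1
begin

text \<open>Existence of the limit almost everywhere, together with its uniqueness, determines the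
  \<open>THE\<close> in \<open>boundary_value\<close>.\<close>

lemma AE_boundary_value: "AE t in lborel. t \<in> {0..<2*pi} \<longrightarrow> boundary_value f t = b (cis t)"
  using AE_circ_cis[OF hardy_nontangential_limit[OF f B]]
proof eventually_elim
  fix t assume t: "t \<in> {0..<2*pi} \<longrightarrow> has_nontangential_limit f (cis t) (b (cis t))"
  show "t \<in> {0..<2*pi} \<longrightarrow> boundary_value f t = b (cis t)"
  proof
    assume "t \<in> {0..<2*pi}"
    with t have "has_nontangential_limit f (cis t) (b (cis t))" by blast
    then show "boundary_value f t = b (cis t)"
      unfolding boundary_value_def by (rule the_equality) (rule nontangential_limit_eq_radial_limit, auto)
  qed
qed

text \<open>\<open>boundary_value\<close> agrees almost everywhere with the Borel function t -> b
  (cis t); completeness of Lebesgue measure makes it measurable, and the integral passes to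
  \<open>circ\<close>.\<close>

lemma poisson_measure_integral:
  fixes u :: "complex \<Rightarrow> real"
  assumes z: "norm z < 1" and u[measurable]: "u \<in> borel_measurable borel"
  shows "(LINT \<theta>|poisson_measure z. u (boundary_value f \<theta>)) = (LINT v|circ. poisson z v * u (b v))"
proof -
  define k where "k \<theta> = (1 - (norm z)\<^sup>2) / (norm (cis \<theta> - z))\<^sup>2 / (2 * pi)" for \<theta>
  have k0: "0 \<le> k \<theta>" for \<theta>
  proof -
    have "k \<theta> = poisson z (cis \<theta>) / (2 * pi)" by (simp add: k_def poisson_def)
    then show ?thesis using poisson_nonneg[OF z, of "cis \<theta>"] by simp
  qed
  have kb[measurable]: "k \<in> borel_measurable borel"
    unfolding k_def by (intro borel_measurable_divide borel_measurable_const borel_measurable_power borel_measurable_norm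
      borel_measurable_diff borel_measurable_continuous_onI continuous_on_cis continuous_intros)
  have bm: "b \<in> borel_measurable (restrict_space borel (sphere 0 1))"
    using b_measurable by (simp add: measurable_cong_sets[OF sets_circ refl])
  have [measurable]: "(\<lambda>t. b (cis t)) \<in> borel_measurable borel"
    using measurable_compose[OF cis_measurable_sphere bm] .
  let ?I = "indicator {0..<2*pi} :: real \<Rightarrow> real"
  have ae: "AE t in lebesgue. ?I t *\<^sub>R u (b (cis t)) = ?I t *\<^sub>R u (boundary_value f t)"
    using AE_completion[OF AE_boundary_value] by eventually_elim (auto simp: indicator_def)
  have m1: "(\<lambda>t. ?I t *\<^sub>R u (b (cis t))) \<in> borel_measurable lebesgue"
    by (rule measurable_completion) measurable
  have m2: "(\<lambda>t. ?I t *\<^sub>R u (boundary_value f t)) \<in> borel_measurable lebesgue"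
    by (rule borel_measurable_AE[OF m1 ae])
  then have m3: "(\<lambda>t. u (boundary_value f t)) \<in> borel_measurable (lebesgue_on {0..<2*pi})"
    by (subst borel_measurable_restrict_space_iff) auto
  have "(LINT \<theta>|poisson_measure z. u (boundary_value f \<theta>)) = (LINT \<theta>|lebesgue_on {0..<2*pi}. k \<theta> *\<^sub>R u (boundary_value f \<theta>))"
    unfolding poisson_measure_def k_def[symmetric]
  proof (rule integral_density[OF m3])
    show "k \<in> borel_measurable (lebesgue_on {0..<2*pi})"
      by (intro measurable_restrict_space1 measurable_completion) (simp add: kb)
  qed (use k0 in auto)
  also have "\<dots> = (LINT \<theta>|lebesgue. k \<theta> * (?I \<theta> *\<^sub>R u (boundary_value f \<theta>)))"
    by (subst integral_restrict_space) (auto simp: mult_ac)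
  also have "\<dots> = (LINT \<theta>|lebesgue. k \<theta> * (?I \<theta> *\<^sub>R u (b (cis \<theta>))))"
  proof (rule integral_cong_AE)
    have kl: "k \<in> borel_measurable lebesgue" by (rule measurable_completion) (simp add: kb)
    show "(\<lambda>\<theta>. k \<theta> * (?I \<theta> *\<^sub>R u (boundary_value f \<theta>))) \<in> borel_measurable lebesgue"
      by (intro borel_measurable_times kl m2)
    show "(\<lambda>\<theta>. k \<theta> * (?I \<theta> *\<^sub>R u (b (cis \<theta>)))) \<in> borel_measurable lebesgue"
      by (intro borel_measurable_times kl m1)
    show "AE \<theta> in lebesgue. k \<theta> * (?I \<theta> *\<^sub>R u (boundary_value f \<theta>)) = k \<theta> * (?I \<theta> *\<^sub>R u (b (cis \<theta>)))"
      using ae by eventually_elim (simp only:)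
  qed
  also have "\<dots> = (LINT \<theta>|lborel. k \<theta> * (?I \<theta> *\<^sub>R u (b (cis \<theta>))))"
    by (rule integral_completion) measurable
  also have "\<dots> = (LINT \<theta>|lborel. (1 / (2*pi)) * (?I \<theta> *\<^sub>R (poisson z (cis \<theta>) * u (b (cis \<theta>)))))"
    by (intro Bochner_Integration.integral_cong refl) (simp add: k_def poisson_def mult_ac)
  also have "\<dots> = (1 / (2*pi)) *\<^sub>R (LINT \<theta>:{0..<2*pi}|lborel. poisson z (cis \<theta>) * u (b (cis \<theta>)))"
    unfolding set_lebesgue_integral_def by simp
  also have "\<dots> = (LINT v|circ. poisson z v * u (b v))"
  proof -
    note [measurable] = poisson_measurable[OF z]
    have "(\<lambda>v. poisson z v * u (b v)) \<in> borel_measurable circ" by measurable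
    from integral_circ(1)[OF this] show ?thesis by simp
  qed
  finally show ?thesis .
qed

definition abs_average :: "complex \<Rightarrow> real" where "abs_average z = (LINT v|circ. poisson z v * norm (b v))"

definition deviation :: "complex \<Rightarrow> real" where "deviation z = (LINT v|circ. poisson z v * \<bar>norm (b v) - abs_average z\<bar>)"

lemma poisson_mean_norm_eq: "norm z < 1 \<Longrightarrow> poisson_mean_norm f z = abs_average z"
  unfolding poisson_mean_norm_def abs_average_def by (rule poisson_measure_integral) auto

lemma poisson_deviation_eq: "norm z < 1 \<Longrightarrow>
    (LINT \<theta>|poisson_measure z. \<bar>norm (boundary_value f \<theta>) - poisson_mean_norm f z\<bar>) = deviation z"
  unfolding deviation_def by (subst poisson_mean_norm_eq, assumption) (rule poisson_measure_integral, auto)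

lemma poisson_pair_measurable: "(\<lambda>x. poisson (fst x) (snd x)) \<in> borel_measurable (borel \<Otimes>\<^sub>M circ)"
  unfolding poisson_def by measurable

lemma abs_average_measurable [measurable]: "abs_average \<in> borel_measurable borel"
proof -
  have "(\<lambda>x. b (snd x)) \<in> borel_measurable (borel \<Otimes>\<^sub>M circ)" by measurable
  then have "(\<lambda>(z, v). poisson z v * norm (b v)) \<in> borel_measurable (borel \<Otimes>\<^sub>M circ)"
    unfolding case_prod_beta using poisson_pair_measurable by measurable
  then show ?thesis unfolding abs_average_def by (rule circ.borel_measurable_lebesgue_integral)
qed

lemma deviation_measurable [measurable]: "deviation \<in> borel_measurable borel"
proof -
  have "(\<lambda>x. b (snd x)) \<in> borel_measurable (borel \<Otimes>\<^sub>M circ)"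
    "(\<lambda>x. abs_average (fst x)) \<in> borel_measurable (borel \<Otimes>\<^sub>M circ)" by measurable
  then have "(\<lambda>(z, v). poisson z v * \<bar>norm (b v) - abs_average z\<bar>) \<in> borel_measurable (borel \<Otimes>\<^sub>M circ)"
    unfolding case_prod_beta using poisson_pair_measurable by measurable
  then show ?thesis unfolding deviation_def by (rule circ.borel_measurable_lebesgue_integral)
qed

text \<open>The cut-off makes the function Borel measurable on the whole plane.\<close>

definition defect :: "complex \<Rightarrow> real" where "defect z = abs_average z - norm (indicator (ball 0 1) z *\<^sub>R f z)"

lemma defect_measurable [measurable]: "defect \<in> borel_measurable borel"
proof -
  have "(\<lambda>z. indicator (ball 0 1) z *\<^sub>R f z) \<in> borel_measurable borel"
    by (intro borel_measurable_continuous_on_indicator holomorphic_on_imp_continuous_on f) auto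
  then show ?thesis unfolding defect_def by measurable
qed

lemma defect_eq: "norm z < 1 \<Longrightarrow> defect z = abs_average z - norm (f z)"
  by (simp add: defect_def)

lemma defect_nonneg: "norm z < 1 \<Longrightarrow> 0 \<le> defect z"
  using norm_le_poisson[of z] by (simp add: defect_eq abs_average_def)

lemma deviation_nonneg: "norm z < 1 \<Longrightarrow> 0 \<le> deviation z"
  unfolding deviation_def by (intro integral_nonneg_AE AE_I2 mult_nonneg_nonneg poisson_nonneg) auto

lemma derivative_le_defect_deviation:
  assumes z: "norm z < 1"
  shows "(1 - norm z) * norm (deriv f z) \<le> 2 * defect z + 2 * deviation z"
proof -
  have "(1 - norm z) \<le> 1 - (norm z)\<^sup>2" using z by (simp add: power2_eq_square mult_left_le)
  then have "(1 - norm z) * norm (deriv f z) \<le> (1 - (norm z)\<^sup>2) * norm (deriv f z)" by (intro mult_right_mono) auto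
  \<comment> \<open>The free constant \<open>m\<close> is now the Poisson average itself.\<close>
  also have "\<dots> \<le> 2 * defect z + 2 * deviation z"
    using derivative_bound_radial_limit[OF z, of "abs_average z"] by (simp add: defect_eq[OF z] abs_average_def[symmetric] deviation_def)
  finally show ?thesis .
qed

definition oscillation :: "complex \<Rightarrow> real" where "oscillation z = (LINT v|circ. poisson z v * norm (b v - f z))"

text \<open>Comparing |b| with |f(z)| costs at most the oscillation; in the deviation the centre
  |f(z)| is moved to the average, which costs the defect once more.\<close>

lemma defect_le_oscillation: "norm z < 1 \<Longrightarrow> defect z \<le> oscillation z"
  and deviation_le_oscillation: "norm z < 1 \<Longrightarrow> deviation z \<le> 2 * oscillation z"
proof -
  assume z: "norm z < 1"
  have ip: "integrable circ (\<lambda>v. poisson z v * c)" for c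
    by (intro integrable_circ_continuous continuous_intros continuous_on_poisson z)
  have *: "integrable circ (\<lambda>v. poisson z v * u (b v))" if "\<And>x y. \<bar>u x - u y\<bar> \<le> norm (x - y)" for u :: "complex \<Rightarrow> real"
    using poisson_limit(2)[OF z, of u] that by blast
  have n3: "\<bar>norm x - norm y\<bar> \<le> norm (x - y)" for x y :: complex by (rule norm_triangle_ineq3)
  have i1: "integrable circ (\<lambda>v. poisson z v * norm (b v))" by (rule *) (rule n3)
  have i2: "integrable circ (\<lambda>v. poisson z v * norm (b v - f z))"
    by (rule *[of "\<lambda>x. norm (x - f z)"]) (use n3[of "x - f z" "y - f z" for x y] in simp)
  have i3: "integrable circ (\<lambda>v. poisson z v * \<bar>norm (b v) - c\<bar>)" for c
    by (rule *[of "\<lambda>x. \<bar>norm x - c\<bar>"]) (use n3 in \<open>smt (verit)\<close>)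
  have pc: "(LINT v|circ. poisson z v * c) = c" for c using integral_poisson[OF z] by simp
  have "defect z = (LINT v|circ. poisson z v * norm (b v) - poisson z v * norm (f z))"
    by (subst Bochner_Integration.integral_diff[OF i1 ip]) (simp add: defect_eq[OF z] abs_average_def integral_poisson[OF z])
  also have "\<dots> \<le> oscillation z" unfolding oscillation_def
  proof (intro integral_mono Bochner_Integration.integrable_diff i1 ip i2)
    fix v
    have "poisson z v * (norm (b v) - norm (f z)) \<le> poisson z v * norm (b v - f z)"
      using n3[of "b v" "f z"] by (intro mult_left_mono poisson_nonneg z) linarith
    then show "poisson z v * norm (b v) - poisson z v * norm (f z) \<le> poisson z v * norm (b v - f z)"
      by (simp add: right_diff_distrib)
  qed
  finally show A: "defect z \<le> oscillation z" .
  have "deviation z \<le> (LINT v|circ. poisson z v * norm (b v - f z) + poisson z v * defect z)" unfolding deviation_def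
  proof (intro integral_mono Bochner_Integration.integrable_add i2 i3 ip)
    fix v
    have "\<bar>norm (b v) - abs_average z\<bar> \<le> norm (b v - f z) + defect z"
      using n3[of "b v" "f z"] defect_nonneg[OF z] by (simp add: defect_eq[OF z])
    from mult_left_mono[OF this poisson_nonneg[OF z, of v]]
    show "poisson z v * \<bar>norm (b v) - abs_average z\<bar> \<le> poisson z v * norm (b v - f z) + poisson z v * defect z"
      by (simp add: distrib_left)
  qed
  also have "\<dots> = oscillation z + defect z" using i2 ip pc by (simp add: oscillation_def)
  finally show "deviation z \<le> 2 * oscillation z" using A by simp
qed

text \<open>The bounds keep the angular integrals finite: a Bochner integral of a non-integrable function would be 0.\<close>

lemma defect_deviation_bounded:
  assumes r: "0 \<le> r" "r < 1"
  obtains c where "\<And>w. norm w = 1 \<Longrightarrow> defect (of_real r * w) \<le> c" "\<And>w. norm w = 1 \<Longrightarrow> deviation (of_real r * w) \<le> c"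
proof -
  define L where "L = (LINT v|circ. norm (b v))"
  have i: "integrable circ (\<lambda>v. norm (b v))" using b_integrable by simp
  have L0: "0 \<le> L" unfolding L_def by (intro integral_nonneg_AE) auto
  define c where "c = 2 / (1 - r) * L"
  \<comment> \<open>The maximum of the kernel is (1 + r) / (1 - r).\<close>
  have P: "poisson (of_real r * w) v \<le> 2 / (1 - r)" if w: "norm w = 1" and v: "norm v = 1" for w v
  proof -
    have d: "1 - r \<le> norm (v - of_real r * w)"
      using norm_triangle_ineq2[of v "of_real r * w"] w v r by (simp add: norm_mult)
    have "(1 - r)\<^sup>2 \<le> (norm (v - of_real r * w))\<^sup>2" using r d by (intro power_mono) auto
    then have "poisson (of_real r * w) v \<le> (1 - r\<^sup>2) / (1 - r)\<^sup>2"
      using r w unfolding poisson_def by (intro frac_le) (auto simp: norm_mult power_le_one)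
    also have "1 - r\<^sup>2 = (1 - r) * (1 + r)" by (simp add: power2_eq_square algebra_simps)
    also have "(1 - r) * (1 + r) / (1 - r)\<^sup>2 = (1 + r) / (1 - r)"
      using r by (simp add: power2_eq_square)
    also have "\<dots> \<le> 2 / (1 - r)" using r by (intro divide_right_mono) auto
    finally show ?thesis .
  qed
  have z: "norm (of_real r * w) < 1" if "norm w = 1" for w :: complex using that r by (simp add: norm_mult)
  have abs_average_le: "abs_average (of_real r * w) \<le> c" if w: "norm w = 1" for w
  proof -
    have "abs_average (of_real r * w) \<le> (LINT v|circ. 2 / (1 - r) * norm (b v))"
      unfolding abs_average_def
    proof (rule integral_mono)
      show "integrable circ (\<lambda>v. poisson (of_real r * w) v * norm (b v))"
        using integrable_poisson_mult[OF z[OF w] i] by simp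
      show "integrable circ (\<lambda>v. 2 / (1 - r) * norm (b v))" by (rule integrable_mult_right) (rule i)
    qed (intro mult_right_mono P w, auto)
    then show ?thesis by (simp add: c_def L_def)
  qed
  have oscillation: "defect (of_real r * w) \<le> c" if w: "norm w = 1" for w
    using abs_average_le[OF w] norm_ge_zero[of "f (of_real r * w)"] unfolding defect_eq[OF z[OF w]] by linarith
  have Dl: "deviation (of_real r * w) \<le> 2 * c" if w: "norm w = 1" for w
  proof -
    let ?z = "of_real r * w"
    have ip: "integrable circ (\<lambda>v. poisson ?z v * abs_average ?z)"
      by (intro integrable_circ_continuous continuous_intros continuous_on_poisson z w)
    have i1: "integrable circ (\<lambda>v. poisson ?z v * norm (b v))"
      using integrable_poisson_mult[OF z[OF w] i] by simp
    have Pb0: "0 \<le> abs_average ?z" unfolding abs_average_def by (intro integral_nonneg_AE AE_I2 mult_nonneg_nonneg poisson_nonneg z w) auto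
    have "deviation ?z \<le> (LINT v|circ. poisson ?z v * norm (b v) + poisson ?z v * abs_average ?z)"
      unfolding deviation_def
    proof (rule integral_mono)
      show "integrable circ (\<lambda>v. poisson ?z v * norm (b v) + poisson ?z v * abs_average ?z)" using i1 ip by simp
      show "integrable circ (\<lambda>v. poisson ?z v * \<bar>norm (b v) - abs_average ?z\<bar>)"
        using integrable_poisson_mult[OF z[OF w], of "\<lambda>v. \<bar>norm (b v) - abs_average ?z\<bar>"] i by simp
      fix v
      have "\<bar>norm (b v) - abs_average ?z\<bar> \<le> norm (b v) + abs_average ?z" using Pb0 norm_ge_zero[of "b v"] by linarith
      from mult_left_mono[OF this poisson_nonneg[OF z[OF w], of v]]
      show "poisson ?z v * \<bar>norm (b v) - abs_average ?z\<bar> \<le> poisson ?z v * norm (b v) + poisson ?z v * abs_average ?z"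
        by (simp add: distrib_left)
    qed
    also have "\<dots> = 2 * abs_average ?z" using i1 ip integral_poisson[OF z[OF w]] by (simp add: abs_average_def)
    also have "\<dots> \<le> 2 * c" using abs_average_le[OF w] by simp
    finally show ?thesis .
  qed
  have "0 \<le> c" using L0 r by (simp add: c_def)
  then show ?thesis
    by (intro that[of "2 * c"]) (use oscillation Dl in \<open>auto intro: order_trans[of _ c]\<close>)
qed

lemma circle_integral_eq:
  fixes u :: "complex \<Rightarrow> real"
  assumes [measurable]: "u \<in> borel_measurable borel"
  shows "(LINT t:{0..<2*pi}|lebesgue. u (of_real r * cis t)) = 2 * pi * (LINT w|circ. u (of_real r * w))"
proof (rule set_integral_lebesgue_circ)
  have "(\<lambda>w. w) \<in> borel_measurable circ" by (intro borel_measurable_circ_continuous continuous_intros)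
  then show "(\<lambda>w. u (of_real r * w)) \<in> borel_measurable circ" by measurable
qed

end

subsection \<open>Comparison of the integrals\<close>

text \<open>Through the maximum, hence for every positive \<open>s\<close>: q / p may be less than
  1.\<close>

lemma add2_powr_le:
  fixes x y s :: real
  assumes "0 \<le> x" "0 \<le> y" "0 < s"
  shows "(x + y) powr s \<le> 2 powr s * (x powr s + y powr s)"
proof -
  have "(x + y) powr s \<le> (2 * max x y) powr s" using assms by (intro powr_mono2) auto
  also have "\<dots> = 2 powr s * max x y powr s" using assms by (simp add: powr_mult)
  also have "max x y powr s \<le> x powr s + y powr s" by (simp add: max_def)
  finally show ?thesis by simp
qed

context hardy1
begin

definition mean_defect :: "real \<Rightarrow> real \<Rightarrow> real" where "mean_defect p r = (LINT w|circ. defect (of_real r * w) powr p)"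

definition mean_deviation :: "real \<Rightarrow> real \<Rightarrow> real" where "mean_deviation p r = (LINT w|circ. deviation (of_real r * w) powr p)"

text \<open>The radial integrand of \<open>F1\<close> and \<open>F2\<close> without the weight,
  \<open>x\<close> being a mean over \<open>circ\<close>; the factor 2 pi undoes the
  normalisation.\<close>

definition profile :: "real \<Rightarrow> real \<Rightarrow> real \<Rightarrow> real \<Rightarrow> real" where
  "profile p q x r = (2 * pi * x) powr (q / p) / (1 - r) powr q"

lemma mean_nonneg: "0 \<le> mean_defect p r" "0 \<le> mean_deviation p r"
  unfolding mean_defect_def mean_deviation_def by (auto intro!: integral_nonneg_AE)

lemma mean_measurable: "mean_defect p \<in> borel_measurable borel" "mean_deviation p \<in> borel_measurable borel"
proof -
  have "(\<lambda>(r, w). defect (of_real r * w) powr p) \<in> borel_measurable (borel \<Otimes>\<^sub>M circ)"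
    "(\<lambda>(r, w). deviation (of_real r * w) powr p) \<in> borel_measurable (borel \<Otimes>\<^sub>M circ)"
    unfolding case_prod_beta by measurable
  then show "mean_defect p \<in> borel_measurable borel" "mean_deviation p \<in> borel_measurable borel"
    unfolding mean_defect_def[abs_def] mean_deviation_def[abs_def] by (auto intro: circ.borel_measurable_lebesgue_integral)
qed

lemma F1_eq: "F1 p q \<nu> f = (\<integral>\<^sup>+r\<in>{0..<1}. ennreal (profile p q (mean_defect p r) r * \<nu> (of_real r)) \<partial>lebesgue)"
  unfolding F1_def
proof (intro nn_integral_cong)
  fix r :: real
  show "ennreal ((LINT t:{0..<2*pi}|lebesgue. (poisson_mean_norm f (of_real r * cis t) - norm (f (of_real r * cis t))) powr p) powr (q / p)
      * (\<nu> (of_real r) / (1 - r) powr q)) * indicator {0..<1} r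
    = ennreal (profile p q (mean_defect p r) r * \<nu> (of_real r)) * indicator {0..<1} r"
  proof (cases "r \<in> {0..<1}")
    case True
    then have z: "norm (of_real r * cis t) < 1" for t by (simp add: norm_mult)
    have "(LINT t:{0..<2*pi}|lebesgue. (poisson_mean_norm f (of_real r * cis t) - norm (f (of_real r * cis t))) powr p)
      = (LINT t:{0..<2*pi}|lebesgue. defect (of_real r * cis t) powr p)"
      by (simp only: poisson_mean_norm_eq[OF z] defect_eq[OF z])
    also have "\<dots> = 2 * pi * mean_defect p r"
      unfolding mean_defect_def by (rule circle_integral_eq[of "\<lambda>z. defect z powr p"]) measurable
    finally show ?thesis by (simp add: profile_def)
  qed simp
qed

lemma F2_eq: "F2 p q \<nu> f = (\<integral>\<^sup>+r\<in>{0..<1}. ennreal (profile p q (mean_deviation p r) r * \<nu> (of_real r)) \<partial>lebesgue)"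
  unfolding F2_def
proof (intro nn_integral_cong)
  fix r :: real
  show "ennreal ((LINT t:{0..<2*pi}|lebesgue. (LINT \<theta>|poisson_measure (of_real r * cis t).
           \<bar>norm (boundary_value f \<theta>) - poisson_mean_norm f (of_real r * cis t)\<bar>) powr p) powr (q / p)
      * (\<nu> (of_real r) / (1 - r) powr q)) * indicator {0..<1} r
    = ennreal (profile p q (mean_deviation p r) r * \<nu> (of_real r)) * indicator {0..<1} r"
  proof (cases "r \<in> {0..<1}")
    case True
    then have z: "norm (of_real r * cis t) < 1" for t by (simp add: norm_mult)
    have "(LINT t:{0..<2*pi}|lebesgue. (LINT \<theta>|poisson_measure (of_real r * cis t).
           \<bar>norm (boundary_value f \<theta>) - poisson_mean_norm f (of_real r * cis t)\<bar>) powr p)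
      = (LINT t:{0..<2*pi}|lebesgue. deviation (of_real r * cis t) powr p)"
      by (simp only: poisson_deviation_eq[OF z])
    also have "\<dots> = 2 * pi * mean_deviation p r"
      unfolding mean_deviation_def by (rule circle_integral_eq[of "\<lambda>z. deviation z powr p"]) measurable
    finally show ?thesis by (simp add: profile_def)
  qed simp
qed

text \<open>Splitting the sum of defect and deviation under the power p costs 2^p beside the 2^p of
  the pointwise bound, together 4^q after the outer power; splitting again under the power q / p
  costs 2^(q/p).\<close>

lemma pmean_deriv_le_profiles:
  assumes p: "1 \<le> p" and q: "0 < q" and r: "0 \<le> r" "r < 1"
  shows "pmean p (deriv f) r powr q \<le>
    4 powr q * 2 powr (q / p) * (profile p q (mean_defect p r) r + profile p q (mean_deviation p r) r)"
proof -
  have df: "deriv f holomorphic_on ball 0 1" by (intro holomorphic_deriv f open_ball)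
  have z: "norm (of_real r * w) < 1" if "norm w = 1" for w :: complex using that r by (simp add: norm_mult)
  obtain c where c: "\<And>w. norm w = 1 \<Longrightarrow> defect (of_real r * w) \<le> c" "\<And>w. norm w = 1 \<Longrightarrow> deviation (of_real r * w) \<le> c"
    using defect_deviation_bounded[OF r] by blast
  have idm: "(\<lambda>w. w) \<in> borel_measurable circ" by (intro borel_measurable_circ_continuous continuous_intros)
  have iA: "integrable circ (\<lambda>w. defect (of_real r * w) powr p)"
  proof (rule circ.integrable_const_bound[where B = "c powr p"])
    show "AE w in circ. norm (defect (of_real r * w) powr p) \<le> c powr p"
      using c(1) defect_nonneg z p by (intro AE_I2) (auto intro!: powr_mono2)
    show "(\<lambda>w. defect (of_real r * w) powr p) \<in> borel_measurable circ" using idm by measurable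
  qed
  have iD: "integrable circ (\<lambda>w. deviation (of_real r * w) powr p)"
  proof (rule circ.integrable_const_bound[where B = "c powr p"])
    show "AE w in circ. norm (deviation (of_real r * w) powr p) \<le> c powr p"
      using c(2) deviation_nonneg z p by (intro AE_I2) (auto intro!: powr_mono2)
    show "(\<lambda>w. deviation (of_real r * w) powr p) \<in> borel_measurable circ" using idm by measurable
  qed
  define I where "I = (LINT w|circ. norm (deriv f (of_real r * w)) powr p)"
  have I0: "0 \<le> I" unfolding I_def by (intro integral_nonneg_AE) auto
  have "(1 - r) powr p * I = (LINT w|circ. (1 - r) powr p * norm (deriv f (of_real r * w)) powr p)"
    by (simp add: I_def)
  also have "\<dots> \<le> (LINT w|circ. 4 powr p * (defect (of_real r * w) powr p + deviation (of_real r * w) powr p))"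
  proof (intro integral_mono)
    show "integrable circ (\<lambda>w. (1 - r) powr p * norm (deriv f (of_real r * w)) powr p)"
      using p by (intro integrable_circ_continuous continuous_on_powr' continuous_intros continuous_on_dilation(3)[OF df r]) auto
    show "integrable circ (\<lambda>w. 4 powr p * (defect (of_real r * w) powr p + deviation (of_real r * w) powr p))"
      using iA iD by simp
    fix w assume "w \<in> space circ"
    then have w: "norm w = 1" by simp
    let ?z = "of_real r * w"
    have nz: "norm ?z = r" using r w by (simp add: norm_mult)
    have "(1 - r) powr p * norm (deriv f ?z) powr p = ((1 - r) * norm (deriv f ?z)) powr p"
      using r by (simp add: powr_mult)
    also have "\<dots> \<le> (2 * defect ?z + 2 * deviation ?z) powr p"
      using derivative_le_defect_deviation[OF z[OF w]] r p unfolding nz by (intro powr_mono2) auto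
    also have "\<dots> \<le> 2 powr p * ((2 * defect ?z) powr p + (2 * deviation ?z) powr p)"
      using defect_nonneg[OF z[OF w]] deviation_nonneg[OF z[OF w]] p by (intro add2_powr_le) auto
    also have "\<dots> = (2 * 2) powr p * (defect ?z powr p + deviation ?z powr p)"
      using defect_nonneg[OF z[OF w]] deviation_nonneg[OF z[OF w]] by (simp only: powr_mult[of 2 2 p] powr_mult[of 2 "defect ?z" p] powr_mult[of 2 "deviation ?z" p]) (simp add: algebra_simps)
    finally show "(1 - r) powr p * norm (deriv f ?z) powr p \<le> 4 powr p * (defect ?z powr p + deviation ?z powr p)" by simp
  qed
  also have "\<dots> = 4 powr p * (mean_defect p r + mean_deviation p r)" using iA iD by (simp add: mean_defect_def mean_deviation_def)
  finally have le: "(1 - r) powr p * I \<le> 4 powr p * (mean_defect p r + mean_deviation p r)" .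
  have "(1 - r) powr q * pmean p (deriv f) r powr q = ((1 - r) powr p * I) powr (q / p)"
    using p I0 r by (simp add: pmean_def I_def[symmetric] powr_mult powr_powr)
  also have "\<dots> \<le> (4 powr p * (mean_defect p r + mean_deviation p r)) powr (q / p)"
    using p q I0 by (intro powr_mono2 le) auto
  also have "\<dots> = 4 powr q * (mean_defect p r + mean_deviation p r) powr (q / p)"
    using p mean_nonneg by (simp add: powr_mult powr_powr)
  also have "\<dots> \<le> 4 powr q * (2 powr (q / p) * (mean_defect p r powr (q / p) + mean_deviation p r powr (q / p)))"
    using p q mean_nonneg by (intro mult_left_mono add2_powr_le) auto
  \<comment> \<open>\<open>F1\<close> and \<open>F2\<close> integrate over the unnormalised angle,
    so a factor 2 pi >= 1 is inserted.\<close>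
  also have "\<dots> \<le> 4 powr q * (2 powr (q / p) * ((2 * pi * mean_defect p r) powr (q / p) + (2 * pi * mean_deviation p r) powr (q / p)))"
  proof -
    have "1 \<le> 2 * pi" using pi_gt3 by simp
    then have "x \<le> 2 * pi * x" if "0 \<le> x" for x using mult_right_mono[of 1 "2 * pi" x] that by simp
    then show ?thesis using p q mean_nonneg by (intro mult_left_mono add_mono powr_mono2) auto
  qed
  finally have "pmean p (deriv f) r powr q \<le> 4 powr q * (2 powr (q / p) * ((2 * pi * mean_defect p r) powr (q / p) + (2 * pi * mean_deviation p r) powr (q / p))) / (1 - r) powr q"
    using r by (simp add: pos_le_divide_eq mult.commute)
  then show ?thesis unfolding profile_def add_divide_distrib[symmetric] by (simp add: mult.assoc)
qed

lemma profile_measurable: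
  assumes [measurable]: "x \<in> borel_measurable borel"
  shows "set_borel_measurable borel {0..<1} (\<lambda>r. profile p q (x r) r)"
  unfolding set_borel_measurable_def profile_def by measurable

text \<open>Splitting the integral of a sum asks for measurable integrands, so it is done over
  \<open>\<mu>\<close>, between a change from the profile of the weight to this measure and
  back.\<close>

lemma mixed_norm_le_F1_F2:
  assumes p: "1 \<le> p" and q: "0 < q" and nn: "\<And>z. z \<in> ball 0 1 \<Longrightarrow> 0 \<le> \<nu> z"
    and mu: "sets \<mu> = sets borel"
      "\<And>a :: real \<Rightarrow> real. set_borel_measurable borel {0..<1} a \<Longrightarrow> (\<And>r. r \<in> {0..<1} \<Longrightarrow> 0 \<le> a r) \<Longrightarrow>
      (\<integral>\<^sup>+r\<in>{0..<1}. ennreal (a r * \<nu> (of_real r)) \<partial>lebesgue) = (\<integral>\<^sup>+r\<in>{0..<1}. ennreal (a r) \<partial>\<mu>)"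
  shows "mixed_norm_power p q \<nu> (deriv f) \<le> ennreal (4 powr q * 2 powr (q / p)) * (F1 p q \<nu> f + F2 p q \<nu> f)"
proof -
  define C where "C = 4 powr q * 2 powr (q / p)"
  define x where "x r = profile p q (mean_defect p r) r" for r
  define y where "y r = profile p q (mean_deviation p r) r" for r
  have C0: "0 \<le> C" by (simp add: C_def)
  have x0: "0 \<le> x r" and y0: "0 \<le> y r" for r by (auto simp: x_def y_def profile_def)
  have xm: "set_borel_measurable borel {0..<1} x" and ym: "set_borel_measurable borel {0..<1} y"
    unfolding x_def y_def by (intro profile_measurable mean_measurable)+
  have df: "deriv f holomorphic_on ball 0 1" by (intro holomorphic_deriv f open_ball)
  have M: "(\<lambda>r. ennreal (x r) * indicator {0..<1} r) \<in> borel_measurable \<mu>" "(\<lambda>r. ennreal (y r) * indicator {0..<1} r) \<in> borel_measurable \<mu>"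
  proof -
    have *: "ennreal (u r) * indicator {0..<1} r = ennreal (indicator {0..<1} r *\<^sub>R u r)" for u and r :: real
      by (simp add: indicator_def)
    show "(\<lambda>r. ennreal (x r) * indicator {0..<1} r) \<in> borel_measurable \<mu>" "(\<lambda>r. ennreal (y r) * indicator {0..<1} r) \<in> borel_measurable \<mu>"
      using xm ym unfolding * set_borel_measurable_def measurable_cong_sets[OF mu(1) refl] by measurable
  qed
  have "mixed_norm_power p q \<nu> (deriv f) \<le> (\<integral>\<^sup>+r\<in>{0..<1}. ennreal (C * (x r + y r) * \<nu> (of_real r)) \<partial>lebesgue)"
    unfolding mixed_norm_power_def
  proof (intro nn_integral_mono)
    fix r :: real
    show "ennreal (integral_mean p r (deriv f) powr q * \<nu> (of_real r)) * indicator {0..<1} r \<le> ennreal (C * (x r + y r) * \<nu> (of_real r)) * indicator {0..<1} r"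
    proof (cases "r \<in> {0..<1}")
      case True
      then have "pmean p (deriv f) r powr q \<le> C * (x r + y r)"
        unfolding C_def x_def y_def by (intro pmean_deriv_le_profiles p q) auto
      then have "integral_mean p r (deriv f) powr q * \<nu> (of_real r) \<le> C * (x r + y r) * \<nu> (of_real r)"
        using True nn[of "of_real r"] by (intro mult_right_mono) (auto simp: integral_mean_eq_pmean[OF df])
      from ennreal_leI[OF this] show ?thesis using True by simp
    qed simp
  qed
  also have "\<dots> = (\<integral>\<^sup>+r\<in>{0..<1}. ennreal (C * (x r + y r)) \<partial>\<mu>)"
  proof (rule mu(2))
    have "(\<lambda>r. C * (indicator {0..<1} r *\<^sub>R x r + indicator {0..<1} r *\<^sub>R y r)) \<in> borel_measurable borel"
      using xm ym unfolding set_borel_measurable_def by measurable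
    then show "set_borel_measurable borel {0..<1} (\<lambda>r. C * (x r + y r))"
      by (simp add: set_borel_measurable_def algebra_simps)
  qed (use C0 x0 y0 in auto)
  also have "\<dots> = (\<integral>\<^sup>+r. ennreal C * (ennreal (x r) * indicator {0..<1} r + ennreal (y r) * indicator {0..<1} r) \<partial>\<mu>)"
    using C0 x0 y0 by (intro nn_integral_cong) (auto simp: indicator_def ennreal_mult)
  also have "\<dots> = ennreal C * ((\<integral>\<^sup>+r\<in>{0..<1}. ennreal (x r) \<partial>\<mu>) + (\<integral>\<^sup>+r\<in>{0..<1}. ennreal (y r) \<partial>\<mu>))"
    using M by (simp add: nn_integral_cmult nn_integral_add)
  also have "\<dots> = ennreal C * (F1 p q \<nu> f + F2 p q \<nu> f)"
    unfolding F1_eq F2_eq x_def[symmetric] y_def[symmetric] using mu(2)[OF xm] mu(2)[OF ym] x0 y0 by simp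
  finally show ?thesis by (simp add: C_def)
qed

end

context hardy1_summable
begin

text \<open>Divided by 2^n it is, up to a constant, the L^p bound for the oscillation on ring
  \<open>n\<close>.\<close>

definition Sb :: "nat \<Rightarrow> real" where "Sb n = (\<Sum>j\<le>n. 2 ^ j * Psi j)"

lemma Sb_nonneg: "0 \<le> Sb n"
  unfolding Sb_def by (intro sum_nonneg mult_nonneg_nonneg Psi_nonneg) auto

text \<open>The factor 2^-n in the L^p bound compensates (1 - r)^-q, as 1 - r >= 2^-(n+1) on the
  ring. The constant is 2 * 2 * 4608 = 18432: one 2 from the comparison with the oscillation, one
  from 2^(n+1).\<close>

lemma profiles_le:
  assumes q: "0 < q" and r: "dyadic n \<le> r" "r < dyadic (Suc n)"
  shows "profile p q (mean_defect p r) r \<le> (2 * pi) powr (q / p) * 18432 powr q * Sb n powr q"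
    "profile p q (mean_deviation p r) r \<le> (2 * pi) powr (q / p) * 18432 powr q * Sb n powr q"
proof -
  have r1: "0 \<le> r" "r < 1" using r dyadic(1)[of n] dyadic(2)[of "Suc n"] by auto
  have z: "norm (of_real r * w) < 1" if "norm w = 1" for w :: complex using that r1 by (simp add: norm_mult)
  define E where "E = 4608 / 2 ^ n * Sb n"
  have E0: "0 \<le> E" using Sb_nonneg by (simp add: E_def)
  have Eb0: "0 \<le> oscillation z" if "norm z < 1" for z
    using defect_nonneg[OF that] defect_le_oscillation[OF that] by linarith
  have EbE: "(\<integral>\<^sup>+w. ennreal (oscillation (of_real r * w) powr p) \<partial>circ) \<le> ennreal (E powr p)"
    unfolding oscillation_def E_def Sb_def by (rule poisson_deviation) (use r r1 in auto)
  have bound: "(LINT w|circ. u (of_real r * w) powr p) \<le> (2 * E) powr p"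
    if u: "\<And>z. norm z < 1 \<Longrightarrow> 0 \<le> u z" "\<And>z. norm z < 1 \<Longrightarrow> u z \<le> 2 * oscillation z" for u :: "complex \<Rightarrow> real"
  proof (rule integral_real_bounded)
    have "(\<integral>\<^sup>+w. ennreal (u (of_real r * w) powr p) \<partial>circ) \<le> (\<integral>\<^sup>+w. ennreal (2 powr p * oscillation (of_real r * w) powr p) \<partial>circ)"
    proof (intro nn_integral_mono ennreal_leI)
      fix w assume "w \<in> space circ"
      then have zw: "norm (of_real r * w) < 1" by (intro z) simp
      have "u (of_real r * w) powr p \<le> (2 * oscillation (of_real r * w)) powr p"
        using u[OF zw] p by (intro powr_mono2) auto
      then show "u (of_real r * w) powr p \<le> 2 powr p * oscillation (of_real r * w) powr p"
        using Eb0[OF zw] by (simp add: powr_mult)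
    qed
    also have "\<dots> = ennreal (2 powr p) * (\<integral>\<^sup>+w. ennreal (oscillation (of_real r * w) powr p) \<partial>circ)"
    proof -
      \<comment> \<open>Outside the disc \<open>f\<close> is arbitrary, so measurability is claimed
        on the disc only.\<close>
      have "oscillation \<in> borel_measurable (restrict_space borel (ball 0 1))"
      proof -
        define f0 where "f0 z = indicator (ball 0 1) z *\<^sub>R f z" for z
        have f0[measurable]: "f0 \<in> borel_measurable borel" unfolding f0_def
          by (intro borel_measurable_continuous_on_indicator holomorphic_on_imp_continuous_on f) auto
        have "(\<lambda>x. b (snd x)) \<in> borel_measurable (borel \<Otimes>\<^sub>M circ)" "(\<lambda>x. f0 (fst x)) \<in> borel_measurable (borel \<Otimes>\<^sub>M circ)" by measurable
        then have "(\<lambda>(z, v). poisson z v * norm (b v - f0 z)) \<in> borel_measurable (borel \<Otimes>\<^sub>M circ)"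
          unfolding case_prod_beta using poisson_pair_measurable by measurable
        then have "(\<lambda>z. LINT v|circ. poisson z v * norm (b v - f0 z)) \<in> borel_measurable borel"
          by (rule circ.borel_measurable_lebesgue_integral)
        then have "(\<lambda>z. LINT v|circ. poisson z v * norm (b v - f0 z)) \<in> borel_measurable (restrict_space borel (ball 0 1))"
          by (rule measurable_restrict_space1)
        moreover have "oscillation \<in> borel_measurable (restrict_space borel (ball 0 1)) \<longleftrightarrow>
          (\<lambda>z. LINT v|circ. poisson z v * norm (b v - f0 z)) \<in> borel_measurable (restrict_space borel (ball 0 1))"
          by (intro measurable_cong) (simp add: oscillation_def f0_def space_restrict_space)
        ultimately show ?thesis by simp
      qed
      moreover have "(\<lambda>w. of_real r * w) \<in> circ \<rightarrow>\<^sub>M restrict_space borel (ball 0 1)"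
        using z by (intro measurable_restrict_space2 borel_measurable_circ_continuous continuous_intros) auto
      ultimately have "(\<lambda>w. oscillation (of_real r * w)) \<in> borel_measurable circ"
        by (rule measurable_compose[rotated])
      then have "(\<lambda>w. ennreal (oscillation (of_real r * w) powr p)) \<in> borel_measurable circ" by measurable
      then show ?thesis by (simp add: ennreal_mult nn_integral_cmult)
    qed
    also have "\<dots> \<le> ennreal (2 powr p) * ennreal (E powr p)" by (intro mult_left_mono EbE) auto
    also have "\<dots> = ennreal ((2 * E) powr p)" using E0 by (simp add: powr_mult ennreal_mult)
    finally show "(\<integral>\<^sup>+w. ennreal (u (of_real r * w) powr p) \<partial>circ) \<le> ennreal ((2 * E) powr p)" .
  qed simp
  have prof: "profile p q x r \<le> (2 * pi) powr (q / p) * 18432 powr q * Sb n powr q"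
    if x: "0 \<le> x" "x \<le> (2 * E) powr p" for x
  proof -
    have h: "1 / 2 ^ Suc n \<le> 1 - r" using r(2) by (simp add: dyadic_def)
    have "profile p q x r \<le> (2 * pi * (2 * E) powr p) powr (q / p) / (1 / 2 ^ Suc n) powr q"
      unfolding profile_def using p q x h r1 by (intro frac_le powr_mono2 mult_left_mono) auto
    also have "\<dots> = (2 * pi) powr (q / p) * ((2 * E) powr q * (2 ^ Suc n) powr q)"
      using p E0 by (simp add: powr_mult powr_powr powr_divide)
    also have "(2 * E) powr q * (2 ^ Suc n) powr q = (2 * E * 2 ^ Suc n) powr q"
      using E0 by (intro powr_mult[symmetric])
    also have "2 * E * 2 ^ Suc n = 18432 * Sb n" by (simp add: E_def)
    also have "(18432 * Sb n) powr q = 18432 powr q * Sb n powr q" using Sb_nonneg by (intro powr_mult)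
    finally show ?thesis by simp
  qed
  show "profile p q (mean_defect p r) r \<le> (2 * pi) powr (q / p) * 18432 powr q * Sb n powr q"
  proof (rule prof[OF mean_nonneg(1)])
    show "mean_defect p r \<le> (2 * E) powr p" unfolding mean_defect_def
      using defect_nonneg defect_le_oscillation Eb0 by (intro bound) fastforce+
  qed
  show "profile p q (mean_deviation p r) r \<le> (2 * pi) powr (q / p) * 18432 powr q * Sb n powr q"
  proof (rule prof[OF mean_nonneg(2)])
    show "mean_deviation p r \<le> (2 * E) powr p" unfolding mean_deviation_def
      using deviation_nonneg deviation_le_oscillation by (intro bound) auto
  qed
qed

end

section \<open>Step functions on dyadic rings and the conclusion\<close>

definition dyadic_index :: "real \<Rightarrow> nat" where
  "dyadic_index r = (LEAST n. r < dyadic (Suc n))"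

lemma dyadic_index:
  assumes "0 \<le> r" "r < 1"
  shows "dyadic (dyadic_index r) \<le> r" "r < dyadic (Suc (dyadic_index r))"
proof -
  obtain n where n: "dyadic n \<le> r" "r < dyadic (Suc n)" using dyadic_interval[OF assms] .
  have "dyadic_index r = n" unfolding dyadic_index_def
  proof (rule Least_equality)
    show "r < dyadic (Suc n)" by (rule n)
    fix m assume "r < dyadic (Suc m)"
    then show "n \<le> m" using n(1) dyadic_mono[of "Suc m" n] by (intro leI notI) auto
  qed
  then show "dyadic (dyadic_index r) \<le> r" "r < dyadic (Suc (dyadic_index r))" using n by auto
qed

lemma dyadic_index_measurable: "dyadic_index \<in> borel \<rightarrow>\<^sub>M count_space UNIV"
  unfolding dyadic_index_def by measurable

lemma dyadic_index_eq_iff: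
  assumes "0 \<le> r" "r < 1"
  shows "dyadic_index r = n \<longleftrightarrow> r \<in> {dyadic n..<dyadic (Suc n)}"
  using dyadic_index[OF assms] dyadic_interval_unique[of "dyadic_index r" r n] by auto

lemma nn_integral_dyadic_step:
  fixes s :: "nat \<Rightarrow> real"
  assumes mu: "sets \<mu> = sets borel" and s: "\<And>n. 0 \<le> s n"
  shows "(\<integral>\<^sup>+r\<in>{0..<1}. ennreal (s (dyadic_index r)) \<partial>\<mu>) = (\<Sum>n. ennreal (s n) * emeasure \<mu> {dyadic n..<dyadic (Suc n)})"
proof -
  have [measurable]: "{dyadic n..<dyadic (Suc n)} \<in> sets \<mu>" for n unfolding mu by simp
  have "(\<integral>\<^sup>+r\<in>{0..<1}. ennreal (s (dyadic_index r)) \<partial>\<mu>) = (\<integral>\<^sup>+r. (\<Sum>n. ennreal (s n) * indicator {dyadic n..<dyadic (Suc n)} r) \<partial>\<mu>)"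
  proof (intro nn_integral_cong)
    fix r :: real
    show "ennreal (s (dyadic_index r)) * indicator {0..<1} r = (\<Sum>n. ennreal (s n) * indicator {dyadic n..<dyadic (Suc n)} r)"
    proof (cases "r \<in> {0..<1}")
      case True
      define F where "F n = ennreal (s n) * indicator {dyadic n..<dyadic (Suc n)} r" for n
      have "(\<Sum>n. F n) = (\<Sum>n\<in>{dyadic_index r}. F n)"
      proof (rule suminf_finite)
        fix n assume "n \<notin> {dyadic_index r}"
        then have "r \<notin> {dyadic n..<dyadic (Suc n)}" using dyadic_index_eq_iff[of r n] True by auto
        then show "F n = 0" by (simp add: F_def)
      qed simp
      also have "\<dots> = F (dyadic_index r)" by simp
      also have "\<dots> = ennreal (s (dyadic_index r)) * indicator {0..<1} r"
        using True dyadic_index[of r] by (simp add: F_def)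
      finally show ?thesis by (simp add: F_def)
    next
      case False
      then have "r \<notin> {dyadic n..<dyadic (Suc n)}" for n using dyadic(1)[of n] dyadic(2)[of "Suc n"] by auto
      then show ?thesis using False by simp
    qed
  qed
  also have "\<dots> = (\<Sum>n. ennreal (s n) * emeasure \<mu> {dyadic n..<dyadic (Suc n)})"
    by (subst nn_integral_suminf) (auto simp: nn_integral_cmult_indicator)
  finally show ?thesis .
qed

theorem theorem3:
  fixes p q :: real and \<nu> :: "complex \<Rightarrow> real"
  assumes "1 \<le> p" and "0 < q" and "\<nu> \<in> D_two_sided \<inter> D_hat_sub q"
  shows "\<exists>C1>0. \<exists>C2>0. \<forall>f\<in>hardy_space p.
    mixed_norm_power p q \<nu> (deriv f) \<le> ennreal C1 * (F1 p q \<nu> f + F2 p q \<nu> f) \<and>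
    ennreal C1 * (F1 p q \<nu> f + F2 p q \<nu> f)
      \<le> ennreal C2 * (mixed_norm_power p q \<nu> (deriv f) + ennreal (hardy_norm p f powr q))"
proof -
  note p = assms(1) and q = assms(2) and nu = assms(3)
  have D1: "\<nu> \<in> D_hat" using nu by (simp add: D_two_sided_def)
  have nn: "\<And>z. z \<in> ball 0 1 \<Longrightarrow> 0 \<le> \<nu> z" using D1 unfolding D_hat_def weight_def by blast
  from radial_measure[OF D1] obtain \<mu> :: "real measure" where M: "sets \<mu> = sets borel \<and> emeasure \<mu> {0..<1} < \<infinity> \<and>
    (\<forall>r\<in>{0..<1}. tail \<nu> r = emeasure \<mu> {r..<1}) \<and>
    (\<forall>a. set_borel_measurable borel {0..<1} a \<longrightarrow> (\<forall>r\<in>{0..<1}. 0 \<le> a r) \<longrightarrow>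
      (\<integral>\<^sup>+r\<in>{0..<1}. ennreal (a r * \<nu> (of_real r)) \<partial>lebesgue) = (\<integral>\<^sup>+r\<in>{0..<1}. ennreal (a r) \<partial>\<mu>))"
    by (rule exE)
  note M3 = M[THEN conjunct2, THEN conjunct2, THEN conjunct1]
    and M4 = M[THEN conjunct2, THEN conjunct2, THEN conjunct2]
  have mu: "sets \<mu> = sets borel" "emeasure \<mu> {0..<1} < \<infinity>"
    by (rule M[THEN conjunct1]) (rule M[THEN conjunct2, THEN conjunct1])
  have mu3: "tail \<nu> r = emeasure \<mu> {r..<1}" if "r \<in> {0..<1}" for r
    by (rule bspec[OF M3 that])
  have mu4: "(\<integral>\<^sup>+r\<in>{0..<1}. ennreal (a r * \<nu> (of_real r)) \<partial>lebesgue) = (\<integral>\<^sup>+r\<in>{0..<1}. ennreal (a r) \<partial>\<mu>)"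
    if "set_borel_measurable borel {0..<1} a" "\<And>r. r \<in> {0..<1} \<Longrightarrow> 0 \<le> a r" for a :: "real \<Rightarrow> real"
    by (rule M4[rule_format, OF that])
  define V where "V = (\<lambda>n. measure \<mu> {dyadic n..<1})"
  have W: "\<And>n. 0 < V n" "decseq V" "\<And>n. emeasure \<mu> {dyadic n..<dyadic (Suc n)} = ennreal (V n - V (n + 1))"
    "\<exists>c m. 1 < c \<and> 0 < m \<and> (\<forall>n. c * V (n + m) \<le> V n)"
    "\<exists>K>0. \<forall>n. (\<Sum>k<n. 2 powr (real k * q) * (V k - V (k + 1))) \<le> K * (2 powr (real n * q) * V n)"
    "\<exists>L>0. \<forall>n. V n \<le> L * V (Suc n)"
    unfolding V_def by (rule weight_sequence[OF nu q mu mu3 mu4]; assumption)+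
  obtain c m where c: "1 < c" "0 < m" "\<And>n. c * V (n + m) \<le> V n" using W(4) by blast
  obtain K where K: "K > 0" "\<And>n. (\<Sum>k<n. 2 powr (real k * q) * (V k - V (k + 1))) \<le> K * (2 powr (real n * q) * V n)"
    using W(5) by blast
  obtain L where L: "L > 0" "\<And>n. V n \<le> L * V (Suc n)" using W(6) by blast
  from weighted_hardy_inequality[OF W(1,2) c q K L] obtain C where CC: "C > 0 \<and> (\<forall>M X N. (\<forall>n. 0 \<le> M n) \<longrightarrow> incseq M \<longrightarrow>
      (\<forall>N. (\<Sum>n<N. M n powr q * (V n - V (n + 1))) \<le> X) \<longrightarrow> summable (\<lambda>k. M (Suc k) / 2 ^ Suc k) \<and>
      (\<Sum>n<N. (\<Sum>j\<le>n. 2 ^ j * (\<Sum>k. if j \<le> k then M (Suc k) / 2 ^ Suc k else 0)) powr q * (V n - V (n + 1))) \<le> C * X)"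
    by (rule exE)
  note C = CC[THEN conjunct1] CC[THEN conjunct2, rule_format]
  \<comment> \<open>All constants are fixed before \<open>f\<close> appears: \<open>C\<close>
    through the weight and \<open>q\<close>, \<open>C1\<close> and \<open>A\<close> through
    \<open>p\<close> and \<open>q\<close>.\<close>
  define C1 where "C1 = 4 powr q * 2 powr (q / p)"
  define A where "A = (2 * pi) powr (q / p) * 18432 powr q"
  \<comment> \<open>The 2 accounts for \<open>F1\<close> and \<open>F2\<close>, each bounded by A C
    times the mixed norm.\<close>
  define C2 where "C2 = C1 * (2 * (A * C))"
  have C10: "C1 > 0" by (simp add: C1_def)
  have A0: "A > 0" by (simp add: A_def)
  have C20: "C2 > 0" using C10 A0 C(1) by (simp add: C2_def)
  have dV: "0 \<le> V n - V (n + 1)" for n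
    unfolding diff_ge_0_iff_ge by (rule decseqD[OF W(2)]) (rule le_add1)
  have second: "F1 p q \<nu> f + F2 p q \<nu> f \<le> ennreal (2 * (A * C)) * mixed_norm_power p q \<nu> (deriv f)"
    if "hardy1 f B" and fin: "mixed_norm_power p q \<nu> (deriv f) \<noteq> \<infinity>" for f B
  proof -
    interpret hardy1 f B by fact
    have df: "deriv f holomorphic_on ball 0 1" by (intro holomorphic_deriv f open_ball)
    define M where "M n = pmean p (deriv f) (dyadic n)" for n
    obtain X where X: "mixed_norm_power p q \<nu> (deriv f) = ennreal X" "0 \<le> X"
      using fin by (cases "mixed_norm_power p q \<nu> (deriv f)") auto
    have M0: "0 \<le> M n" for n by (simp add: M_def pmean_nonneg)
    have incM: "incseq M" unfolding M_def
      by (intro incseq_SucI pmean_mono df p dyadic dyadic_mono) simp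
    have step_m: "set_borel_measurable borel {0..<1} (\<lambda>r. s (dyadic_index r))" for s :: "nat \<Rightarrow> real"
      unfolding set_borel_measurable_def using dyadic_index_measurable by measurable
    \<comment> \<open>The means of the derivative increase with the radius, so their values at the
      inner radii of the rings form a lower step function.\<close>
    have low: "(\<Sum>n<N. M n powr q * (V n - V (n + 1))) \<le> X" for N
    proof -
      have "ennreal (\<Sum>n<N. M n powr q * (V n - V (n + 1))) = (\<Sum>n<N. ennreal (M n powr q) * emeasure \<mu> {dyadic n..<dyadic (Suc n)})"
        using dV by (simp add: W(3) ennreal_mult flip: sum_ennreal)
      also have "\<dots> \<le> (\<Sum>n. ennreal (M n powr q) * emeasure \<mu> {dyadic n..<dyadic (Suc n)})"
        by (intro sum_le_suminf summableI) auto
      also have "\<dots> = (\<integral>\<^sup>+r\<in>{0..<1}. ennreal (M (dyadic_index r) powr q) \<partial>\<mu>)"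
        by (rule nn_integral_dyadic_step[OF mu(1), symmetric]) simp
      also have "\<dots> = (\<integral>\<^sup>+r\<in>{0..<1}. ennreal (M (dyadic_index r) powr q * \<nu> (of_real r)) \<partial>lebesgue)"
        by (rule mu4[symmetric]) (rule step_m, simp)
      also have "\<dots> \<le> mixed_norm_power p q \<nu> (deriv f)"
        unfolding mixed_norm_power_def
      proof (intro nn_integral_mono)
        fix r :: real
        show "ennreal (M (dyadic_index r) powr q * \<nu> (of_real r)) * indicator {0..<1} r
          \<le> ennreal (integral_mean p r (deriv f) powr q * \<nu> (of_real r)) * indicator {0..<1} r"
        proof (cases "r \<in> {0..<1}")
          case True
          have "M (dyadic_index r) powr q \<le> integral_mean p r (deriv f) powr q"
            using True q dyadic_index[of r] by (simp add: integral_mean_eq_pmean[OF df] M_def)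
              (intro powr_mono2 pmean_mono df p dyadic pmean_nonneg, auto)
          then have "M (dyadic_index r) powr q * \<nu> (of_real r) \<le> integral_mean p r (deriv f) powr q * \<nu> (of_real r)"
            using True nn[of "of_real r"] by (intro mult_right_mono) auto
          from ennreal_leI[OF this] show ?thesis using True by simp
        qed simp
      qed
      finally show ?thesis using X by (simp add: ennreal_le_iff)
    qed
    note H = C(2)[OF M0 incM low]
    have summ: "summable (\<lambda>k. M (Suc k) / 2 ^ Suc k)" using H by blast
    \<comment> \<open>Summability is itself a conclusion of the Hardy inequality, drawn from the
      finiteness of the mixed norm.\<close>
    interpret hardy1_summable f B p
      by unfold_locales (use p summ in \<open>simp_all add: M_def\<close>)
    have S: "(\<Sum>n<N. Sb n powr q * (V n - V (n + 1))) \<le> C * X" for N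
      using H[of N] unfolding Sb_def Psi_def M_def by blast
    \<comment> \<open>Conversely an upper step function, integrated ring by ring.\<close>
    have up: "(\<integral>\<^sup>+r\<in>{0..<1}. ennreal (u r * \<nu> (of_real r)) \<partial>lebesgue) \<le> ennreal (A * (C * X))"
      if u: "\<And>n r. dyadic n \<le> r \<Longrightarrow> r < dyadic (Suc n) \<Longrightarrow> u r \<le> A * Sb n powr q" for u
    proof -
      have "(\<integral>\<^sup>+r\<in>{0..<1}. ennreal (u r * \<nu> (of_real r)) \<partial>lebesgue)
        \<le> (\<integral>\<^sup>+r\<in>{0..<1}. ennreal (A * Sb (dyadic_index r) powr q * \<nu> (of_real r)) \<partial>lebesgue)"
      proof (intro nn_integral_mono)
        fix r :: real
        show "ennreal (u r * \<nu> (of_real r)) * indicator {0..<1} r \<le> ennreal (A * Sb (dyadic_index r) powr q * \<nu> (of_real r)) * indicator {0..<1} r"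
        proof (cases "r \<in> {0..<1}")
          case True
          then have "u r * \<nu> (of_real r) \<le> A * Sb (dyadic_index r) powr q * \<nu> (of_real r)"
            using nn[of "of_real r"] dyadic_index[of r] by (intro mult_right_mono u) auto
          from ennreal_leI[OF this] show ?thesis using True by simp
        qed simp
      qed
      also have "\<dots> = (\<integral>\<^sup>+r\<in>{0..<1}. ennreal (A * Sb (dyadic_index r) powr q) \<partial>\<mu>)"
        by (rule mu4) (rule step_m, use A0 in simp)
      also have "\<dots> = (\<Sum>n. ennreal (A * Sb n powr q) * emeasure \<mu> {dyadic n..<dyadic (Suc n)})"
        by (rule nn_integral_dyadic_step[OF mu(1), of "\<lambda>n. A * Sb n powr q"]) (use A0 in simp)
      also have "\<dots> \<le> ennreal (A * (C * X))"
      proof (rule suminf_le_const[OF summableI])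
        fix N
        have "(\<Sum>n<N. ennreal (A * Sb n powr q) * emeasure \<mu> {dyadic n..<dyadic (Suc n)}) = ennreal (\<Sum>n<N. A * Sb n powr q * (V n - V (n + 1)))"
          using dV A0 by (simp add: W(3) ennreal_mult flip: sum_ennreal)
        also have "\<dots> \<le> ennreal (A * (C * X))"
        proof (rule ennreal_leI)
          have "(\<Sum>n<N. A * Sb n powr q * (V n - V (n + 1))) = A * (\<Sum>n<N. Sb n powr q * (V n - V (n + 1)))"
            by (simp add: sum_distrib_left mult.assoc)
          also have "\<dots> \<le> A * (C * X)" using A0 by (intro mult_left_mono S) auto
          finally show "(\<Sum>n<N. A * Sb n powr q * (V n - V (n + 1))) \<le> A * (C * X)" .
        qed
        finally show "(\<Sum>n<N. ennreal (A * Sb n powr q) * emeasure \<mu> {dyadic n..<dyadic (Suc n)}) \<le> ennreal (A * (C * X))" .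
      qed
      finally show ?thesis .
    qed
    have "F1 p q \<nu> f \<le> ennreal (A * (C * X))"
      unfolding F1_eq by (rule up) (unfold A_def, rule profiles_le(1)[OF q])
    moreover have "F2 p q \<nu> f \<le> ennreal (A * (C * X))"
      unfolding F2_eq by (rule up) (unfold A_def, rule profiles_le(2)[OF q])
    ultimately have "F1 p q \<nu> f + F2 p q \<nu> f \<le> ennreal (A * (C * X)) + ennreal (A * (C * X))"
      by (rule add_mono)
    also have "\<dots> = ennreal (A * (C * X) + A * (C * X))"
      using A0 C(1) X(2) by (intro ennreal_plus[symmetric]) auto
    also have "A * (C * X) + A * (C * X) = 2 * (A * C) * X" by simp
    also have "ennreal (2 * (A * C) * X) = ennreal (2 * (A * C)) * ennreal X"
      using A0 C(1) X(2) by (intro ennreal_mult) auto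
    finally show ?thesis by (simp only: X(1))
  qed
  show ?thesis
  proof (rule exI[of _ C1], rule conjI[OF C10], rule exI[of _ C2], rule conjI[OF C20], rule ballI)
    fix f assume "f \<in> hardy_space p"
    then obtain B where H: "hardy1 f B" using hardy_space_imp_hardy1[OF _ p] by blast
    let ?X = "mixed_norm_power p q \<nu> (deriv f)"
    have first: "?X \<le> ennreal C1 * (F1 p q \<nu> f + F2 p q \<nu> f)"
      unfolding C1_def by (rule hardy1.mixed_norm_le_F1_F2[OF H p q nn mu(1) mu4])
    have "ennreal C1 * (F1 p q \<nu> f + F2 p q \<nu> f) \<le> ennreal C2 * (?X + ennreal (hardy_norm p f powr q))"
    \<comment> \<open>An infinite mixed norm makes the right side infinite because C2 > 0; the
      finite case is the one in which the series of means converges.\<close>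
    proof (cases "?X = \<infinity>")
      case True
      then show ?thesis using C20 by (simp add: ennreal_mult_top)
    next
      case False
      have "ennreal C1 * (F1 p q \<nu> f + F2 p q \<nu> f) \<le> ennreal C1 * (ennreal (2 * (A * C)) * ?X)"
        by (intro mult_left_mono second[OF H False]) auto
      also have "\<dots> = ennreal C2 * ?X"
        unfolding C2_def using C10 A0 C(1) by (simp add: ennreal_mult mult.assoc)
      also have "\<dots> \<le> ennreal C2 * (?X + ennreal (hardy_norm p f powr q))"
        by (intro mult_left_mono) auto
      finally show ?thesis .
    qed
    with first show "?X \<le> ennreal C1 * (F1 p q \<nu> f + F2 p q \<nu> f) \<and>
      ennreal C1 * (F1 p q \<nu> f + F2 p q \<nu> f) \<le> ennreal C2 * (?X + ennreal (hardy_norm p f powr q))" ..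
  qed
qed

end
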